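(* Let $G$ be a polycyclic group. The algebraic factors of any group shift on $G$ can be effectively computed: there is an algorithm which, given a group shift $X\subset\Sigma_1^G$ (by a finite set of forbidden patterns and the finite group $\Sigma_1$) and a local rule of a shift-commuting continuous group homomorphism $f$ from $X$ onto a group shift $Y\subset\Sigma_2^G$ (with the finite group $\Sigma_2$ given), outputs a finite set of forbidden patterns defining $Y=f(X)$.
   Context: For a finite alphabet $\Sigma$, $G$ acts on $\Sigma^G$ by $(gx)_h=x_{g^{-1}h}$; a subshift is a closed $G$-invariant subset of $\Sigma^G$. If $\Sigma$ is a finite group, a group shift is a subshift $X\subset\Sigma^G$ closed under the cellwise group operations of $\Sigma$ (a nonempty subgroup of $\Sigma^G$). A finite set of patterns (elements of $\Sigma^D$, $D\subset G$ finite) defines the subshift of all points of $\Sigma^G$ containing no translate of any of these patterns. A local rule of a continuous shift-commuting map $f$ consists of a finite $N\subset G$ and a function computing $f(x)_e$ from $x|N$. An algebraic factor of $X$ is the image $f(X)$ under such a homomorphism. *)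

theory Defs
  imports
    "HOL-Analysis.Function_Topology"
    "HOL-Algebra.Elementary_Groups"
    "HOL-Algebra.Product_Groups"
    "HOL-Library.Nat_Bijection"
begin

section \<open>Algorithms\<close>

text \<open>
  Algorithms are Kleene's partial recursive functions on the natural numbers.
  \<open>partial_recursive n f\<close> is about the values of \<open>f\<close> on argument lists of length \<open>n\<close>; the values on
  lists of other lengths are meaningless.  \<open>None\<close> stands for divergence.
\<close>

definition minimization :: "(nat list \<Rightarrow> nat option) \<Rightarrow> nat list \<Rightarrow> nat option" where
  "minimization f xs =
    (if \<exists>m. f (m # xs) = Some 0 \<and> (\<forall>k<m. f (k # xs) \<noteq> None)
     then Some (LEAST m. f (m # xs) = Some 0) else None)"

inductive partial_recursive :: "nat \<Rightarrow> (nat list \<Rightarrow> nat option) \<Rightarrow> bool" where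
  zero: "partial_recursive n (\<lambda>xs. Some 0)"
| succ: "partial_recursive 1 (\<lambda>xs. Some (Suc (hd xs)))"
| proj: "i < n \<Longrightarrow> partial_recursive n (\<lambda>xs. Some (xs ! i))"
| comp: "partial_recursive (length gs) f \<Longrightarrow> (\<And>g. g \<in> set gs \<Longrightarrow> partial_recursive n g) \<Longrightarrow>
    partial_recursive n (\<lambda>xs. Option.bind (those (map (\<lambda>g. g xs) gs)) f)"
| prim_rec: "partial_recursive n f \<Longrightarrow> partial_recursive (Suc (Suc n)) g \<Longrightarrow>
    partial_recursive (Suc n)
      (\<lambda>xs. rec_nat (f (tl xs)) (\<lambda>k r. Option.bind r (\<lambda>v. g (k # v # tl xs))) (hd xs))"
| mu: "partial_recursive (Suc n) f \<Longrightarrow> partial_recursive n (minimization f)"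


section \<open>Polycyclic groups\<close>

definition polycyclic :: "('g, 'b) monoid_scheme \<Rightarrow> bool" where
  "polycyclic G \<longleftrightarrow> group G \<and>
    (\<exists>(n::nat) H. H 0 = {\<one>\<^bsub>G\<^esub>} \<and> H n = carrier G \<and>
      (\<forall>i\<le>n. subgroup (H i) G) \<and>
      (\<forall>i<n. H i \<lhd> G\<lparr>carrier := H (Suc i)\<rparr> \<and>
              cyclic_group (G\<lparr>carrier := H (Suc i)\<rparr> Mod H i)))"


section \<open>Group shifts\<close>

text \<open>
  Points of $\Sigma^G$ are the elements of \<open>carrier G \<rightarrow>\<^sub>E \<Sigma>\<close>, that is, functions that are
  \<open>undefined\<close> outside \<open>carrier G\<close>.
\<close>

definition full_shift_topology :: "('g, 'b) monoid_scheme \<Rightarrow> 'a set \<Rightarrow> ('g \<Rightarrow> 'a) topology" where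
  "full_shift_topology G \<Sigma> = product_topology (\<lambda>_. discrete_topology \<Sigma>) (carrier G)"

definition shift :: "('g, 'b) monoid_scheme \<Rightarrow> 'g \<Rightarrow> ('g \<Rightarrow> 'a) \<Rightarrow> 'g \<Rightarrow> 'a" where
  "shift G g x = (\<lambda>h\<in>carrier G. x (inv\<^bsub>G\<^esub> g \<otimes>\<^bsub>G\<^esub> h))"

definition subshift :: "('g, 'b) monoid_scheme \<Rightarrow> 'a set \<Rightarrow> ('g \<Rightarrow> 'a) set \<Rightarrow> bool" where
  "subshift G \<Sigma> X \<longleftrightarrow> finite \<Sigma> \<and> closedin (full_shift_topology G \<Sigma>) X \<and>
    (\<forall>g\<in>carrier G. \<forall>x\<in>X. shift G g x \<in> X)"

definition cellwise_group ::
    "('g, 'b) monoid_scheme \<Rightarrow> ('a, 'c) monoid_scheme \<Rightarrow> ('g \<Rightarrow> 'a) monoid" where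
  "cellwise_group G \<Sigma> = product_group (carrier G) (\<lambda>_. \<Sigma>)"

definition group_shift ::
    "('g, 'b) monoid_scheme \<Rightarrow> ('a, 'c) monoid_scheme \<Rightarrow> ('g \<Rightarrow> 'a) set \<Rightarrow> bool" where
  "group_shift G \<Sigma> X \<longleftrightarrow> group \<Sigma> \<and> subshift G (carrier \<Sigma>) X \<and> subgroup X (cellwise_group G \<Sigma>)"

definition group_shift_hom ::
    "('g, 'b) monoid_scheme \<Rightarrow> ('a, 'c) monoid_scheme \<Rightarrow> ('g \<Rightarrow> 'a) set \<Rightarrow>
     ('a2, 'c2) monoid_scheme \<Rightarrow> ('g \<Rightarrow> 'a2) set \<Rightarrow> (('g \<Rightarrow> 'a) \<Rightarrow> ('g \<Rightarrow> 'a2)) \<Rightarrow> bool" where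
  "group_shift_hom G \<Sigma>\<^sub>1 X \<Sigma>\<^sub>2 Y f \<longleftrightarrow>
    f \<in> hom ((cellwise_group G \<Sigma>\<^sub>1)\<lparr>carrier := X\<rparr>) ((cellwise_group G \<Sigma>\<^sub>2)\<lparr>carrier := Y\<rparr>) \<and>
    continuous_map (subtopology (full_shift_topology G (carrier \<Sigma>\<^sub>1)) X)
                   (subtopology (full_shift_topology G (carrier \<Sigma>\<^sub>2)) Y) f \<and>
    (\<forall>g\<in>carrier G. \<forall>x\<in>X. f (shift G g x) = shift G g (f x))"

definition is_pattern :: "('g, 'b) monoid_scheme \<Rightarrow> 'a set \<Rightarrow> ('g \<rightharpoonup> 'a) \<Rightarrow> bool" where
  "is_pattern G \<Sigma> p \<longleftrightarrow> finite (dom p) \<and> dom p \<subseteq> carrier G \<and> ran p \<subseteq> \<Sigma>"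

text \<open>\<open>x\<close> contains the translate of \<open>p\<close> by \<open>g\<close>, which has domain \<open>g D\<close> if \<open>p\<close> has domain \<open>D\<close>.\<close>

definition occurs_at ::
    "('g, 'b) monoid_scheme \<Rightarrow> ('g \<rightharpoonup> 'a) \<Rightarrow> ('g \<Rightarrow> 'a) \<Rightarrow> 'g \<Rightarrow> bool" where
  "occurs_at G p x g \<longleftrightarrow> (\<forall>h\<in>dom p. p h = Some (x (g \<otimes>\<^bsub>G\<^esub> h)))"

definition shift_avoiding ::
    "('g, 'b) monoid_scheme \<Rightarrow> 'a set \<Rightarrow> ('g \<rightharpoonup> 'a) set \<Rightarrow> ('g \<Rightarrow> 'a) set" where
  "shift_avoiding G \<Sigma> F =
    {x \<in> carrier G \<rightarrow>\<^sub>E \<Sigma>. \<forall>p\<in>F. \<forall>g\<in>carrier G. \<not> occurs_at G p x g}"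

text \<open>
  A local rule \<open>(N, \<phi>)\<close> for \<open>f\<close> on \<open>X\<close>.  The function \<open>\<phi>\<close> on \<open>N\<close>-patterns may be partial, as long as
  it is defined on the restrictions to \<open>N\<close> of all points of \<open>X\<close>.
\<close>

definition local_rule ::
    "('g, 'b) monoid_scheme \<Rightarrow> 'a set \<Rightarrow> 'a2 set \<Rightarrow> ('g \<Rightarrow> 'a) set \<Rightarrow> (('g \<Rightarrow> 'a) \<Rightarrow> ('g \<Rightarrow> 'a2)) \<Rightarrow>
     'g set \<Rightarrow> (('g \<Rightarrow> 'a) \<rightharpoonup> 'a2) \<Rightarrow> bool" where
  "local_rule G \<Sigma>\<^sub>1 \<Sigma>\<^sub>2 X f N \<phi> \<longleftrightarrow>
    finite N \<and> N \<subseteq> carrier G \<and> dom \<phi> \<subseteq> (N \<rightarrow>\<^sub>E \<Sigma>\<^sub>1) \<and> ran \<phi> \<subseteq> \<Sigma>\<^sub>2 \<and>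
    (\<forall>x\<in>X. \<phi> (restrict x N) = Some (f x \<one>\<^bsub>G\<^esub>))"


section \<open>Finite descriptions\<close>

text \<open>
  Elements of \<open>G\<close> are given by words over a fixed finite list \<open>gs\<close> of generators;
  the letter \<open>(i, True)\<close> stands for \<open>gs ! i\<close> and \<open>(i, False)\<close> for its inverse.
\<close>

type_synonym word = "(nat \<times> bool) list"

definition letter_value :: "('g, 'b) monoid_scheme \<Rightarrow> 'g list \<Rightarrow> nat \<times> bool \<Rightarrow> 'g" where
  "letter_value G gs l = (if snd l then gs ! fst l else inv\<^bsub>G\<^esub> (gs ! fst l))"

definition word_value :: "('g, 'b) monoid_scheme \<Rightarrow> 'g list \<Rightarrow> word \<Rightarrow> 'g" where
  "word_value G gs w = foldr (\<lambda>l a. letter_value G gs l \<otimes>\<^bsub>G\<^esub> a) w \<one>\<^bsub>G\<^esub>"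

definition is_word :: "'g list \<Rightarrow> word \<Rightarrow> bool" where
  "is_word gs w \<longleftrightarrow> (\<forall>l\<in>set w. fst l < length gs)"

text \<open>A finite group, up to isomorphism one on an initial segment of the natural numbers, is given
  by its multiplication table.\<close>

type_synonym table = "nat list list"

definition table_describes :: "table \<Rightarrow> nat monoid \<Rightarrow> bool" where
  "table_describes T \<Sigma> \<longleftrightarrow> group \<Sigma> \<and> carrier \<Sigma> = {..<length T} \<and>
    (\<forall>r\<in>set T. length r = length T) \<and>
    (\<forall>a<length T. \<forall>b<length T. T ! a ! b = a \<otimes>\<^bsub>\<Sigma>\<^esub> b)"

text \<open>
  Distinct words may have the same value; a list of word-symbol pairs describes a pattern only if
  the relation between group elements and symbols that it lists is single-valued.
\<close>

type_synonym pattern_desc = "(word \<times> nat) list"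

definition pattern_describes ::
    "('g, 'b) monoid_scheme \<Rightarrow> 'g list \<Rightarrow> nat set \<Rightarrow> pattern_desc \<Rightarrow> ('g \<rightharpoonup> nat) \<Rightarrow> bool" where
  "pattern_describes G gs \<Sigma> d p \<longleftrightarrow> is_pattern G \<Sigma> p \<and> (\<forall>(w, s)\<in>set d. is_word gs w) \<and>
    Map.graph p = (\<lambda>(w, s). (word_value G gs w, s)) ` set d"

definition patterns_describe ::
    "('g, 'b) monoid_scheme \<Rightarrow> 'g list \<Rightarrow> nat set \<Rightarrow> pattern_desc list \<Rightarrow> ('g \<rightharpoonup> nat) set \<Rightarrow> bool" where
  "patterns_describe G gs \<Sigma> ds F \<longleftrightarrow>
    (\<exists>ps. list_all2 (pattern_describes G gs \<Sigma>) ds ps \<and> F = set ps)"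

text \<open>
  A local rule \<open>(N, \<phi>)\<close> is given by a list of words for the elements of \<open>N\<close> and a lookup table for
  \<open>\<phi>\<close>, whose keys list the symbols of an \<open>N\<close>-pattern in the order of the words.
\<close>

type_synonym rule_desc = "word list \<times> (nat list \<times> nat) list"

definition rule_describes ::
    "('g, 'b) monoid_scheme \<Rightarrow> 'g list \<Rightarrow> nat set \<Rightarrow> rule_desc \<Rightarrow>
     'g set \<Rightarrow> (('g \<Rightarrow> nat) \<rightharpoonup> nat) \<Rightarrow> bool" where
  "rule_describes G gs \<Sigma>\<^sub>1 r N \<phi> \<longleftrightarrow> (case r of (ws, R) \<Rightarrow>
    (\<forall>w\<in>set ws. is_word gs w) \<and> N = word_value G gs ` set ws \<and>
    (\<forall>u \<in> N \<rightarrow>\<^sub>E \<Sigma>\<^sub>1. \<phi> u = map_of R (map (\<lambda>w. u (word_value G gs w)) ws)))"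


section \<open>Numerical codes of finite descriptions\<close>

definition pair_code :: "('a \<Rightarrow> nat) \<Rightarrow> ('b \<Rightarrow> nat) \<Rightarrow> 'a \<times> 'b \<Rightarrow> nat" where
  "pair_code c d z = prod_encode (c (fst z), d (snd z))"

definition list_code :: "('a \<Rightarrow> nat) \<Rightarrow> 'a list \<Rightarrow> nat" where
  "list_code c xs = list_encode (map c xs)"

definition word_code :: "word \<Rightarrow> nat" where
  "word_code = list_code (pair_code id of_bool)"

definition table_code :: "table \<Rightarrow> nat" where
  "table_code = list_code (list_code id)"

definition patterns_code :: "pattern_desc list \<Rightarrow> nat" where
  "patterns_code = list_code (list_code (pair_code word_code id))"

definition rule_code :: "rule_desc \<Rightarrow> nat" where
  "rule_code = pair_code (list_code word_code) (list_code (pair_code (list_code id) id))"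

definition input_code :: "table \<Rightarrow> pattern_desc list \<Rightarrow> table \<Rightarrow> rule_desc \<Rightarrow> nat" where
  "input_code T\<^sub>1 ds T\<^sub>2 r = list_encode [table_code T\<^sub>1, patterns_code ds, table_code T\<^sub>2, rule_code r]"

end

theory Submission
  imports Defs "HOL-Library.Diagonal_Subsequence"
begin

text \<open>
  Replace \<open>G\<close> by a group of codes with computable multiplication, and put a point of \<open>X\<close> on layer 0 and its
  image on layer 1: the graph of \<open>f\<close> is then an effectively given group shift of finite type. Candidates
  for \<open>Y\<close> are searched exhaustively. That \<open>Y\<close> lies in a candidate shift is semidecidable by compactness, so
  what matters is a semidecision procedure for the converse, that every point of the candidate extends
  to a point of the graph.

  Such a procedure, and the fact that group shifts are of finite type, pass from a normal subgroup \<open>N\<close> to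
  a cyclic extension by \<open>t\<close>. If the quotient is infinite, cut the configurations into the levels \<open>t\<^sup>k N\<close>.
  An extension over finitely many levels can be continued upwards and downwards one level at a time as
  soon as three extension statements over \<open>N\<close> hold for windows of finitely many levels; for group
  shifts, compactness bounds the size of the windows that are needed. The certificates are sound for
  arbitrary candidates, and the group structure enters only in the proof that a certificate exists, so
  the search never has to test whether a candidate is a group shift.
\<close>

text \<open>For general shifts of finite type it can be undecidable whether an admissible pattern
  extends to a point, so certificates have to come from algebra. Their source is a finiteness
  statement proved along the same cyclic tower (\<open>markov\<close>): a closed invariant subgroup
  that depends on finitely many cells is given by one finite rule on those cells. Up to relabelling,
  finitely many levels of an extension of N are finitely many layers over N. Restricting a group
  shift to a window of levels therefore gives a group shift over N, which the induction hypothesis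
  turns into finite data. These rules are the contents of a certificate, and the extension
  statements about them are again statements over N. A finite quotient needs no continuation, since
  all its levels fit into one window. The tower must also produce the codes of the group. Products
  in an extension involve conjugation by t; it is computable because every homomorphism from a coded
  group to an effective group is (\<open>homlift\<close>), a property that is carried along the
  tower.\<close>

section \<open>Total recursive functions\<close>

definition total_rec :: "nat \<Rightarrow> (nat list \<Rightarrow> nat) \<Rightarrow> bool" where
  "total_rec n F \<longleftrightarrow> (\<exists>g. partial_recursive n g \<and> (\<forall>xs. length xs = n \<longrightarrow> g xs = Some (F xs)))"

lemma total_rec_cong:
  assumes "total_rec n F" "\<And>xs. length xs = n \<Longrightarrow> F xs = F' xs"
  shows "total_rec n F'"
  using assms unfolding total_rec_def by auto

lemma total_rec_proj: "i < n \<Longrightarrow> total_rec n (\<lambda>xs. xs ! i)"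
  unfolding total_rec_def using partial_recursive.proj by blast

lemma total_rec_zero: "total_rec n (\<lambda>xs. 0)"
  unfolding total_rec_def using partial_recursive.zero by blast

lemma those_map_Some: "(\<And>x. x \<in> set xs \<Longrightarrow> f x = Some (g x)) \<Longrightarrow> those (map f xs) = Some (map g xs)"
  by (induction xs) auto

lemma total_rec_comp:
  assumes "total_rec (length Gs) F" "\<And>G. G \<in> set Gs \<Longrightarrow> total_rec n G"
  shows "total_rec n (\<lambda>xs. F (map (\<lambda>G. G xs) Gs))"
proof -
  obtain f where f: "partial_recursive (length Gs) f"
    "\<And>xs. length xs = length Gs \<Longrightarrow> f xs = Some (F xs)"
    using assms(1) unfolding total_rec_def by blast
  obtain c where c: "\<And>G. G \<in> set Gs \<Longrightarrow> partial_recursive n (c G)"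
    "\<And>G xs. G \<in> set Gs \<Longrightarrow> length xs = n \<Longrightarrow> c G xs = Some (G xs)"
    using assms(2) unfolding total_rec_def by metis
  have pr: "partial_recursive n (\<lambda>xs. Option.bind (those (map (\<lambda>g. g xs) (map c Gs))) f)"
    by (rule partial_recursive.comp) (use f c in auto)
  have "those (map (\<lambda>g. g xs) (map c Gs)) = Some (map (\<lambda>G. G xs) Gs)" if "length xs = n" for xs
    unfolding map_map o_def by (rule those_map_Some) (use c that in auto)
  then show ?thesis
    unfolding total_rec_def
    by (intro exI[of _ "\<lambda>xs. Option.bind (those (map (\<lambda>g. g xs) (map c Gs))) f"] conjI pr)
      (simp add: f(2))
qed

lemma total_rec_comp1:
  assumes "total_rec 1 (\<lambda>ys. f (ys ! 0))" "total_rec n A"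
  shows "total_rec n (\<lambda>xs. f (A xs))"
  using total_rec_comp[of "[A]" "\<lambda>ys. f (ys ! 0)" n] assms by simp

lemma total_rec_comp2:
  assumes "total_rec 2 (\<lambda>ys. f (ys ! 0) (ys ! 1))" "total_rec n A" "total_rec n B"
  shows "total_rec n (\<lambda>xs. f (A xs) (B xs))"
  using total_rec_comp[of "[A, B]" "\<lambda>ys. f (ys ! 0) (ys ! 1)" n] assms
  by (auto simp: numeral_2_eq_2)

lemma total_rec_Suc: "total_rec 1 (\<lambda>xs. Suc (xs ! 0))"
  unfolding total_rec_def
  by (rule exI[where x = "\<lambda>xs. Some (Suc (hd xs))"])
    (auto intro: partial_recursive.succ[simplified] simp: length_Suc_conv)

lemma total_rec_const: "total_rec n (\<lambda>xs. c)"
  by (induction c) (auto intro: total_rec_zero total_rec_comp1[OF total_rec_Suc])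

lemma total_rec_rec_nat:
  assumes "total_rec n F" "total_rec (Suc (Suc n)) G"
  shows "total_rec (Suc n) (\<lambda>xs. rec_nat (F (tl xs)) (\<lambda>k r. G (k # r # tl xs)) (hd xs))"
proof -
  obtain f where f: "partial_recursive n f" "\<And>xs. length xs = n \<Longrightarrow> f xs = Some (F xs)"
    using assms(1) unfolding total_rec_def by blast
  obtain g where g: "partial_recursive (Suc (Suc n)) g"
    "\<And>xs. length xs = Suc (Suc n) \<Longrightarrow> g xs = Some (G xs)"
    using assms(2) unfolding total_rec_def by blast
  have "rec_nat (f (tl xs)) (\<lambda>k r. Option.bind r (\<lambda>v. g (k # v # tl xs))) m
      = Some (rec_nat (F (tl xs)) (\<lambda>k r. G (k # r # tl xs)) m)" if "length xs = Suc n" for m xs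
    using that by (induction m) (auto simp: f g)
  then show ?thesis
    unfolding total_rec_def using partial_recursive.prim_rec[OF f(1) g(1)] by blast
qed

lemma total_rec_Least:
  assumes "total_rec (Suc n) F" "\<And>xs. length xs = n \<Longrightarrow> \<exists>m. F (m # xs) = 0"
  shows "total_rec n (\<lambda>xs. LEAST m. F (m # xs) = 0)"
proof -
  obtain f where f: "partial_recursive (Suc n) f"
    "\<And>xs. length xs = Suc n \<Longrightarrow> f xs = Some (F xs)"
    using assms(1) unfolding total_rec_def by blast
  have "minimization f xs = Some (LEAST m. F (m # xs) = 0)" if "length xs = n" for xs
    using assms(2)[OF that] that by (auto simp: minimization_def f)
  then show ?thesis
    unfolding total_rec_def using partial_recursive.mu[OF f(1)] by blast
qed

lemma length_2_conv: "length xs = 2 \<longleftrightarrow> (\<exists>a b. xs = [a, b])"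
  by (auto simp: numeral_2_eq_2 length_Suc_conv)

lemma total_rec_rec_nat2:
  assumes "total_rec 1 (\<lambda>xs. f (xs ! 0))" "total_rec 3 (\<lambda>xs. g (xs ! 0) (xs ! 1) (xs ! 2))"
  shows "total_rec 2 (\<lambda>xs. rec_nat (f (xs ! 1)) (\<lambda>k r. g k r (xs ! 1)) (xs ! 0))"
proof -
  have "total_rec (Suc 1) (\<lambda>xs. rec_nat (f (tl xs ! 0))
      (\<lambda>k r. g ((k # r # tl xs) ! 0) ((k # r # tl xs) ! 1) ((k # r # tl xs) ! 2)) (hd xs))"
    using total_rec_rec_nat[of 1 "\<lambda>xs. f (xs ! 0)" "\<lambda>xs. g (xs ! 0) (xs ! 1) (xs ! 2)"] assms
    by (simp add: numeral_3_eq_3)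
  then have "total_rec 2 (\<lambda>xs. rec_nat (f (tl xs ! 0))
      (\<lambda>k r. g ((k # r # tl xs) ! 0) ((k # r # tl xs) ! 1) ((k # r # tl xs) ! 2)) (hd xs))"
    by (simp add: numeral_2_eq_2)
  then show ?thesis
    by (rule total_rec_cong) (auto simp: length_2_conv)
qed

lemma total_rec_rec_nat1:
  assumes "total_rec 2 (\<lambda>xs. g (xs ! 0) (xs ! 1))"
  shows "total_rec 1 (\<lambda>xs. rec_nat c g (xs ! 0))"
  using total_rec_comp2[OF total_rec_rec_nat2[where f = "\<lambda>_. c" and g = "\<lambda>a b _. g a b"],
      where A = "\<lambda>xs. xs ! 0" and B = "\<lambda>xs. xs ! 0" and n = 1]
  by (simp add: total_rec_const total_rec_proj total_rec_comp2[OF assms])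

section \<open>Arithmetic and the Cantor pairing\<close>

lemma total_rec_add: "total_rec 2 (\<lambda>xs. xs ! 0 + xs ! 1)"
proof -
  have "rec_nat b (\<lambda>k r. Suc r) a = a + b" for a b :: nat
    by (induction a) auto
  moreover have "total_rec 2 (\<lambda>xs. rec_nat (xs ! 1) (\<lambda>k r. Suc r) (xs ! 0))"
    by (rule total_rec_rec_nat2[where f = "\<lambda>x. x" and g = "\<lambda>a b c. Suc b"])
      (auto intro!: total_rec_proj total_rec_comp1[OF total_rec_Suc])
  ultimately show ?thesis by simp
qed

lemma total_rec_mult: "total_rec 2 (\<lambda>xs. xs ! 0 * xs ! 1)"
proof -
  have "rec_nat 0 (\<lambda>k r. r + b) a = a * b" for a b :: nat
    by (induction a) auto
  moreover have "total_rec 2 (\<lambda>xs. rec_nat 0 (\<lambda>k r. r + xs ! 1) (xs ! 0))"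
    by (rule total_rec_rec_nat2[where f = "\<lambda>x. 0" and g = "\<lambda>a b c. b + c"])
      (auto intro!: total_rec_proj total_rec_const total_rec_comp2[OF total_rec_add])
  ultimately show ?thesis by simp
qed

lemma total_rec_pred: "total_rec 1 (\<lambda>xs. xs ! 0 - 1)"
proof -
  have "rec_nat 0 (\<lambda>k r. k) a = a - 1" for a :: nat
    by (induction a) auto
  moreover have "total_rec 1 (\<lambda>xs. rec_nat 0 (\<lambda>k r. k) (xs ! 0))"
    by (rule total_rec_rec_nat1) (auto intro!: total_rec_proj)
  ultimately show ?thesis by simp
qed

lemma total_rec_diff: "total_rec 2 (\<lambda>xs. xs ! 0 - xs ! 1)"
proof -
  have "rec_nat b (\<lambda>k r. r - 1) a = b - a" for a b :: nat
    by (induction a) auto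
  moreover have "total_rec 2 (\<lambda>xs. rec_nat (xs ! 1) (\<lambda>k r. r - 1) (xs ! 0))"
    by (rule total_rec_rec_nat2[where f = "\<lambda>x. x" and g = "\<lambda>a b c. b - 1"])
      (auto intro!: total_rec_proj total_rec_comp1[OF total_rec_pred, simplified])
  ultimately have "total_rec 2 (\<lambda>xs. xs ! 1 - xs ! 0)" by simp
  \<comment> \<open>The recursion consumes argument 0, which here is the subtrahend; swapping the
    projections restores the order.\<close>
  from total_rec_comp2[OF this total_rec_proj total_rec_proj, of 1 2 0]
  show ?thesis by simp
qed

lemma total_rec_triangle: "total_rec 1 (\<lambda>xs. triangle (xs ! 0))"
proof -
  have "rec_nat 0 (\<lambda>k r. r + Suc k) a = triangle a" for a :: nat
    by (induction a) auto
  moreover have "total_rec 1 (\<lambda>xs. rec_nat 0 (\<lambda>k r. r + Suc k) (xs ! 0))"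
    by (rule total_rec_rec_nat1)
      (auto intro!: total_rec_proj total_rec_comp1[OF total_rec_Suc] total_rec_comp2[OF total_rec_add] simp del: add_Suc_right)
  ultimately show ?thesis by simp
qed

lemma total_rec_prod_encode: "total_rec 2 (\<lambda>xs. prod_encode (xs ! 0, xs ! 1))"
  unfolding prod_encode_def prod.case
  by (intro total_rec_comp2[OF total_rec_add] total_rec_comp1[OF total_rec_triangle] total_rec_proj) auto

text \<open>The Cantor code of (a, b) is \<open>triangle (a + b) + a\<close>, so the diagonal a + b
  determines both components arithmetically; it is the only part of \<open>prod_decode\<close> that
  needs a search.\<close>

definition diag_index :: "nat \<Rightarrow> nat" where
  "diag_index z = fst (prod_decode z) + snd (prod_decode z)"

lemma triangle_mono: "a \<le> b \<Longrightarrow> triangle a \<le> triangle b"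
  by (induction b) (auto simp: le_Suc_eq)

lemma prod_decode_via_diag:
  "fst (prod_decode z) = z - triangle (diag_index z)"
  "snd (prod_decode z) = diag_index z - (z - triangle (diag_index z))"
proof -
  obtain a b where ab: "prod_decode z = (a, b)" by force
  then have "z = prod_encode (a, b)" by (metis prod_decode_inverse)
  then show "fst (prod_decode z) = z - triangle (diag_index z)"
    "snd (prod_decode z) = diag_index z - (z - triangle (diag_index z))"
    using ab by (auto simp: diag_index_def prod_encode_def)
qed

text \<open>The diagonal of z is the largest w with triangle w <= z, hence the first w with z <
  triangle (w + 1). The truncated difference vanishes exactly then, which is the form that
  minimization wants.\<close>

lemma diag_index_eq: "diag_index z = (LEAST w. Suc z - triangle (Suc w) = 0)"
proof -
  obtain a b where ab: "prod_decode z = (a, b)" by force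
  then have z: "z = prod_encode (a, b)" by (metis prod_decode_inverse)
  have "(LEAST w. Suc z - triangle (Suc w) = 0) = a + b"
  proof (rule Least_equality)
    show "Suc z - triangle (Suc (a + b)) = 0"
      by (simp add: z prod_encode_def)
    fix y assume "Suc z - triangle (Suc y) = 0"
    then have "triangle (a + b) < triangle (Suc y)"
      by (simp add: z prod_encode_def)
    then show "a + b \<le> y"
      using triangle_mono[of "Suc y" "a + b"] by linarith
  qed
  then show ?thesis by (simp add: diag_index_def ab)
qed

lemma total_rec_diag_index: "total_rec 1 (\<lambda>xs. diag_index (xs ! 0))"
proof -
  let ?F = "\<lambda>xs. Suc (xs ! 1) - triangle (Suc (xs ! 0))"
  have "total_rec (Suc 1) ?F"
    by (intro total_rec_comp2[OF total_rec_diff] total_rec_comp1[OF total_rec_Suc]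
        total_rec_comp1[OF total_rec_triangle] total_rec_proj) auto
  moreover have "\<exists>m. ?F (m # xs) = 0" if "length xs = 1" for xs
  proof -
    have "z \<le> triangle z" for z by (induction z) auto
    then have "?F (xs ! 0 # xs) = 0"
      by (simp add: le_SucI trans_le_add2)
    then show ?thesis by blast
  qed
  ultimately have "total_rec 1 (\<lambda>xs. LEAST m. ?F (m # xs) = 0)"
    by (rule total_rec_Least)
  then show ?thesis by (simp add: diag_index_eq)
qed

lemma total_rec_fst: "total_rec 1 (\<lambda>xs. fst (prod_decode (xs ! 0)))"
  and total_rec_snd: "total_rec 1 (\<lambda>xs. snd (prod_decode (xs ! 0)))"
  unfolding prod_decode_via_diag
  by (intro total_rec_comp2[OF total_rec_diff] total_rec_diag_index
        total_rec_comp1[OF total_rec_triangle] total_rec_proj; simp)+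

section \<open>Computable functions between encoded types\<close>

text \<open>Codes are bijections with the natural numbers: decoding is then computable for free, and
  a search through a type is a search through all numbers. A finite type such as \<open>bool\<close>
  cannot be an instance, so predicates go through \<open>of_bool\<close> and the letters of words
  are recoded.\<close>

class encodable =
  fixes enc :: "'a \<Rightarrow> nat" and dec :: "nat \<Rightarrow> 'a"
  assumes dec_enc [simp]: "dec (enc x) = x" and enc_dec [simp]: "enc (dec n) = n"

lemma enc_inject [simp]: "enc x = enc y \<longleftrightarrow> x = y"
  by (metis dec_enc)

instantiation nat :: encodable
begin
definition enc_nat :: "nat \<Rightarrow> nat" where [simp]: "enc_nat n = n"
definition dec_nat :: "nat \<Rightarrow> nat" where [simp]: "dec_nat n = n"
instance by standard auto
end

instantiation int :: encodable
begin
definition enc_int :: "int \<Rightarrow> nat" where "enc_int = int_encode"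
definition dec_int :: "nat \<Rightarrow> int" where "dec_int = int_decode"
instance by standard (auto simp: enc_int_def dec_int_def)
end

instantiation prod :: (encodable, encodable) encodable
begin
definition enc_prod :: "'a \<times> 'b \<Rightarrow> nat" where
  "enc_prod p = prod_encode (enc (fst p), enc (snd p))"
definition dec_prod :: "nat \<Rightarrow> 'a \<times> 'b" where
  "dec_prod n = (dec (fst (prod_decode n)), dec (snd (prod_decode n)))"
instance by standard (auto simp: enc_prod_def dec_prod_def)
end

instantiation list :: (encodable) encodable
begin
definition enc_list :: "'a list \<Rightarrow> nat" where "enc_list xs = list_encode (map enc xs)"
definition dec_list :: "nat \<Rightarrow> 'a list" where "dec_list n = map dec (list_decode n)"
instance by standard (auto simp: enc_list_def dec_list_def map_idI)
end

definition computable :: "('a::encodable \<Rightarrow> 'b::encodable) \<Rightarrow> bool" where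
  "computable f \<longleftrightarrow> total_rec 1 (\<lambda>xs. enc (f (dec (xs ! 0))))"

named_theorems comp_intro

lemma computable_compose:
  assumes "computable f" "computable g"
  shows "computable (\<lambda>x. f (g x))"
  using total_rec_comp1[where f = "\<lambda>n. enc (f (dec n))" and A = "\<lambda>xs. enc (g (dec (xs ! 0)))" and n = 1] assms
  by (simp add: computable_def)

lemma computable_id [comp_intro]: "computable (\<lambda>x. x)"
  by (simp add: computable_def total_rec_proj)

lemma computable_const [comp_intro]: "computable (\<lambda>x. c)"
  by (simp add: computable_def total_rec_const)

lemma computable_Pair [comp_intro]:
  assumes "computable f" "computable g"
  shows "computable (\<lambda>x. (f x, g x))"
  using assms by (auto simp: computable_def enc_prod_def intro: total_rec_comp2[OF total_rec_prod_encode])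

lemma computable_fst [comp_intro]:
  assumes "computable f" shows "computable (\<lambda>x. fst (f x))"
proof (rule computable_compose[OF _ assms])
  show "computable (fst :: 'b \<times> 'c \<Rightarrow> 'b)"
    by (simp add: computable_def dec_prod_def total_rec_fst[simplified])
qed

lemma computable_snd [comp_intro]:
  assumes "computable f" shows "computable (\<lambda>x. snd (f x))"
proof (rule computable_compose[OF _ assms])
  show "computable (snd :: 'b \<times> 'c \<Rightarrow> 'c)"
    by (simp add: computable_def dec_prod_def total_rec_snd[simplified])
qed

lemma computable_apply2:
  assumes "computable (\<lambda>p. h (fst p) (snd p))" "computable f" "computable g"
  shows "computable (\<lambda>x. h (f x) (g x))"
  using computable_compose[OF assms(1) computable_Pair[OF assms(2,3)]] by simp

lemma computable_nat2:
  fixes h :: "nat \<Rightarrow> nat \<Rightarrow> nat"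
  assumes "total_rec 2 (\<lambda>xs. h (xs ! 0) (xs ! 1))" "computable f" "computable g"
  shows "computable (\<lambda>x. h (f x) (g x))"
  using total_rec_comp2[OF assms(1) assms(2,3)[unfolded computable_def]]
  by (simp add: computable_def)

lemma computable_Suc [comp_intro]:
  "computable f \<Longrightarrow> computable (\<lambda>x. Suc (f x))"
  by (auto simp: computable_def intro: total_rec_comp1[OF total_rec_Suc])

lemmas computable_add [comp_intro] = computable_nat2[OF total_rec_add]
lemmas computable_diff [comp_intro] = computable_nat2[OF total_rec_diff]
lemmas computable_mult [comp_intro] = computable_nat2[OF total_rec_mult]

lemma computable_rec_nat [comp_intro]:
  fixes g :: "'a::encodable \<Rightarrow> nat \<Rightarrow> 'b::encodable \<Rightarrow> 'b"
  assumes "computable f" "computable (\<lambda>p. g (fst p) (fst (snd p)) (snd (snd p)))" "computable n"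
  shows "computable (\<lambda>x. rec_nat (f x) (g x) (n x))"
proof -
  let ?f = "\<lambda>a. enc (f (dec a))" and ?g = "\<lambda>k r a. enc (g (dec a) k (dec r))"
  have "total_rec 3 (\<lambda>xs. ?g (xs ! 0) (xs ! 1) (xs ! 2))"
  proof -
    have "total_rec 3 (\<lambda>xs. prod_encode (xs ! 2, prod_encode (xs ! 0, xs ! 1)))"
      by (intro total_rec_comp2[OF total_rec_prod_encode] total_rec_proj) auto
    from total_rec_comp1[OF assms(2)[unfolded computable_def] this]
    show ?thesis by (simp add: dec_prod_def)
  qed
  moreover have "total_rec 1 (\<lambda>xs. ?f (xs ! 0))"
    using assms(1) by (simp add: computable_def)
  ultimately have "total_rec 2 (\<lambda>xs. rec_nat (?f (xs ! 1)) (\<lambda>k r. ?g k r (xs ! 1)) (xs ! 0))"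
    by (intro total_rec_rec_nat2)
  from total_rec_comp2[OF this assms(3)[unfolded computable_def] total_rec_proj[of 0 1]]
  have "total_rec 1 (\<lambda>xs. rec_nat (?f (xs ! 0)) (\<lambda>k r. ?g k r (xs ! 0)) (n (dec (xs ! 0))))"
    by simp
  moreover have "rec_nat (?f a) (\<lambda>k r. ?g k r a) m = enc (rec_nat (f (dec a)) (g (dec a)) m)" for a m
    by (induction m) auto
  ultimately show ?thesis by (simp add: computable_def)
qed

definition decidable :: "('a::encodable \<Rightarrow> bool) \<Rightarrow> bool" where
  "decidable P \<longleftrightarrow> computable (\<lambda>x. of_bool (P x) :: nat)"

lemma decidable_compose: "decidable P \<Longrightarrow> computable f \<Longrightarrow> decidable (\<lambda>x. P (f x))"
  unfolding decidable_def by (rule computable_compose)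

lemma decidable_not [comp_intro]:
  assumes "decidable P" shows "decidable (\<lambda>x. \<not> P x)"
proof -
  have "of_bool (\<not> P x) = 1 - (of_bool (P x) :: nat)" for x by simp
  then show ?thesis
    using assms unfolding decidable_def by (simp only:) (intro comp_intro)
qed

lemma decidable_conj [comp_intro]:
  assumes "decidable P" "decidable Q" shows "decidable (\<lambda>x. P x \<and> Q x)"
  using computable_mult[OF assms[unfolded decidable_def]]
  by (simp add: decidable_def of_bool_conj)

lemma decidable_disj [comp_intro]:
  assumes "decidable P" "decidable Q" shows "decidable (\<lambda>x. P x \<or> Q x)"
  using decidable_not[OF decidable_conj[OF decidable_not[OF assms(1)] decidable_not[OF assms(2)]]] by simp

lemma decidable_imp [comp_intro]:
  assumes "decidable P" "decidable Q" shows "decidable (\<lambda>x. P x \<longrightarrow> Q x)"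
  unfolding imp_conv_disj by (rule decidable_disj[OF decidable_not[OF assms(1)] assms(2)])

lemma decidable_le [comp_intro]:
  fixes f :: "'a::encodable \<Rightarrow> nat"
  assumes "computable f" "computable g" shows "decidable (\<lambda>x. f x \<le> g x)"
proof -
  have "of_bool (f x \<le> g x) = 1 - (f x - g x)" for x by auto
  then show ?thesis unfolding decidable_def by (simp only:) (intro comp_intro assms)
qed

lemma decidable_less [comp_intro]:
  fixes f :: "'a::encodable \<Rightarrow> nat"
  assumes "computable f" "computable g" shows "decidable (\<lambda>x. f x < g x)"
  using decidable_le[OF computable_Suc[OF assms(1)] assms(2)] by (simp add: Suc_le_eq)

lemma computable_enc [comp_intro]: "computable f \<Longrightarrow> computable (\<lambda>x. enc (f x))"
  by (simp add: computable_def)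

lemma decidable_eq [comp_intro]:
  assumes "computable f" "computable g" shows "decidable (\<lambda>x. f x = g x)"
proof -
  have "f x = g x \<longleftrightarrow> enc (f x) \<le> enc (g x) \<and> enc (g x) \<le> enc (f x)" for x
    by (metis enc_inject le_antisym order_refl)
  then show ?thesis by (simp only:) (intro comp_intro assms)
qed

text \<open>A case distinction is a primitive recursion that runs zero times or once.\<close>

lemma computable_If [comp_intro]:
  assumes "decidable P" "computable f" "computable g"
  shows "computable (\<lambda>x. if P x then f x else g x)"
proof -
  have "(if P x then f x else g x) = rec_nat (g x) (\<lambda>_ _. f x) (of_bool (P x))" for x by simp
  moreover have "computable (\<lambda>x. rec_nat (g x) (\<lambda>_ _. f x) (of_bool (P x)))"
    by (rule computable_rec_nat[OF assms(3) computable_compose[OF assms(2)] assms(1)[unfolded decidable_def]])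
      (intro comp_intro)
  ultimately show ?thesis by simp
qed

lemma computable_Least:
  assumes "decidable (\<lambda>p. P (fst p) (snd p))" "\<And>x. \<exists>k. P x k"
  shows "computable (\<lambda>x. LEAST k::nat. P x k)"
proof -
  let ?F = "\<lambda>xs. 1 - of_bool (P (dec (xs ! 1)) (xs ! 0)) :: nat"
  have "total_rec (Suc 1) ?F"
  proof (rule total_rec_comp2[OF total_rec_diff total_rec_const])
    have "total_rec (Suc 1) (\<lambda>xs. prod_encode (xs ! 1, xs ! 0))"
      by (intro total_rec_comp2[OF total_rec_prod_encode] total_rec_proj) auto
    from total_rec_comp1[OF assms(1)[unfolded decidable_def computable_def] this]
    show "total_rec (Suc 1) (\<lambda>xs. of_bool (P (dec (xs ! 1)) (xs ! 0)))"
      by (simp add: dec_prod_def)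
  qed
  then have "total_rec 1 (\<lambda>xs. LEAST m. ?F (m # xs) = 0)"
  proof (rule total_rec_Least)
    fix xs :: "nat list"
    obtain k where "P (dec (xs ! 0)) k" using assms(2) by blast
    then show "\<exists>m. ?F (m # xs) = 0" by (intro exI[of _ k]) auto
  qed
  moreover have "(1 - of_bool Q = (0::nat)) = Q" for Q by simp
  ultimately show ?thesis by (simp only: computable_def enc_nat_def nth_Cons_0 nth_Cons_Suc One_nat_def)
qed

lemma decidable_ex_less [comp_intro]:
  fixes P :: "'a::encodable \<Rightarrow> nat \<Rightarrow> bool"
  assumes "decidable (\<lambda>p. P (fst p) (snd p))" "computable f"
  shows "decidable (\<lambda>x. \<exists>k<f x. P x k)"
proof -
  have eq: "(\<exists>k<m. P x k) \<longleftrightarrow> rec_nat (0::nat) (\<lambda>k r. if P x k then 1 else r) m = 1" for x and m :: nat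
    by (induction m) (auto simp: less_Suc_eq simp del: One_nat_def)
  show ?thesis
    unfolding eq
    by (intro decidable_eq computable_rec_nat computable_If comp_intro assms(2)
        decidable_compose[OF assms(1), of "\<lambda>p. (fst p, fst (snd p))", simplified])
qed

lemma computable_div [comp_intro]:
  fixes f :: "'a::encodable \<Rightarrow> nat"
  assumes "computable f" "computable g" shows "computable (\<lambda>x. f x div g x)"
proof -
  \<comment> \<open>The disjunct \<open>b = 0\<close> ends the search at 0, the value that HOL gives
    to division by zero.\<close>
  have "(LEAST q. b = 0 \<or> a < Suc q * b) = a div b" for a b :: nat
  proof (cases "b = 0")
    case False
    show ?thesis
    proof (rule Least_equality)
      show "b = 0 \<or> a < Suc (a div b) * b"
        using False dividend_less_div_times[of b a] by simp
      fix q assume "b = 0 \<or> a < Suc q * b"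
      then show "a div b \<le> q"
        using False less_mult_imp_div_less[of a "Suc q" b] by simp
    qed
  qed (auto intro: Least_equality)
  moreover have "computable (\<lambda>p. LEAST q. snd p = 0 \<or> fst p < Suc q * (snd p :: nat))"
  proof (rule computable_Least)
    show "\<exists>q. snd p = 0 \<or> fst p < Suc q * snd p" for p :: "nat \<times> nat"
      by (intro exI[of _ "fst p"]) (cases "snd p"; auto)
  qed (intro comp_intro)
  ultimately have "computable (\<lambda>p. fst p div (snd p :: nat))" by simp
  from computable_apply2[OF this assms] show ?thesis .
qed

lemma computable_mod [comp_intro]:
  fixes f :: "'a::encodable \<Rightarrow> nat"
  assumes "computable f" "computable g" shows "computable (\<lambda>x. f x mod g x)"
  unfolding modulo_nat_def by (intro comp_intro assms)

lemma decidable_all_less [comp_intro]: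
  fixes P :: "'a::encodable \<Rightarrow> nat \<Rightarrow> bool"
  assumes "decidable (\<lambda>p. P (fst p) (snd p))" "computable f"
  shows "decidable (\<lambda>x. \<forall>k<f x. P x k)"
  using decidable_not[OF decidable_ex_less[OF decidable_not[OF assms(1)] assms(2)]] by simp

subsection \<open>Lists\<close>

lemma enc_Nil [simp]: "enc [] = 0"
  by (simp add: enc_list_def)

lemma enc_Cons [simp]: "enc (x # xs) = Suc (prod_encode (enc x, enc xs))"
  by (simp add: enc_list_def)

lemma computable_Cons [comp_intro]:
  assumes "computable f" "computable g" shows "computable (\<lambda>x. f x # g x)"
  using computable_Suc[OF computable_nat2[OF total_rec_prod_encode computable_enc[OF assms(1)] computable_enc[OF assms(2)]]]
  by (simp add: computable_def)

lemma dec_list_0: "dec 0 = []" and dec_list_Suc: "dec (Suc n) = dec (fst (prod_decode n)) # dec (snd (prod_decode n))"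
  by (simp_all add: dec_list_def case_prod_beta)

lemma computable_tl [comp_intro]:
  assumes "computable f" shows "computable (\<lambda>x. tl (f x))"
proof (rule computable_compose[OF _ assms])
  have "enc (tl (dec n :: 'b list)) = snd (prod_decode (n - 1))" for n
    \<comment> \<open>For the empty list the truncated predecessor is 0 again. A component never
      exceeds its pair code, so the second component of 0 is 0, the code of the empty list.\<close>
    using le_prod_encode_2[of "snd (prod_decode 0)" "fst (prod_decode 0)"]
    by (cases n) (simp_all add: dec_list_0 dec_list_Suc)
  then show "computable (tl :: 'b list \<Rightarrow> 'b list)"
    using total_rec_comp1[OF total_rec_snd total_rec_pred] by (simp add: computable_def)
qed

lemma computable_hd [comp_intro]:
  assumes "computable f" shows "computable (\<lambda>x. hd (f x))"
proof (rule computable_compose[OF _ assms])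
  have "computable (\<lambda>n. if n = 0 then enc (hd [] :: 'b) else fst (dec (n - 1) :: nat \<times> nat))"
  proof (intro computable_If decidable_eq comp_intro)
    have "computable (\<lambda>n. dec n :: nat \<times> nat)"
      by (simp add: computable_def total_rec_proj)
    from computable_compose[OF this computable_diff[OF computable_id computable_const]]
    show "computable (\<lambda>n. dec (n - 1) :: nat \<times> nat)" .
  qed
  moreover have "enc (hd (dec n :: 'b list)) = (if n = 0 then enc (hd [] :: 'b) else fst (dec (n - 1) :: nat \<times> nat))" for n
    by (cases n) (simp_all add: dec_list_0 dec_list_Suc dec_prod_def)
  ultimately show "computable (hd :: 'b list \<Rightarrow> 'b)"
    by (simp only: computable_def dec_nat_def enc_nat_def)
qed

lemma length_le_enc: "length xs \<le> enc xs"
proof (induction xs)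
  case (Cons x xs)
  then show ?case
    using le_prod_encode_2[of "enc xs" "enc x"] by simp
qed simp

text \<open>Primitive recursion on a state made of the remaining list and the accumulator. The code
  of a list bounds its length, so it serves as the number of rounds; rounds after the list is
  exhausted change nothing.\<close>

lemma computable_fold [comp_intro]:
  assumes "computable (\<lambda>p. g (fst p) (fst (snd p)) (snd (snd p)))" "computable l" "computable a"
  shows "computable (\<lambda>x. fold (g x) (l x) (a x))"
proof -
  define step where "step x s = (if fst s = [] then s else (tl (fst s), g x (hd (fst s)) (snd s)))" for x and s :: "_ list \<times> _"
  have step: "step x ([], c) = ([], c)" "step x (z # zs, c) = (zs, g x z c)" for x c z zs
    by (simp_all add: step_def)
  have nil: "rec_nat ([], c) (\<lambda>_. step x) n = ([], c)" for x n c
    by (induction n) (auto simp: step)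
  have shift: "rec_nat s (\<lambda>_. step x) (Suc n) = rec_nat (step x s) (\<lambda>_. step x) n" for x s n
    by (induction n) auto
  have run: "length ys \<le> n \<Longrightarrow> rec_nat (ys, c) (\<lambda>_. step x) n = ([], fold (g x) ys c)" for x ys n c
  proof (induction n arbitrary: ys c)
    case (Suc n)
    show ?case
    proof (cases ys)
      case Nil then show ?thesis by (simp add: nil step)
    next
      case (Cons z zs)
      then show ?thesis unfolding shift using Suc by (simp add: step)
    qed
  qed simp
  have "computable (\<lambda>x. snd (rec_nat (l x, a x) (\<lambda>_. step x) (enc (l x))))"
    unfolding step_def
    by (intro comp_intro assms computable_compose[OF assms(1),
          of "\<lambda>p. (fst p, hd (fst (snd (snd p))), snd (snd (snd p)))", simplified])
  then show ?thesis by (simp add: run length_le_enc)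
qed

lemma computable_rev [comp_intro]:
  assumes "computable f" shows "computable (\<lambda>x. rev (f x))"
  unfolding rev_conv_fold by (intro comp_intro assms)

lemma computable_foldr [comp_intro]:
  assumes "computable (\<lambda>p. g (fst p) (fst (snd p)) (snd (snd p)))" "computable l" "computable a"
  shows "computable (\<lambda>x. foldr (g x) (l x) (a x))"
  unfolding foldr_conv_fold by (intro comp_intro assms)

lemma computable_append [comp_intro]:
  assumes "computable f" "computable g" shows "computable (\<lambda>x. f x @ g x)"
proof -
  have "xs @ ys = foldr (\<lambda>y r. y # r) xs ys" for xs ys :: "'b list"
    by (induction xs) auto
  then show ?thesis by (simp only:) (intro comp_intro assms)
qed

lemma computable_map [comp_intro]:
  assumes "computable (\<lambda>p. h (fst p) (snd p))" "computable l"
  shows "computable (\<lambda>x. map (h x) (l x))"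
proof -
  have "map f xs = foldr (\<lambda>y r. f y # r) xs []" for f :: "'b \<Rightarrow> 'c" and xs
    by (induction xs) auto
  then show ?thesis
    by (simp only:) (intro comp_intro assms computable_compose[OF assms(1),
          of "\<lambda>p. (fst p, fst (snd p))", simplified])
qed

lemma computable_filter [comp_intro]:
  assumes "decidable (\<lambda>p. P (fst p) (snd p))" "computable l"
  shows "computable (\<lambda>x. filter (P x) (l x))"
proof -
  have "filter f xs = foldr (\<lambda>y r. if f y then y # r else r) xs []" for f :: "'b \<Rightarrow> bool" and xs
    by (induction xs) auto
  then show ?thesis
    by (simp only:) (intro comp_intro assms decidable_compose[OF assms(1),
          of "\<lambda>p. (fst p, fst (snd p))", simplified])
qed

lemma computable_concat [comp_intro]:
  assumes "computable l" shows "computable (\<lambda>x. concat (l x))"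
  unfolding concat_conv_foldr by (intro comp_intro assms)

lemma computable_length [comp_intro]:
  assumes "computable l" shows "computable (\<lambda>x. length (l x))"
proof -
  have "length xs = foldr (\<lambda>_ n. Suc n) xs 0" for xs :: "'b list"
    by (induction xs) auto
  then show ?thesis by (simp only:) (intro comp_intro assms)
qed

lemma decidable_ball_list [comp_intro]:
  assumes "decidable (\<lambda>p. P (fst p) (snd p))" "computable l"
  shows "decidable (\<lambda>x. \<forall>y\<in>set (l x). P x y)"
proof -
  have "(\<forall>y\<in>set xs. P y) \<longleftrightarrow> filter (\<lambda>y. \<not> P y) xs = []" for P :: "'b \<Rightarrow> bool" and xs
    by (simp add: filter_empty_conv)
  then show ?thesis by (simp only:) (intro comp_intro assms)
qed

lemma decidable_bex_list [comp_intro]: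
  assumes "decidable (\<lambda>p. P (fst p) (snd p))" "computable l"
  shows "decidable (\<lambda>x. \<exists>y\<in>set (l x). P x y)"
  using decidable_not[OF decidable_ball_list[OF decidable_not[OF assms(1)] assms(2)]] by simp

lemma decidable_mem_list [comp_intro]:
  assumes "computable f" "computable l"
  shows "decidable (\<lambda>x. f x \<in> set (l x))"
proof -
  have "a \<in> set xs \<longleftrightarrow> (\<exists>y\<in>set xs. y = a)" for a :: 'b and xs by blast
  then show ?thesis
    by (simp only:) (intro comp_intro assms computable_compose[OF assms(1), of fst])
qed

lemma computable_upt [comp_intro]:
  assumes "computable f" "computable g" shows "computable (\<lambda>x. [f x..<g x])"
proof -
  have upt0: "[0..<n] = rec_nat [] (\<lambda>k r. r @ [k]) n" for n
    by (induction n) auto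
  have "[a..<b] = map (\<lambda>i. i + a) (rec_nat [] (\<lambda>k r. r @ [k]) (b - a))" for a b
  proof -
    have "[a..<b] = map (\<lambda>i. i + a) [0..<b - a]"
      by (cases "a \<le> b") (simp_all add: map_add_upt)
    then show ?thesis by (simp only: upt0)
  qed
  then show ?thesis
    by (simp only:) (intro comp_intro assms computable_compose[OF assms(1), of fst])
qed

lemma computable_drop [comp_intro]:
  assumes "computable f" "computable g" shows "computable (\<lambda>x. drop (f x) (g x))"
proof -
  have "drop n xs = rec_nat xs (\<lambda>_ r. tl r) n" for n and xs :: "'b list"
    by (induction n) (simp_all add: drop_Suc flip: tl_drop)
  then show ?thesis by (simp only:) (intro comp_intro assms)
qed

lemma computable_zip [comp_intro]:
  assumes "computable f" "computable g" shows "computable (\<lambda>x. zip (f x) (g x))"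
proof -
  \<comment> \<open>The length of the result is the minimum of the two lengths, written with
    truncated subtraction only; entries are read as heads of suffixes.\<close>
  have "zip xs ys = map (\<lambda>i. (hd (drop i xs), hd (drop i ys))) [0..<length xs - (length xs - length ys)]"
    for xs :: "'b list" and ys :: "'c list"
  proof -
    have "length xs - (length xs - length ys) = min (length xs) (length ys)" by simp
    then show ?thesis by (intro nth_equalityI) (simp_all add: hd_drop_conv_nth)
  qed
  then show ?thesis
    by (simp only:) (intro comp_intro assms computable_compose[OF assms(1), of fst] computable_compose[OF assms(2), of fst])
qed

lemma decidable_distinct [comp_intro]:
  assumes "computable f" shows "decidable (\<lambda>x. distinct (f x))"
proof -
  have "distinct xs \<longleftrightarrow> (\<forall>i<length xs. \<forall>j<i. hd (drop i xs) \<noteq> hd (drop j xs))" for xs :: "'b list"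
    unfolding distinct_conv_nth
    by (auto simp: hd_drop_conv_nth) (metis hd_drop_conv_nth linorder_neqE_nat order.strict_trans)
  then show ?thesis
    by (simp only:) (intro comp_intro assms computable_compose[OF assms, of "\<lambda>p. fst (fst p)"])
qed

lemma computable_n_lists [comp_intro]:
  assumes "computable f" "computable g" shows "computable (\<lambda>x. List.n_lists (f x) (g x))"
proof -
  have "List.n_lists n xs = rec_nat [[]] (\<lambda>_ r. concat (map (\<lambda>ys. map (\<lambda>y. y # ys) xs) r)) n"
    for n and xs :: "'b list"
    by (induction n) auto
  then show ?thesis
    by (simp only:) (intro comp_intro assms computable_compose[OF assms(2), of fst]
         computable_compose[OF assms(2), of "\<lambda>p. fst (fst p)"])
qed

subsection \<open>Integers\<close>

lemma int_of_enc: "dec n = (if even n then int (n div 2) else - int (n div 2) - 1)"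
  by (simp add: dec_int_def int_decode_def sum_decode_def)

lemma enc_of_int: "enc z = (if 0 \<le> z then 2 * nat z else Suc (2 * nat (- z - 1)))"
  by (simp add: enc_int_def int_encode_def sum_encode_def)

lemma computable_nat [comp_intro]:
  assumes "computable f" shows "computable (\<lambda>x. nat (f x))"
proof (rule computable_compose[OF _ assms])
  have "computable (\<lambda>n. if n mod 2 = 0 then n div 2 else 0 :: nat)"
    by (intro comp_intro)
  moreover have "nat (dec n) = (if n mod 2 = 0 then n div 2 else 0)" for n
    by (auto simp: int_of_enc)
  ultimately show "computable nat" by (simp only: computable_def dec_nat_def enc_nat_def)
qed

lemma computable_int [comp_intro]:
  assumes "computable f" shows "computable (\<lambda>x. int (f x))"
  using computable_mult[OF computable_const[of 2] assms]
  by (simp add: computable_def enc_of_int)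

lemma computable_uminus_int [comp_intro]:
  fixes f :: "_ \<Rightarrow> int"
  assumes "computable f" shows "computable (\<lambda>x. - f x)"
proof (rule computable_compose[OF _ assms])
  have "computable (\<lambda>n. if n = 0 then 0 else if n mod 2 = 0 then n - 1 else n + 1 :: nat)"
    by (intro comp_intro)
  moreover have "enc (- dec n :: int) = (if n = 0 then 0 else if n mod 2 = 0 then n - 1 else n + 1)" for n
  proof (cases "even n")
    case True
    then obtain b where "n = 2 * b" by blast
    then show ?thesis by (cases b) (simp_all add: int_of_enc enc_of_int)
  next
    case False
    then obtain b where b: "n = Suc (2 * b)" by (metis oddE Suc_eq_plus1)
    then have "Suc (2 * b) mod 2 = 1" "(dec n :: int) = - int b - 1"
      by (simp_all add: int_of_enc)
    then show ?thesis by (simp add: b enc_of_int)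
  qed
  ultimately show "computable (uminus :: int \<Rightarrow> int)" by (simp only: computable_def dec_nat_def enc_nat_def)
qed

lemma computable_add_int [comp_intro]:
  fixes f :: "_ \<Rightarrow> int"
  assumes "computable f" "computable g" shows "computable (\<lambda>x. f x + g x)"
proof -
  have "z + w = (if nat (- z) + nat (- w) \<le> nat z + nat w
    then int ((nat z + nat w) - (nat (- z) + nat (- w)))
    else - int ((nat (- z) + nat (- w)) - (nat z + nat w)))" for z w :: int
    by (cases z; cases w) auto
  then show ?thesis by (simp only:) (intro comp_intro assms)
qed

lemma computable_diff_int [comp_intro]:
  fixes f :: "_ \<Rightarrow> int"
  assumes "computable f" "computable g" shows "computable (\<lambda>x. f x - g x)"
  using computable_add_int[OF assms(1) computable_uminus_int[OF assms(2)]] by simp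

lemma decidable_le_int [comp_intro]:
  fixes f :: "_ \<Rightarrow> int"
  assumes "computable f" "computable g" shows "decidable (\<lambda>x. f x \<le> g x)"
proof -
  have "z \<le> w \<longleftrightarrow> nat (z - w) = 0" for z w :: int by auto
  then show ?thesis by (simp only:) (intro comp_intro assms)
qed

text \<open>Adding r * nat (- z) makes z nonnegative, keeps its residue and raises the quotient by
  nat (- z), so both operations reduce to natural numbers.\<close>

lemma mod_int_via_nat:
  assumes "r > 0"
  shows "z mod int r = int (nat (z + int (r * nat (- z))) mod r)"
    and "z div int r = int (nat (z + int (r * nat (- z))) div r) - int (nat (- z))"
proof -
  have "z + int (r * nat (- z)) \<ge> 0"
  proof (cases "z < 0")
    case True
    have "int (nat (- z)) \<le> int (r * nat (- z))"
      using assms by (intro of_nat_mono) simp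
    then show ?thesis using True by linarith
  qed simp
  then have *: "int (nat (z + int (r * nat (- z)))) = z + int r * int (nat (- z))" by simp
  show "z mod int r = int (nat (z + int (r * nat (- z))) mod r)"
    unfolding zmod_int * by simp
  show "z div int r = int (nat (z + int (r * nat (- z))) div r) - int (nat (- z))"
    unfolding zdiv_int * using assms by simp
qed

lemma computable_mod_int [comp_intro]:
  assumes "computable f" shows "computable (\<lambda>x. f x mod int r)"
proof (cases "r = 0")
  case False
  then have "z mod int r = int (nat (z + int (r * nat (- z))) mod r)" for z
    using mod_int_via_nat by simp
  then show ?thesis by (simp only:) (intro comp_intro assms)
qed (use assms in simp)

lemma computable_div_int [comp_intro]:
  assumes "computable f" shows "computable (\<lambda>x. f x div int r)"
proof (cases "r = 0")
  case False
  then have "z div int r = int (nat (z + int (r * nat (- z))) div r) - int (nat (- z))" for z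
    using mod_int_via_nat by simp
  then show ?thesis by (simp only:) (intro comp_intro assms)
qed (simp add: computable_const)

section \<open>Recursively enumerable predicates\<close>

definition re_pred :: "('a::encodable \<Rightarrow> bool) \<Rightarrow> bool" where
  "re_pred P \<longleftrightarrow> (\<exists>R. decidable (\<lambda>p. R (fst p) (snd p)) \<and> (\<forall>x. P x \<longleftrightarrow> (\<exists>k::nat. R x k)))"

lemma re_pred_ex_decidable:
  fixes R :: "'a::encodable \<Rightarrow> 'b::encodable \<Rightarrow> bool"
  assumes "decidable (\<lambda>p. R (fst p) (snd p))"
  shows "re_pred (\<lambda>x. \<exists>y. R x y)"
proof -
  have dec: "computable (\<lambda>p :: 'a \<times> nat. dec (snd p) :: 'b)"
  proof (rule computable_compose[OF _ computable_snd[OF computable_id]])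
    show "computable (dec :: nat \<Rightarrow> 'b)" by (simp add: computable_def total_rec_proj)
  qed
  have "decidable (\<lambda>p :: 'a \<times> nat. R (fst p) (dec (snd p)))"
    using decidable_compose[OF assms computable_Pair[OF computable_fst[OF computable_id] dec]] by simp
  moreover have "(\<exists>y. R x y) \<longleftrightarrow> (\<exists>k. R x (dec k))" for x
    by (metis dec_enc)
  ultimately show ?thesis
    unfolding re_pred_def by (intro exI[of _ "\<lambda>x k. R x (dec k)"]) simp
qed

lemma re_pred_decidable [comp_intro]: "decidable P \<Longrightarrow> re_pred P"
  using re_pred_ex_decidable[of "\<lambda>x (_::nat). P x"] decidable_compose[of P fst]
  by (simp add: computable_fst computable_id)

lemma re_pred_ex [comp_intro]:
  fixes P :: "'a::encodable \<Rightarrow> 'b::encodable \<Rightarrow> bool"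
  assumes "re_pred (\<lambda>p. P (fst p) (snd p))"
  shows "re_pred (\<lambda>x. \<exists>y. P x y)"
proof -
  obtain R where R: "decidable (\<lambda>p. R (fst p) (snd p))"
    "\<And>p. P (fst p) (snd p) \<longleftrightarrow> (\<exists>k::nat. R p k)"
    using assms unfolding re_pred_def by auto
  have "decidable (\<lambda>p :: 'a \<times> 'b \<times> nat. R (fst p, fst (snd p)) (snd (snd p)))"
    by (rule decidable_compose[OF R(1), of "\<lambda>p. ((fst p, fst (snd p)), snd (snd p))", simplified])
      (intro comp_intro)
  then have "re_pred (\<lambda>x. \<exists>y. R (x, fst y) (snd y))"
    by (intro re_pred_ex_decidable) simp
  moreover have "(\<exists>y. P x y) \<longleftrightarrow> (\<exists>y. R (x, fst y) (snd y))" for x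
    using R(2)[of "(x, _)"] by auto
  ultimately show ?thesis by simp
qed

lemma re_pred_conj [comp_intro]:
  fixes P Q :: "'a::encodable \<Rightarrow> bool"
  assumes "re_pred P" "re_pred Q" shows "re_pred (\<lambda>x. P x \<and> Q x)"
proof -
  obtain R where R: "decidable (\<lambda>p. R (fst p) (snd p))" "\<And>x. P x \<longleftrightarrow> (\<exists>k::nat. R x k)"
    using assms(1) unfolding re_pred_def by auto
  obtain S where S: "decidable (\<lambda>p. S (fst p) (snd p))" "\<And>x. Q x \<longleftrightarrow> (\<exists>k::nat. S x k)"
    using assms(2) unfolding re_pred_def by auto
  have "decidable (\<lambda>p :: 'a \<times> nat \<times> nat. R (fst p) (fst (snd p)) \<and> S (fst p) (snd (snd p)))"
    by (intro decidable_conj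
        decidable_compose[OF R(1), of "\<lambda>p. (fst p, fst (snd p))", simplified]
        decidable_compose[OF S(1), of "\<lambda>p. (fst p, snd (snd p))", simplified]) (intro comp_intro)+
  then have "re_pred (\<lambda>x. \<exists>y. R x (fst y) \<and> S x (snd y))"
    by (intro re_pred_ex_decidable) simp
  moreover have "P x \<and> Q x \<longleftrightarrow> (\<exists>y. R x (fst y) \<and> S x (snd y))" for x
    using R(2) S(2) by auto
  ultimately show ?thesis by simp
qed

lemma re_pred_compose:
  fixes P :: "'b::encodable \<Rightarrow> bool" and f :: "'a::encodable \<Rightarrow> 'b"
  assumes "re_pred P" "computable f"
  shows "re_pred (\<lambda>x. P (f x))"
proof -
  obtain R where R: "decidable (\<lambda>p. R (fst p) (snd p))" "\<And>x. P x \<longleftrightarrow> (\<exists>k::nat. R x k)"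
    using assms unfolding re_pred_def by auto
  have "decidable (\<lambda>p :: 'a \<times> nat. R (f (fst p)) (snd p))"
    by (rule decidable_compose[OF R(1), of "\<lambda>p. (f (fst p), snd p)", simplified])
      (intro comp_intro computable_compose[OF assms(2), of fst])
  then show ?thesis
    unfolding re_pred_def R(2) by (intro exI[of _ "\<lambda>x. R (f x)"]) simp
qed

text \<open>One search runs through the codes of pairs of a candidate and a witness for it, and its
  output is the first component of the pair found. Nothing is claimed for inputs without a
  candidate, where the search diverges.\<close>

lemma re_pred_search:
  fixes P :: "'a::encodable \<Rightarrow> 'b::encodable \<Rightarrow> bool"
  assumes "re_pred (\<lambda>p. P (fst p) (snd p))"
  obtains A where "partial_recursive 1 A"
    "\<And>x. (\<exists>y. P x y) \<Longrightarrow> \<exists>y. P x y \<and> A [enc x] = Some (enc y)"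
proof -
  obtain R where R: "decidable (\<lambda>p. R (fst p) (snd p))"
    "\<And>p. P (fst p) (snd p) \<longleftrightarrow> (\<exists>k::nat. R p k)"
    using assms unfolding re_pred_def by auto
  define F :: "nat list \<Rightarrow> nat" where
    "F xs = 1 - of_bool (R (dec (xs ! 1), fst (dec (xs ! 0) :: 'b \<times> nat)) (snd (dec (xs ! 0) :: 'b \<times> nat)))" for xs
  have "total_rec 2 F"
    unfolding F_def
  proof (rule total_rec_comp2[OF total_rec_diff total_rec_const])
    have "decidable (\<lambda>p :: ('b \<times> nat) \<times> 'a. R (snd p, fst (fst p)) (snd (fst p)))"
      by (rule decidable_compose[OF R(1), of "\<lambda>p. ((snd p, fst (fst p)), snd (fst p))", simplified])
        (intro comp_intro)
    moreover have "total_rec 2 (\<lambda>xs. prod_encode (xs ! 0, xs ! 1))"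
      by (rule total_rec_prod_encode)
    ultimately show "total_rec 2 (\<lambda>xs. of_bool (R (dec (xs ! 1), fst (dec (xs ! 0) :: 'b \<times> nat)) (snd (dec (xs ! 0) :: 'b \<times> nat))))"
      using total_rec_comp1[where n = 2 and A = "\<lambda>xs. prod_encode (xs ! 0, xs ! 1)" and
          f = "\<lambda>n. enc (of_bool (R (snd (dec n :: ('b \<times> nat) \<times> 'a), fst (fst (dec n :: ('b \<times> nat) \<times> 'a)))
             (snd (fst (dec n :: ('b \<times> nat) \<times> 'a)))) :: nat)"]
      by (simp add: decidable_def computable_def dec_prod_def)
  qed
  then obtain g where g: "partial_recursive 2 g" "\<And>xs. length xs = 2 \<Longrightarrow> g xs = Some (F xs)"
    unfolding total_rec_def by blast
  have mg: "partial_recursive 1 (minimization g)"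
    by (rule partial_recursive.mu) (use g(1) in \<open>simp add: numeral_2_eq_2\<close>)
  obtain h where h: "partial_recursive 1 h" "\<And>n. h [n] = Some (fst (prod_decode n))"
    using total_rec_fst unfolding total_rec_def by force
  define A where "A = (\<lambda>xs. Option.bind (those (map (\<lambda>g. g xs) [minimization g])) h)"
  have "partial_recursive 1 A"
    unfolding A_def by (rule partial_recursive.comp) (use mg h(1) in auto)
  moreover have "\<exists>y. P x y \<and> A [enc x] = Some (enc y)" if ex: "\<exists>y. P x y" for x
  proof -
    define k where "k = (LEAST m. F [m, enc x] = 0)"
    obtain y j where "R (x, y) j" using ex R(2)[of "(x, _)"] by auto
    then have "F [enc (y, j), enc x] = 0" by (simp add: F_def)
    then have k: "F [k, enc x] = 0" unfolding k_def by (rule LeastI)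
    define y where "y = fst (dec k :: 'b \<times> nat)"
    have "R (x, y) (snd (dec k :: 'b \<times> nat))"
      using k unfolding F_def y_def
      by (cases "R (x, fst (dec k :: 'b \<times> nat)) (snd (dec k :: 'b \<times> nat))") auto
    then have "P x y" using R(2)[of "(x, y)"] by auto
    moreover have "minimization g [enc x] = Some k"
      using k by (auto simp: minimization_def g(2) k_def)
    then have "A [enc x] = Some (fst (prod_decode k))"
      by (simp add: A_def h)
    then have "A [enc x] = Some (enc y)"
      by (simp add: y_def dec_prod_def)
    ultimately show ?thesis by blast
  qed
  ultimately show ?thesis using that by blast
qed

section \<open>Shifts on sets of sites\<close>

text \<open>
  A site is a pair of (the code of) a group element and a layer; the group acts on the first
  component, and trivially where that component is not a group element, so that \<open>act\<close> is a true
  action on all sites.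
\<close>

type_synonym site = "nat \<times> nat"
type_synonym config = "site \<Rightarrow> nat"
type_synonym rules = "(site list \<times> nat list list) list"

definition act :: "nat monoid \<Rightarrow> nat \<Rightarrow> site \<Rightarrow> site" where
  "act K g p = (if fst p \<in> carrier K then (g \<otimes>\<^bsub>K\<^esub> fst p, snd p) else p)"

definition cfg :: "nat \<Rightarrow> config set" where
  "cfg s = {x. \<forall>p. x p < s}"

text \<open>\<open>B\<close> is kept apart from \<open>K\<close> because the level argument lets
  only a normal subgroup act while the sites remain those of the larger group. A rule lists allowed
  words rather than forbidden ones.\<close>

definition sol :: "nat monoid \<Rightarrow> nat set \<Rightarrow> nat \<Rightarrow> rules \<Rightarrow> config set" where
  "sol K B s cs = {x \<in> cfg s. \<forall>g\<in>B. \<forall>c\<in>set cs. map (\<lambda>p. x (act K g p)) (fst c) \<in> set (snd c)}"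

text \<open>Closedness in the product topology, expressed by finite windows.\<close>

definition closed_cfg :: "config set \<Rightarrow> bool" where
  "closed_cfg X \<longleftrightarrow> (\<forall>x. (\<forall>W. finite W \<longrightarrow> (\<exists>y\<in>X. \<forall>p\<in>W. y p = x p)) \<longrightarrow> x \<in> X)"

text \<open>The map \<open>c\<close> sorts sites into cells: with \<open>c = snd\<close> a cell is a
  layer, and for an extension it is a pair of level and layer. Sites outside the group are never
  compared.\<close>

definition agree :: "nat monoid \<Rightarrow> (site \<Rightarrow> 'c) \<Rightarrow> 'c set \<Rightarrow> config \<Rightarrow> config \<Rightarrow> bool" where
  "agree K c A x y \<longleftrightarrow> (\<forall>p. fst p \<in> carrier K \<and> c p \<in> A \<longrightarrow> x p = y p)"

definition dep :: "nat monoid \<Rightarrow> (site \<Rightarrow> 'c) \<Rightarrow> nat \<Rightarrow> 'c set \<Rightarrow> config set \<Rightarrow> bool" where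
  "dep K c s A X \<longleftrightarrow> (\<forall>x\<in>X. \<forall>y\<in>cfg s. agree K c A x y \<longrightarrow> y \<in> X)"

text \<open>The cylinder over the restriction of \<open>X\<close> to the cells \<open>A\<close>.
  Keeping arbitrary values elsewhere lets restrictions live in the same space as
  \<open>X\<close>.\<close>

definition proj :: "nat monoid \<Rightarrow> (site \<Rightarrow> 'c) \<Rightarrow> nat \<Rightarrow> 'c set \<Rightarrow> config set \<Rightarrow> config set" where
  "proj K c s A X = {y \<in> cfg s. \<exists>x\<in>X. agree K c A x y}"

definition act_inv :: "nat monoid \<Rightarrow> nat set \<Rightarrow> config set \<Rightarrow> bool" where
  "act_inv K B X \<longleftrightarrow> (\<forall>x\<in>X. \<forall>g\<in>B. (\<lambda>p. x (act K g p)) \<in> X)"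

definition sub_cfg :: "nat monoid \<Rightarrow> config set \<Rightarrow> bool" where
  "sub_cfg \<Sigma> X \<longleftrightarrow> (\<lambda>p. \<one>\<^bsub>\<Sigma>\<^esub>) \<in> X \<and> (\<forall>x\<in>X. \<forall>y\<in>X. (\<lambda>p. x p \<otimes>\<^bsub>\<Sigma>\<^esub> y p) \<in> X) \<and>
    (\<forall>x\<in>X. (\<lambda>p. inv\<^bsub>\<Sigma>\<^esub> (x p)) \<in> X)"

definition on_cells :: "nat monoid \<Rightarrow> (site \<Rightarrow> 'c) \<Rightarrow> 'c set \<Rightarrow> rules \<Rightarrow> bool" where
  "on_cells K c A cs \<longleftrightarrow> (\<forall>r\<in>set cs. \<forall>p\<in>set (fst r). fst p \<in> carrier K \<and> c p \<in> A)"

text \<open>The finiteness property of group shifts. Finitely many cells stand for a finite alphabet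
  at each group element. It matters that the rule lives on the same cells: rules found for a window
  of levels then speak about that window only.\<close>

definition markov :: "nat monoid \<Rightarrow> nat set \<Rightarrow> (site \<Rightarrow> 'c) \<Rightarrow> bool" where
  "markov K B c \<longleftrightarrow> (\<forall>s \<Sigma> X A. group \<Sigma> \<and> carrier \<Sigma> = {..<s} \<and> finite A \<and> X \<subseteq> cfg s \<and>
     closed_cfg X \<and> sub_cfg \<Sigma> X \<and> act_inv K B X \<and> dep K c s A X \<longrightarrow>
     (\<exists>D H. on_cells K c A [(D, H)] \<and> X = sol K B s [(D, H)]))"

text \<open>Quantifiers over sites are kept whole, since most facts below treat a site as one
  object.\<close>

declare split_paired_All [simp del] split_paired_Ex [simp del]

lemma agree_refl [simp]: "agree K c A x x"
  by (simp add: agree_def)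

lemma agree_sym: "agree K c A x y \<Longrightarrow> agree K c A y x"
  by (simp add: agree_def)

lemma agree_trans: "agree K c A x y \<Longrightarrow> agree K c A y z \<Longrightarrow> agree K c A x z"
  by (simp add: agree_def)

lemma agree_mono: "agree K c A x y \<Longrightarrow> A' \<subseteq> A \<Longrightarrow> agree K c A' x y"
  unfolding agree_def by blast

lemma agree_Un: "agree K c (A \<union> A') x y \<longleftrightarrow> agree K c A x y \<and> agree K c A' x y"
  unfolding agree_def by blast

lemma agreeD: "agree K c A x y \<Longrightarrow> fst p \<in> carrier K \<Longrightarrow> c p \<in> A \<Longrightarrow> x p = y p"
  by (simp add: agree_def)

lemma depD: "dep K c s A X \<Longrightarrow> x \<in> X \<Longrightarrow> y \<in> cfg s \<Longrightarrow> agree K c A x y \<Longrightarrow> y \<in> X"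
  unfolding dep_def by blast

lemma projI: "x \<in> X \<Longrightarrow> y \<in> cfg s \<Longrightarrow> agree K c A x y \<Longrightarrow> y \<in> proj K c s A X"
  unfolding proj_def by blast

lemma projE:
  assumes "y \<in> proj K c s A X"
  obtains x where "x \<in> X" "y \<in> cfg s" "agree K c A x y"
  using assms unfolding proj_def by blast

lemma act_invD: "act_inv K B X \<Longrightarrow> x \<in> X \<Longrightarrow> g \<in> B \<Longrightarrow> (\<lambda>p. x (act K g p)) \<in> X"
  unfolding act_inv_def by blast

lemma sub_cfg_one: "sub_cfg \<Sigma> X \<Longrightarrow> (\<lambda>p. \<one>\<^bsub>\<Sigma>\<^esub>) \<in> X"
  and sub_cfg_mult: "sub_cfg \<Sigma> X \<Longrightarrow> x \<in> X \<Longrightarrow> y \<in> X \<Longrightarrow> (\<lambda>p. x p \<otimes>\<^bsub>\<Sigma>\<^esub> y p) \<in> X"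
  and sub_cfg_inv: "sub_cfg \<Sigma> X \<Longrightarrow> x \<in> X \<Longrightarrow> (\<lambda>p. inv\<^bsub>\<Sigma>\<^esub> (x p)) \<in> X"
  by (simp_all add: sub_cfg_def)

subsection \<open>Compactness\<close>

text \<open>Cantor's diagonal argument: with finitely many symbols a subsequence is constant at the
  k-th site, for each k in turn. The limit is matched on finite windows arbitrarily late in the
  sequence, which is what counts when later members satisfy more conditions.\<close>

lemma closed_cfg_accumulate:
  fixes y :: "nat \<Rightarrow> config"
  assumes "closed_cfg X" "X \<subseteq> cfg s" "\<And>n. y n \<in> X"
  shows "\<exists>x\<in>X. \<forall>W m. finite W \<longrightarrow> (\<exists>n\<ge>m. \<forall>p\<in>W. y n p = x p)"
proof -
  interpret subseqs "\<lambda>k (r :: nat \<Rightarrow> nat). \<exists>c. \<forall>i. y (r i) (prod_decode k) = c"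
  proof
    fix n and r :: "nat \<Rightarrow> nat"
    let ?f = "\<lambda>i. y (r i) (prod_decode n)"
    have "range ?f \<subseteq> {..<s}" using assms(2,3) by (auto simp: cfg_def)
    then have "finite (range ?f)" by (rule finite_subset) simp
    then obtain i where "infinite {j \<in> UNIV. ?f j = ?f i}"
      using pigeonhole_infinite[of UNIV ?f] by auto
    then have "infinite {j. ?f j = ?f i}" by simp
    then obtain r' :: "nat \<Rightarrow> nat" where "strict_mono r'" "\<And>k. r' k \<in> {j. ?f j = ?f i}"
      using infinite_enumerate by blast
    then have "\<forall>k. y ((r \<circ> r') k) (prod_decode n) = ?f i" by simp
    with \<open>strict_mono r'\<close> show "\<exists>r' :: nat \<Rightarrow> nat. strict_mono r' \<and> (\<exists>c. \<forall>i. y ((r \<circ> r') i) (prod_decode n) = c)"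
      by (intro exI[of _ r'] exI[of _ "?f i"] conjI)
  qed
  have ev: "\<exists>c. \<forall>i. y (diagseq (Suc k + i)) (prod_decode k) = c" for k
    using diagseq_holds[of k] by (auto simp: o_def)
  then obtain c where c: "\<And>k i. y (diagseq (Suc k + i)) (prod_decode k) = c k" by metis
  define x where "x p = c (prod_encode p)" for p
  have near: "\<exists>n\<ge>m. \<forall>p\<in>W. y n p = x p" if W: "finite W" for W m
  proof -
    obtain b where b: "\<And>p. p \<in> W \<Longrightarrow> Suc (prod_encode p) \<le> b"
      using finite_nat_set_iff_bounded_le[of "(\<lambda>p. Suc (prod_encode p)) ` W"] W by auto
    \<comment> \<open>From diagonal index \<open>b\<close> on, every site of \<open>W\<close> has
      reached its final value; adding \<open>m\<close> makes the index in the original sequence at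
      least \<open>m\<close>.\<close>
    let ?n = "diagseq (b + m)"
    have "?n \<ge> m" using seq_suble[OF subseq_diagseq, of "b + m"] by linarith
    moreover have "y ?n p = x p" if "p \<in> W" for p
      using c[of "prod_encode p" "b + m - Suc (prod_encode p)"] b[OF that] by (simp add: x_def)
    ultimately show ?thesis by blast
  qed
  have "x \<in> X"
  proof (rule assms(1)[unfolded closed_cfg_def, rule_format])
    fix W :: "site set" assume "finite W"
    from near[OF this, of 0] show "\<exists>y\<in>X. \<forall>p\<in>W. y p = x p"
      using assms(3) by blast
  qed
  then show ?thesis using near by (intro bexI[of _ x] allI impI)
qed

text \<open>Approximation on windows inside the cells \<open>A\<close> suffices, because an
  approximating point may be overwritten by \<open>y\<close> everywhere else.\<close>

lemma closed_cfg_dep: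
  assumes "closed_cfg X" "dep K c s A X" "X \<subseteq> cfg s" "y \<in> cfg s"
    and "\<And>W. finite W \<Longrightarrow> (\<And>p. p \<in> W \<Longrightarrow> fst p \<in> carrier K \<and> c p \<in> A) \<Longrightarrow> \<exists>x\<in>X. \<forall>p\<in>W. x p = y p"
  shows "y \<in> X"
proof -
  have "\<exists>x\<in>X. \<forall>p\<in>W. x p = y p" if W: "finite W" for W
  proof -
    have "\<exists>x\<in>X. \<forall>p\<in>{p\<in>W. fst p \<in> carrier K \<and> c p \<in> A}. x p = y p"
      by (rule assms(5)) (use W in auto)
    then obtain x where x: "x \<in> X" "\<forall>p\<in>{p\<in>W. fst p \<in> carrier K \<and> c p \<in> A}. x p = y p"
      by blast
    define z where "z p = (if fst p \<in> carrier K \<and> c p \<in> A then x p else y p)" for p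
    have "z \<in> cfg s" "agree K c A x z"
      using x assms(3,4) by (auto simp: z_def cfg_def agree_def)
    then have "z \<in> X" using assms(2) x(1) unfolding dep_def by blast
    moreover have "\<forall>p\<in>W. z p = y p" using x(2) by (simp add: z_def)
    ultimately show ?thesis by blast
  qed
  then show ?thesis by (intro assms(1)[unfolded closed_cfg_def, rule_format])
qed

text \<open>Images of compact sets are closed: points of \<open>X\<close> that fit on the first n
  sites accumulate at one that fits on all of \<open>A\<close>.\<close>

lemma closed_cfg_proj:
  assumes "closed_cfg X" "X \<subseteq> cfg s"
  shows "closed_cfg (proj K c s A X)"
  unfolding closed_cfg_def
proof (intro allI impI)
  fix y assume approx: "\<forall>W. finite W \<longrightarrow> (\<exists>z\<in>proj K c s A X. \<forall>p\<in>W. z p = y p)"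
  have "y p < s" for p
    using approx[rule_format, of "{p}"] by (auto simp: proj_def cfg_def) metis
  then have y: "y \<in> cfg s" by (simp add: cfg_def)
  let ?W = "\<lambda>n. prod_decode ` {..<n}"
  have "\<exists>x\<in>X. \<forall>p\<in>?W n. fst p \<in> carrier K \<and> c p \<in> A \<longrightarrow> x p = y p" for n
  proof -
    obtain z where "z \<in> proj K c s A X" "\<forall>p\<in>?W n. z p = y p"
      using approx[rule_format, of "?W n"] by blast
    then obtain x where "x \<in> X" "agree K c A x z" unfolding proj_def by blast
    then show ?thesis
      using \<open>\<forall>p\<in>?W n. z p = y p\<close> by (intro bexI[of _ x]) (simp_all add: agree_def)
  qed
  then obtain u where u: "\<And>n. u n \<in> X"
    "\<And>n p. p \<in> ?W n \<Longrightarrow> fst p \<in> carrier K \<Longrightarrow> c p \<in> A \<Longrightarrow> u n p = y p"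
    by metis
  obtain x where x: "x \<in> X" "\<And>W m. finite W \<Longrightarrow> \<exists>n\<ge>m. \<forall>p\<in>W. u n p = x p"
    using closed_cfg_accumulate[where y = u, OF assms u(1)] by metis
  have "x p = y p" if p: "fst p \<in> carrier K" "c p \<in> A" for p
  proof -
    obtain n where "n \<ge> Suc (prod_encode p)" "u n p = x p" using x(2)[of "{p}"] by auto
    moreover from this have "p \<in> ?W n"
      by (metis Suc_le_lessD image_eqI lessThan_iff prod_encode_inverse)
    ultimately show ?thesis using u(2) p by metis
  qed
  then show "y \<in> proj K c s A X"
    by (intro projI[OF x(1) y]) (simp add: agree_def)
qed

lemma closed_cfg_Int: "closed_cfg X \<Longrightarrow> closed_cfg Y \<Longrightarrow> closed_cfg (X \<inter> Y)"
  unfolding closed_cfg_def by (meson IntE IntI)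

lemma closed_cfg_agree_const: "closed_cfg {x. agree K c A x (\<lambda>_. a)}"
  unfolding closed_cfg_def
proof (intro allI impI)
  fix x assume approx: "\<forall>W. finite W \<longrightarrow> (\<exists>y\<in>{x. agree K c A x (\<lambda>_. a)}. \<forall>p\<in>W. y p = x p)"
  have "x p = a" if "fst p \<in> carrier K" "c p \<in> A" for p
    using approx[rule_format, of "{p}"] that by (auto simp: agree_def)
  then show "x \<in> {x. agree K c A x (\<lambda>_. a)}" by (simp add: agree_def)
qed

lemma closed_cfg_sol: "closed_cfg (sol K B s cs)"
  unfolding closed_cfg_def
proof (intro allI impI)
  fix x assume approx: "\<forall>W. finite W \<longrightarrow> (\<exists>y\<in>sol K B s cs. \<forall>p\<in>W. y p = x p)"
  have "x p < s" for p
    using approx[rule_format, of "{p}"] by (auto simp: sol_def cfg_def) metis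
  moreover have "map (\<lambda>p. x (act K g p)) (fst c) \<in> set (snd c)" if "g \<in> B" "c \<in> set cs" for g c
  proof -
    obtain y where "y \<in> sol K B s cs" "\<forall>p\<in>act K g ` set (fst c). y p = x p"
      using approx[rule_format, of "act K g ` set (fst c)"] by blast
    moreover from this have "map (\<lambda>p. y (act K g p)) (fst c) = map (\<lambda>p. x (act K g p)) (fst c)"
      by simp
    ultimately show ?thesis using that unfolding sol_def by (metis (no_types, lifting) mem_Collect_eq)
  qed
  ultimately show "x \<in> sol K B s cs" by (simp add: sol_def cfg_def)
qed

subsection \<open>Subgroups of configurations\<close>

lemma sub_cfg_Int: "sub_cfg \<Sigma> X \<Longrightarrow> sub_cfg \<Sigma> Y \<Longrightarrow> sub_cfg \<Sigma> (X \<inter> Y)"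
  unfolding sub_cfg_def by blast

lemma sub_cfg_agree_one:
  assumes "group \<Sigma>" shows "sub_cfg \<Sigma> {x. agree K c A x (\<lambda>_. \<one>\<^bsub>\<Sigma>\<^esub>)}"
proof -
  interpret group \<Sigma> by fact
  show ?thesis by (simp add: sub_cfg_def agree_def)
qed

lemma sub_cfg_proj:
  assumes "group \<Sigma>" "carrier \<Sigma> = {..<s}" "sub_cfg \<Sigma> X"
  shows "sub_cfg \<Sigma> (proj K c s A X)"
proof -
  interpret group \<Sigma> by fact
  have car: "a \<in> carrier \<Sigma> \<longleftrightarrow> a < s" for a using assms(2) by auto
  have cfg: "x \<in> cfg s \<longleftrightarrow> (\<forall>p. x p \<in> carrier \<Sigma>)" for x by (simp add: cfg_def car)
  show ?thesis
    unfolding sub_cfg_def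
  proof (intro conjI ballI)
    show "(\<lambda>p. \<one>\<^bsub>\<Sigma>\<^esub>) \<in> proj K c s A X"
      by (rule projI[OF sub_cfg_one[OF assms(3)]]) (simp_all add: cfg)
  next
    fix x y assume "x \<in> proj K c s A X" "y \<in> proj K c s A X"
    then obtain x' y' where "x' \<in> X" "x \<in> cfg s" "agree K c A x' x" "y' \<in> X" "y \<in> cfg s" "agree K c A y' y"
      by (elim projE)
    then show "(\<lambda>p. x p \<otimes>\<^bsub>\<Sigma>\<^esub> y p) \<in> proj K c s A X"
      by (intro projI[OF sub_cfg_mult[OF assms(3), of x' y']]) (simp_all add: cfg agree_def)
  next
    fix x assume "x \<in> proj K c s A X"
    then obtain x' where "x' \<in> X" "x \<in> cfg s" "agree K c A x' x"
      by (elim projE)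
    then show "(\<lambda>p. inv\<^bsub>\<Sigma>\<^esub> x p) \<in> proj K c s A X"
      by (intro projI[OF sub_cfg_inv[OF assms(3), of x']]) (simp_all add: cfg agree_def)
  qed
qed

lemma dep_proj: "dep K c s A (proj K c s A X)"
  unfolding dep_def
proof (intro ballI impI)
  fix x y assume "x \<in> proj K c s A X" "y \<in> cfg s" "agree K c A x y"
  then show "y \<in> proj K c s A X"
    by (elim projE) (metis projI agree_trans)
qed

lemma proj_subset: "X \<subseteq> cfg s \<Longrightarrow> X \<subseteq> proj K c s A X"
  by (auto intro: projI)

lemma proj_cfg: "proj K c s A X \<subseteq> cfg s"
  by (auto elim: projE)

lemma sol_cfg: "sol K B s cs \<subseteq> cfg s"
  unfolding sol_def by blast

lemma act_inv_Int: "act_inv K B X \<Longrightarrow> act_inv K B Y \<Longrightarrow> act_inv K B (X \<inter> Y)"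
  unfolding act_inv_def by simp

lemma act_inv_subset: "act_inv K B X \<Longrightarrow> B' \<subseteq> B \<Longrightarrow> act_inv K B' X"
  unfolding act_inv_def by blast

lemma cfg_compose: "x \<in> cfg s \<Longrightarrow> (\<lambda>p. x (f p)) \<in> cfg s"
  by (simp add: cfg_def)

lemma act_one [simp]: "group K \<Longrightarrow> act K \<one>\<^bsub>K\<^esub> p = p"
  by (simp add: act_def group.is_monoid)

lemma act_mult:
  "group K \<Longrightarrow> a \<in> carrier K \<Longrightarrow> b \<in> carrier K \<Longrightarrow> act K a (act K b p) = act K (a \<otimes>\<^bsub>K\<^esub> b) p"
  by (simp add: act_def group.is_monoid monoid.m_assoc monoid.m_closed)

lemma fst_act [simp]: "group K \<Longrightarrow> g \<in> carrier K \<Longrightarrow> fst (act K g p) \<in> carrier K \<longleftrightarrow> fst p \<in> carrier K"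
  by (simp add: act_def group.is_monoid monoid.m_closed)

lemma snd_act [simp]: "snd (act K g p) = snd p"
  by (simp add: act_def)

lemma solD: "x \<in> sol K B s cs \<Longrightarrow> g \<in> B \<Longrightarrow> r \<in> set cs \<Longrightarrow> map (\<lambda>p. x (act K g p)) (fst r) \<in> set (snd r)"
  by (simp add: sol_def)

lemma act_inv_sol:
  assumes "group K" "subgroup B K" shows "act_inv K B (sol K B s cs)"
  unfolding act_inv_def
proof (intro ballI)
  fix x g assume "x \<in> sol K B s cs" "g \<in> B"
  then show "(\<lambda>p. x (act K g p)) \<in> sol K B s cs"
    using assms unfolding sol_def
    by (auto simp: cfg_def act_mult subgroup.mem_carrier subgroup.m_closed)
qed

text \<open>\<open>B\<close> moves no site to another cell, so every translate of a rule reads cells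
  in \<open>A\<close> only.\<close>

lemma dep_sol:
  assumes "group K" "B \<subseteq> carrier K" "on_cells K c A cs"
    and "\<And>g p. g \<in> B \<Longrightarrow> fst p \<in> carrier K \<Longrightarrow> c (act K g p) = c p"
  shows "dep K c s A (sol K B s cs)"
  unfolding dep_def
proof (intro ballI impI)
  fix x y assume x: "x \<in> sol K B s cs" and y: "y \<in> cfg s" "agree K c A x y"
  have "map (\<lambda>p. y (act K g p)) (fst r) \<in> set (snd r)" if "g \<in> B" "r \<in> set cs" for g r
  proof -
    have "x (act K g p) = y (act K g p)" if "p \<in> set (fst r)" for p
      using assms \<open>g \<in> B\<close> \<open>r \<in> set cs\<close> that unfolding on_cells_def
      by (intro agreeD[OF y(2)]) auto
    then have eq: "map (\<lambda>p. y (act K g p)) (fst r) = map (\<lambda>p. x (act K g p)) (fst r)" by simp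
    show ?thesis unfolding eq by (rule solD[OF x that])
  qed
  then show "y \<in> sol K B s cs" using y(1) by (simp add: sol_def)
qed

lemma act_inv_proj:
  assumes "group K" "B \<subseteq> carrier K" "act_inv K B X"
    and "\<And>g p. g \<in> B \<Longrightarrow> fst p \<in> carrier K \<Longrightarrow> c (act K g p) = c p"
  shows "act_inv K B (proj K c s A X)"
  unfolding act_inv_def
proof (intro ballI)
  fix y g assume "y \<in> proj K c s A X" "g \<in> B"
  then obtain x where x: "x \<in> X" "y \<in> cfg s" "agree K c A x y" by (elim projE)
  have "agree K c A (\<lambda>p. x (act K g p)) (\<lambda>p. y (act K g p))"
    using x(3) assms \<open>g \<in> B\<close> by (auto simp: agree_def)
  then show "(\<lambda>p. y (act K g p)) \<in> proj K c s A X"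
    using x assms \<open>g \<in> B\<close> by (intro projI[OF act_invD[OF assms(3) x(1)]]) (auto intro: cfg_compose)
qed

lemma markovD:
  assumes "markov K B c" "group \<Sigma>" "carrier \<Sigma> = {..<s}" "finite A" "X \<subseteq> cfg s"
    "closed_cfg X" "sub_cfg \<Sigma> X" "act_inv K B X" "dep K c s A X"
  obtains D H where "on_cells K c A [(D, H)]" "X = sol K B s [(D, H)]"
  using assms unfolding markov_def by blast

section \<open>Extensions by the infinite cyclic group\<close>

text \<open>\<open>lev\<close> is the quotient map onto the integers and \<open>t\<close> a lift of
  the generator, so the powers of \<open>t\<close> represent the cosets of the kernel.\<close>

locale zext = group M for M :: "nat monoid" (structure) +
  fixes t :: nat and lev :: "nat \<Rightarrow> int"
  assumes t_closed [simp]: "t \<in> carrier M" and lev_t: "lev t = 1"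
    and lev_mult: "a \<in> carrier M \<Longrightarrow> b \<in> carrier M \<Longrightarrow> lev (a \<otimes> b) = lev a + lev b"
begin

definition ker where "ker = {m \<in> carrier M. lev m = 0}"

definition cell :: "site \<Rightarrow> int \<times> nat" where "cell p = (lev (fst p), snd p)"

definition T :: "int \<Rightarrow> site \<Rightarrow> site" where "T k = act M (t [^] k)"

lemma is_grp: "group M" ..

lemma lev_one [simp]: "lev \<one> = 0"
  using lev_mult[of \<one> \<one>] by simp

lemma lev_inv: "a \<in> carrier M \<Longrightarrow> lev (inv a) = - lev a"
  using lev_mult[of a "inv a"] by simp

lemma lev_npow: "lev (t [^] (n :: nat)) = int n"
  by (induction n) (simp_all add: lev_mult lev_t)

lemma lev_pow [simp]: "lev (t [^] (k :: int)) = k"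
  by (cases k rule: int_cases2) (simp_all add: int_pow_int int_pow_neg_int lev_inv lev_npow)

lemma subgroup_ker: "subgroup ker M"
  by unfold_locales (auto simp: ker_def lev_mult lev_inv)

lemma ker_subset: "ker \<subseteq> carrier M"
  by (auto simp: ker_def)

lemma cell_act: "g \<in> carrier M \<Longrightarrow> fst p \<in> carrier M \<Longrightarrow> cell (act M g p) = (lev g + fst (cell p), snd p)"
  by (simp add: cell_def act_def lev_mult)

lemma cell_ker: "g \<in> ker \<Longrightarrow> fst p \<in> carrier M \<Longrightarrow> cell (act M g p) = cell p"
  by (simp add: cell_def act_def ker_def lev_mult)

lemma pow_t_closed: "t [^] (k :: int) \<in> carrier M"
  by (rule int_pow_closed[OF t_closed])

lemma cell_T [simp]: "fst p \<in> carrier M \<Longrightarrow> cell (T k p) = (fst (cell p) + k, snd p)"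
  by (simp add: T_def cell_act)

lemma lev_T [simp]: "fst p \<in> carrier M \<Longrightarrow> lev (fst (T k p)) = lev (fst p) + k"
  by (simp add: T_def act_def lev_mult)

lemma fst_T [simp]: "fst (T k p) \<in> carrier M \<longleftrightarrow> fst p \<in> carrier M"
  by (simp add: T_def is_grp)

lemma T_T [simp]: "T j (T k p) = T (j + k) p"
  by (simp add: T_def act_mult is_grp int_pow_mult)

lemma snd_T [simp]: "snd (T k p) = snd p"
  by (simp add: T_def)

lemma fst_snd_cell [simp]: "(fst (cell p), snd p) = cell p"
  by (simp add: cell_def)

lemma T_0 [simp]: "T 0 p = p"
  by (simp add: T_def is_grp)

lemma T_1: "T 1 p = act M t p"
  by (simp add: T_def)

text \<open>With g = t^k h and the power of t on the left, the rules of x at g are the rules of the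
  shifted configuration x o T k at the kernel element h. This reduces rules over \<open>M\<close> to
  rules over the kernel, level by level.\<close>

lemma act_split:
  assumes "g \<in> carrier M" shows "\<exists>h\<in>ker. \<forall>p. act M g p = T (lev g) (act M h p)"
proof -
  let ?h = "t [^] (- lev g) \<otimes> g"
  have h: "?h \<in> ker"
    using assms pow_t_closed by (simp add: ker_def lev_mult del: int_pow_closed)
  have "act M g p = T (lev g) (act M ?h p)" for p
  proof -
    have "t [^] lev g \<otimes> ?h = g"
      using assms pow_t_closed by (simp add: int_pow_neg flip: m_assoc)
    then show ?thesis
      using assms h ker_subset pow_t_closed by (simp add: T_def act_mult[OF is_grp] subsetD)
  qed
  with h show ?thesis by blast
qed

lemma act_inv_T: "act_inv M (carrier M) X \<Longrightarrow> x \<in> X \<Longrightarrow> (\<lambda>p. x (T k p)) \<in> X"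
  unfolding T_def by (rule act_invD) (use pow_t_closed in auto)

lemma snd_cell [simp]: "snd (cell p) = snd p"
  by (simp add: cell_def)

text \<open>The window \<open>A\<close> walks along the levels in both directions. \<open>Q\<close>
  holds its admissible contents, and \<open>E0\<close>, \<open>E1\<close>, \<open>E2\<close> start
  the walk, move it up and move it down. \<open>C\<close> contains the \<open>L\<close>-layers of
  two successive windows, so \<open>Z\<close> constrains the prescribed values both before and after
  a move.\<close>

lemma ext_sound:
  fixes A :: "(int \<times> nat) set" and L :: "nat set"
  defines "C \<equiv> {(k, l). l \<in> L \<and> ((k, l) \<in> A \<or> (k - 1, l) \<in> A)}"
  assumes depQ: "dep M cell s A Q" and depZ: "dep M cell s C Z"
    and cfgs: "Q \<subseteq> cfg s" "Z \<subseteq> cfg s"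
    and X1: "X1 \<subseteq> Z" "act_inv M (carrier M) X1"
    and Q: "Q \<subseteq> sol M ker s cs" "on_cells M cell A cs"
    and E0: "\<And>z. z \<in> Z \<Longrightarrow> \<exists>q\<in>Q. agree M cell C q z"
    and E1: "\<And>p. p \<in> Q \<Longrightarrow> p \<in> Z \<Longrightarrow> \<exists>x\<in>cfg s. (\<lambda>r. x (act M t r)) \<in> Q \<and> agree M cell (A \<union> C) x p"
    and E2: "\<And>p. (\<lambda>r. p (act M t r)) \<in> Q \<Longrightarrow> p \<in> Z \<Longrightarrow>
      \<exists>x\<in>Q. agree M cell ({(k, l). (k - 1, l) \<in> A} \<union> C) x p"
    and conv: "\<And>a b k l. (a, l) \<in> A \<Longrightarrow> (b, l) \<in> A \<Longrightarrow> a \<le> k \<Longrightarrow> k \<le> b \<Longrightarrow> (k, l) \<in> A"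
    and z: "z \<in> X1"
  shows "\<exists>x\<in>sol M (carrier M) s cs. agree M snd L x z"
proof -
  define inA where "inA k p \<longleftrightarrow> fst p \<in> carrier M \<and> (fst (cell p) - k, snd p) \<in> A" for k p
  \<comment> \<open>Outside the window \<open>q\<close> is reset to \<open>z\<close>, so a state
    remembers nothing beyond the window; on the layers in \<open>L\<close> the values of
    \<open>z\<close> are binding even inside it.\<close>
  define st where "st k q \<longleftrightarrow> q \<in> cfg s \<and> (\<lambda>p. q (T k p)) \<in> Q \<and>
    (\<forall>p. \<not> inA k p \<or> snd p \<in> L \<longrightarrow> q p = z p)" for k q
  define nb where "nb k q q' \<longleftrightarrow> (\<forall>p. inA k p \<and> inA (k + 1) p \<longrightarrow> q p = q' p)" for k and q q' :: config
  have zc: "z \<in> cfg s" using z X1 cfgs by blast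
  have zT: "(\<lambda>p. z (T k p)) \<in> Z" for k using act_inv_T[OF X1(2) z] X1(1) by blast
  \<comment> \<open>\<open>Z\<close> reads layers in \<open>L\<close> only, where \<open>q\<close>
    coincides with \<open>z\<close>, and all shifts of \<open>z\<close> lie in \<open>Z\<close> by
    invariance of \<open>X1\<close>.\<close>
  have inZ: "(\<lambda>p. q (T k p)) \<in> Z" if "st k q" for k q
  proof (rule depD[OF depZ zT[of k]])
    show "(\<lambda>p. q (T k p)) \<in> cfg s" using that by (auto simp: st_def intro: cfg_compose)
    show "agree M cell C (\<lambda>p. z (T k p)) (\<lambda>p. q (T k p))"
      using that by (auto simp: agree_def C_def st_def T_def cell_def)
  qed
  have up: "\<exists>q'. st (k + 1) q' \<and> nb k q q'" if st: "st k q" for k q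
  proof -
    have "(\<lambda>p. q (T k p)) \<in> Q" using st by (simp add: st_def)
    from E1[OF this inZ[OF st]] obtain x where x: "x \<in> cfg s" "(\<lambda>r. x (act M t r)) \<in> Q"
      "agree M cell (A \<union> C) x (\<lambda>p. q (T k p))" by blast
    define q' where "q' p = (if inA (k + 1) p then x (T (- k) p) else z p)" for p
    have xq: "x (T (- k) p) = q p" if "fst p \<in> carrier M" "(fst (cell p) - k, snd p) \<in> A \<union> C" for p
      using agreeD[OF x(3), of "T (- k) p"] that by simp
    have "q' \<in> cfg s" using x(1) zc by (auto simp: cfg_def q'_def)
    moreover have "(\<lambda>p. q' (T (k + 1) p)) \<in> Q"
    proof (rule depD[OF depQ x(2)])
      show "(\<lambda>p. q' (T (k + 1) p)) \<in> cfg s" using \<open>q' \<in> cfg s\<close> by (rule cfg_compose)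
      show "agree M cell A (\<lambda>r. x (act M t r)) (\<lambda>p. q' (T (k + 1) p))"
        unfolding agree_def
      proof (intro allI impI)
        fix p assume p: "fst p \<in> carrier M \<and> cell p \<in> A"
        then have "inA (k + 1) (T (k + 1) p)"
          by (simp add: inA_def)
        then show "x (act M t p) = q' (T (k + 1) p)"
          by (simp add: q'_def T_1)
      qed
    qed
    moreover have "q' p = z p" if "\<not> inA (k + 1) p \<or> snd p \<in> L" for p
    proof (cases "inA (k + 1) p")
      case True
      then have "x (T (- k) p) = q p"
        using that by (intro xq) (auto simp: inA_def C_def algebra_simps)
      then show ?thesis using True that st by (simp add: q'_def st_def)
    qed (simp add: q'_def)
    moreover have "nb k q q'"
      unfolding nb_def q'_def using xq by (auto simp: inA_def)
    ultimately show ?thesis unfolding st_def by blast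
  qed
  have down: "\<exists>q'. st k q' \<and> nb k q' q" if st: "st (k + 1) q" for k q
  proof -
    \<comment> \<open>Seen from offset \<open>k\<close>, the given contents sit one level too high,
      which is the hypothesis of \<open>E2\<close>.\<close>
    have "(\<lambda>r. (\<lambda>p. q (T k p)) (act M t r)) \<in> Q" using st by (simp add: st_def flip: T_1)
    moreover have "(\<lambda>p. q (T k p)) \<in> Z"
    proof (rule depD[OF depZ zT[of k]])
      show "(\<lambda>p. q (T k p)) \<in> cfg s" using st by (auto simp: st_def intro: cfg_compose)
      show "agree M cell C (\<lambda>p. z (T k p)) (\<lambda>p. q (T k p))"
        using st by (auto simp: agree_def C_def st_def T_def cell_def)
    qed
    ultimately obtain x where x: "x \<in> Q"
      "agree M cell ({(k, l). (k - 1, l) \<in> A} \<union> C) x (\<lambda>p. q (T k p))"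
      using E2[of "\<lambda>p. q (T k p)"] by blast
    define q' where "q' p = (if inA k p then x (T (- k) p) else z p)" for p
    have xq: "x (T (- k) p) = q p"
      if "fst p \<in> carrier M" "inA (k + 1) p \<or> (fst (cell p) - k, snd p) \<in> C" for p
      using agreeD[OF x(2), of "T (- k) p"] that by (auto simp: inA_def algebra_simps)
    have "q' \<in> cfg s" using x(1) zc cfgs by (auto simp: cfg_def q'_def)
    moreover have "(\<lambda>p. q' (T k p)) \<in> Q"
    proof (rule depD[OF depQ x(1)])
      show "(\<lambda>p. q' (T k p)) \<in> cfg s" using \<open>q' \<in> cfg s\<close> by (rule cfg_compose)
      show "agree M cell A x (\<lambda>p. q' (T k p))"
        unfolding agree_def
      proof (intro allI impI)
        fix p assume p: "fst p \<in> carrier M \<and> cell p \<in> A"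
        then have "inA k (T k p)"
          by (simp add: inA_def)
        then show "x p = q' (T k p)"
          by (simp add: q'_def)
      qed
    qed
    moreover have "q' p = z p" if "\<not> inA k p \<or> snd p \<in> L" for p
    proof (cases "inA k p")
      case True
      then have "x (T (- k) p) = q p"
        using that by (intro xq) (auto simp: inA_def C_def)
      then show ?thesis using True that st by (simp add: q'_def st_def)
    qed (simp add: q'_def)
    moreover have "nb k q' q"
      unfolding nb_def q'_def using xq by (auto simp: inA_def)
    ultimately show ?thesis unfolding st_def by blast
  qed
  obtain q0 where "q0 \<in> Q" "agree M cell C q0 z"
    using E0 X1 z by blast
  define q where "q p = (if inA 0 p then q0 p else z p)" for p
  have "q \<in> cfg s" using \<open>q0 \<in> Q\<close> zc cfgs by (auto simp: cfg_def q_def)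
  have st0: "st 0 q"
    unfolding st_def
  proof (intro conjI allI impI)
    show "q \<in> cfg s" by fact
    show "(\<lambda>p. q (T 0 p)) \<in> Q"
    proof (rule depD[OF depQ \<open>q0 \<in> Q\<close>])
      show "(\<lambda>p. q (T 0 p)) \<in> cfg s" using \<open>q \<in> cfg s\<close> by (rule cfg_compose)
      show "agree M cell A q0 (\<lambda>p. q (T 0 p))"
        by (simp add: agree_def q_def inA_def)
    qed
    fix p assume "\<not> inA 0 p \<or> snd p \<in> L"
    then show "q p = z p"
      using agreeD[OF \<open>agree M cell C q0 z\<close>, of p] by (auto simp: q_def inA_def C_def cell_def)
  qed
  obtain u where u: "\<And>n :: nat. st (int n) (u n)" "\<And>n. nb (int n) (u n) (u (Suc n))" "u 0 = q"
  proof -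
    have "\<exists>f. \<forall>n. (st (int n) (f n) \<and> (n = 0 \<longrightarrow> f n = q)) \<and> nb (int n) (f n) (f (Suc n))"
    proof (rule dependent_nat_choice)
      show "\<exists>x. st (int 0) x \<and> (0 = (0::nat) \<longrightarrow> x = q)" using st0 by auto
      fix x and n :: nat assume "st (int n) x \<and> (n = 0 \<longrightarrow> x = q)"
      then show "\<exists>y. (st (int (Suc n)) y \<and> (Suc n = 0 \<longrightarrow> y = q)) \<and> nb (int n) x y"
        using up[of "int n" x] by (auto simp: add.commute)
    qed
    then show thesis using that by blast
  qed
  obtain v where v: "\<And>n :: nat. st (- int n) (v n)" "\<And>n. nb (- int n - 1) (v (Suc n)) (v n)" "v 0 = q"
  proof -
    have "\<exists>f. \<forall>n. (st (- int n) (f n) \<and> (n = 0 \<longrightarrow> f n = q)) \<and> nb (- int n - 1) (f (Suc n)) (f n)"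
    proof (rule dependent_nat_choice)
      show "\<exists>x. st (- int 0) x \<and> (0 = (0::nat) \<longrightarrow> x = q)" using st0 by auto
      fix x and n :: nat assume "st (- int n) x \<and> (n = 0 \<longrightarrow> x = q)"
      then obtain y where "st (- int n - 1) y" "nb (- int n - 1) y x"
        using down[of "- int n - 1" x] by auto
      moreover have "- int (Suc n) = - int n - 1" by simp
      ultimately show "\<exists>y. (st (- int (Suc n)) y \<and> (Suc n = 0 \<longrightarrow> y = q)) \<and> nb (- int n - 1) y x"
        by (intro exI[of _ y]) (simp only:, simp)
    qed
    then show thesis using that by blast
  qed
  define w where "w k = (if 0 \<le> k then u (nat k) else v (nat (- k)))" for k
  have w: "st k (w k)" for k
    using u(1)[of "nat k"] v(1)[of "nat (- k)"] by (auto simp: w_def)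
  have w_nb: "nb k (w k) (w (k + 1))" for k
  proof (cases "0 \<le> k")
    case True
    then show ?thesis using u(2)[of "nat k"] by (simp add: w_def Suc_nat_eq_nat_zadd1 add.commute)
  next
    case False
    then obtain n where "k = - int n - 1" by (metis add.commute diff_add_cancel minus_diff_eq nonneg_int_cases not_le uminus_add_conv_diff zle_add1_eq_le neg_0_le_iff_le diff_minus_eq_add)
    then show ?thesis using v(2)[of n] u(3) v(3) by (cases n) (simp_all add: w_def nat_add_distrib)
  qed
  \<comment> \<open>The offsets of the windows containing a given site form an interval, because
    \<open>A\<close> is convex in each layer; equality passes along the neighbours in
    between.\<close>
  have w_eq: "w j p = w k p" if "inA j p" "inA k p" "j \<le> k" for j k p
  proof -
    have inb: "inA i p" if "j \<le> i" "i \<le> k" for i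
      using that \<open>inA j p\<close> \<open>inA k p\<close> conv[of "fst (cell p) - k" "snd p" "fst (cell p) - j" "fst (cell p) - i"]
      by (simp add: inA_def)
    have "w j p = w i p" if "j \<le> i" "i \<le> k" for i
      using that
    proof (induction i rule: int_ge_induct)
      case (step i)
      then show ?case using w_nb[of i] inb[of i] inb[of "i + 1"] by (simp add: nb_def)
    qed simp
    then show ?thesis using that by simp
  qed
  \<comment> \<open>Sites in no window, such as those of layers that \<open>A\<close> does not meet,
    take their values from \<open>z\<close>.\<close>
  define x where "x p = (if \<exists>k. inA k p then w (SOME k. inA k p) p else z p)" for p
  have x_w: "x p = w k p" if "inA k p" for k p
  proof -
    have "inA (SOME k. inA k p) p" using that by (rule someI)
    then have "w (SOME k. inA k p) p = w k p"
      using w_eq[of k p "SOME k. inA k p"] w_eq[of "SOME k. inA k p" p k] that by linarith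
    then show ?thesis using that by (auto simp: x_def)
  qed
  have "x p < s" for p
    using w zc by (cases "\<exists>k. inA k p") (auto simp: x_w st_def cfg_def x_def)
  moreover have "map (\<lambda>p. x (act M g p)) (fst r) \<in> set (snd r)"
    if g: "g \<in> carrier M" and r: "r \<in> set cs" for g r
  proof -
    obtain h where h: "h \<in> ker" "\<And>p. act M g p = T (lev g) (act M h p)"
      using act_split[OF g] by blast
    let ?k = "lev g"
    have "(\<lambda>p. w ?k (T ?k p)) \<in> sol M ker s cs"
      using w[of ?k] Q by (auto simp: st_def)
    from solD[OF this h(1) r] have "map (\<lambda>p. w ?k (T ?k (act M h p))) (fst r) \<in> set (snd r)" .
    moreover have "x (act M g p) = w ?k (T ?k (act M h p))" if "p \<in> set (fst r)" for p
    proof -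
      have p: "fst p \<in> carrier M" "cell p \<in> A" using Q(2) r that by (auto simp: on_cells_def)
      then have "inA ?k (act M g p)"
        by (simp add: inA_def cell_act g is_grp)
      then show ?thesis by (simp add: x_w h(2))
    qed
    ultimately show ?thesis by (simp cong: map_cong)
  qed
  moreover have "x p = z p" if "snd p \<in> L" for p
    using w that by (cases "\<exists>k. inA k p") (auto simp: x_w st_def x_def)
  ultimately show ?thesis
    by (intro bexI[of _ x]) (auto simp: sol_def cfg_def agree_def)
qed

lemma agree_layers: "agree M snd L x y \<longleftrightarrow> agree M cell (UNIV \<times> L) x y"
  by (simp add: agree_def mem_Times_iff)

text \<open>
  By compactness, agreement on a large finite part of the cells \<open>\<Union>\<C>\<close> suffices for splicing
  \<open>a\<close> on \<open>S\<close> with \<open>b\<close> on \<open>\<Union>\<C>\<close>.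
\<close>

lemma splice:
  assumes mk: "markov M ker cell" and \<Sigma>: "group \<Sigma>" "carrier \<Sigma> = {..<s}"
    and S: "finite S" and X: "X \<subseteq> cfg s" "closed_cfg X" "sub_cfg \<Sigma> X" "act_inv M ker X"
    and \<C>: "\<And>m n :: nat. m \<le> n \<Longrightarrow> \<C> m \<subseteq> \<C> n"
  shows "\<exists>n. \<forall>a\<in>X. \<forall>b\<in>X. agree M cell (\<C> n) a b \<longrightarrow>
    (\<exists>x\<in>X. agree M cell S x a \<and> agree M cell (\<Union>(range \<C>)) x b)"
proof -
  interpret \<Sigma>: group \<Sigma> by fact
  have car: "x p \<in> carrier \<Sigma>" if "x \<in> X" for x p
    using that X(1) \<Sigma>(2) by (auto simp: cfg_def)
  define one where "one = (\<lambda>_ :: site. \<one>\<^bsub>\<Sigma>\<^esub>)"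
  \<comment> \<open>The points that are trivial on all the \<C> n. Their trace on \<open>S\<close>
    is a group shift on finitely many cells, hence given by one rule \<open>(D, H)\<close>.\<close>
  define K where "K = X \<inter> {x. agree M cell (\<Union>(range \<C>)) x one}"
  have one_ker: "\<one> \<in> ker" by (simp add: ker_def)
  have inv1: "agree M cell E (\<lambda>p. x (act M g p)) one"
    if "agree M cell E x one" "g \<in> ker" for x g and E :: "(int \<times> nat) set"
    using that ker_subset by (auto simp: agree_def one_def cell_ker is_grp subset_iff)
  have K: "K \<subseteq> cfg s" "closed_cfg K" "sub_cfg \<Sigma> K" "act_inv M ker K"
    using X inv1 unfolding K_def one_def
    by (auto intro!: closed_cfg_Int closed_cfg_agree_const sub_cfg_Int sub_cfg_agree_one \<Sigma>(1)
        simp: act_inv_def)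
  obtain D H where DH: "on_cells M cell S [(D, H)]" "proj M cell s S K = sol M ker s [(D, H)]"
    by (rule markovD[OF mk \<Sigma> S proj_cfg closed_cfg_proj[OF K(2,1)] sub_cfg_proj[OF \<Sigma> K(3)] act_inv_proj[OF is_grp ker_subset K(4) cell_ker] dep_proj])
  \<comment> \<open>Otherwise points trivial on larger and larger \<C> n would violate the rule at
    the identity, and an accumulation point would lie in \<open>K\<close> and still violate
    it.\<close>
  have "\<exists>n. \<forall>x\<in>X. agree M cell (\<C> n) x one \<longrightarrow> map x D \<in> set H"
  proof (rule ccontr)
    assume "\<not> ?thesis"
    then have "\<forall>n. \<exists>x. x \<in> X \<and> agree M cell (\<C> n) x one \<and> map x D \<notin> set H" by blast
    then obtain u where u: "\<And>n. u n \<in> X" "\<And>n. agree M cell (\<C> n) (u n) one" "\<And>n. map (u n) D \<notin> set H"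
      by metis
    obtain x where x: "x \<in> X" "\<And>W m. finite W \<Longrightarrow> \<exists>n\<ge>m. \<forall>p\<in>W. u n p = x p"
      using closed_cfg_accumulate[where y = u, OF X(2,1) u(1)] by metis
    have "agree M cell (\<Union>(range \<C>)) x one"
      unfolding agree_def
    proof (intro allI impI)
      fix p assume p: "fst p \<in> carrier M \<and> cell p \<in> \<Union>(range \<C>)"
      then obtain m where "cell p \<in> \<C> m" by blast
      moreover obtain n where "n \<ge> m" "u n p = x p" using x(2)[of "{p}" m] by auto
      ultimately show "x p = one p" using agreeD[OF u(2)[of n], of p] \<C>[of m n] p by auto
    qed
    with x(1) have "x \<in> K" by (simp add: K_def)
    then have "x \<in> sol M ker s [(D, H)]"
      using proj_subset[OF K(1), of M cell S] unfolding DH(2) by (rule subsetD[rotated])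
    from solD[OF this one_ker, of "(D, H)"] have "map x D \<in> set H" by (simp add: is_grp)
    moreover obtain n where "\<forall>p\<in>set D. u n p = x p" using x(2)[of "set D" 0] by auto
    then have "map (u n) D = map x D" by simp
    ultimately show False using u(3)[of n] by metis
  qed
  then obtain n where n: "\<And>x. x \<in> X \<Longrightarrow> agree M cell (\<C> n) x one \<Longrightarrow> map x D \<in> set H" by blast
  have "\<exists>x\<in>X. agree M cell S x a \<and> agree M cell (\<Union>(range \<C>)) x b"
    if ab: "a \<in> X" "b \<in> X" "agree M cell (\<C> n) a b" for a b
  proof -
    \<comment> \<open>This quotient is trivial on \<C> n, hence obeys the rule at every kernel
      translate and agrees on \<open>S\<close> with some k in \<open>K\<close>. Then b k^-1 equals b
      (b^-1 a) = a on \<open>S\<close>, and equals b wherever k is trivial.\<close>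
    define d where "d p = inv\<^bsub>\<Sigma>\<^esub> a p \<otimes>\<^bsub>\<Sigma>\<^esub> b p" for p
    have d: "d \<in> X"
      unfolding d_def using ab by (intro sub_cfg_mult[OF X(3)] sub_cfg_inv[OF X(3)])
    have "agree M cell (\<C> n) d one"
      using ab(3) car[OF ab(2)] by (simp add: agree_def d_def one_def)
    then have "d \<in> sol M ker s [(D, H)]"
      using d X(1,4) n inv1 by (auto simp: sol_def dest: act_invD)
    then obtain k where k: "k \<in> K" "agree M cell S k d" using DH(2) by (metis projE)
    define x where "x p = b p \<otimes>\<^bsub>\<Sigma>\<^esub> inv\<^bsub>\<Sigma>\<^esub> k p" for p
    have "x \<in> X"
      unfolding x_def using ab k by (intro sub_cfg_mult[OF X(3)] sub_cfg_inv[OF X(3)]) (auto simp: K_def)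
    moreover have "agree M cell S x a"
      using k(2) car ab by (simp add: agree_def x_def d_def \<Sigma>.inv_mult_group flip: \<Sigma>.m_assoc)
    moreover have "agree M cell (\<Union>(range \<C>)) x b"
      using k(1) car ab by (simp add: agree_def x_def K_def one_def)
    ultimately show ?thesis by blast
  qed
  then show ?thesis by blast
qed

section \<open>Group shifts over an extension by the integers are of finite type\<close>

lemma agree_T:
  assumes "agree M cell A x y"
  shows "agree M cell {(i, l). (i + k, l) \<in> A} (\<lambda>p. x (T k p)) (\<lambda>p. y (T k p))"
  unfolding agree_def
proof (intro allI impI)
  fix p assume "fst p \<in> carrier M \<and> cell p \<in> {(i, l). (i + k, l) \<in> A}"
  then show "x (T k p) = y (T k p)"
    by (intro agreeD[OF assms]) (auto simp: cell_def)
qed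

text \<open>Levels play the role of time. \<open>splice\<close> yields a memory m: level 0 of one
  point can be glued to the entire past of another as soon as the two match on the m levels before.
  Hence the trace on m + 1 consecutive levels determines the shift.\<close>

lemma markov_ext:
  assumes mk: "markov M ker cell"
  shows "markov M (carrier M) snd"
  unfolding markov_def
proof (intro allI impI, elim conjE)
  fix s \<Sigma> X and L :: "nat set"
  assume \<Sigma>: "group \<Sigma>" "carrier \<Sigma> = {..<s}" and L: "finite L" and X: "X \<subseteq> cfg s" "closed_cfg X"
    "sub_cfg \<Sigma> X" "act_inv M (carrier M) X" "dep M snd s L X"
  have Xker: "act_inv M ker X" using X(4) ker_subset by (rule act_inv_subset)
  obtain m where m: "\<And>a b. a \<in> X \<Longrightarrow> b \<in> X \<Longrightarrow> agree M cell ({- int m..-1} \<times> L) a b \<Longrightarrow>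
    \<exists>x\<in>X. agree M cell ({0} \<times> L) x a \<and> agree M cell ({..-1} \<times> L) x b"
  proof -
    have "(\<Union>n. {- int n..-1} \<times> L) = {..-1 :: int} \<times> L"
    proof (intro equalityI subsetI)
      fix p :: "int \<times> nat" assume "p \<in> {..-1} \<times> L"
      then have "p \<in> {- int (nat (- fst p))..-1} \<times> L" by (auto simp: mem_Times_iff)
      then show "p \<in> (\<Union>n. {- int n..-1} \<times> L)" by (rule UN_I[OF UNIV_I])
    qed auto
    moreover have "\<exists>n. \<forall>a\<in>X. \<forall>b\<in>X. agree M cell ({- int n..-1} \<times> L) a b \<longrightarrow>
      (\<exists>x\<in>X. agree M cell ({0} \<times> L) x a \<and> agree M cell (\<Union>n. {- int n..-1} \<times> L) x b)"
      by (rule splice[OF mk \<Sigma> _ X(1-3) Xker]) (use L in auto)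
    ultimately have "\<exists>n. \<forall>a\<in>X. \<forall>b\<in>X. agree M cell ({- int n..-1} \<times> L) a b \<longrightarrow>
      (\<exists>x\<in>X. agree M cell ({0} \<times> L) x a \<and> agree M cell ({..-1} \<times> L) x b)"
      by (simp only:)
    then show thesis using that by metis
  qed
  define win where "win n = {- int n..0} \<times> L" for n
  have "finite (win m)" using L by (simp add: win_def)
  then obtain D H where DH: "on_cells M cell (win m) [(D, H)]" "proj M cell s (win m) X = sol M ker s [(D, H)]"
    by (rule markovD[OF mk \<Sigma> _ proj_cfg closed_cfg_proj[OF X(2,1)] sub_cfg_proj[OF \<Sigma> X(3)] act_inv_proj[OF is_grp ker_subset Xker cell_ker] dep_proj])
  let ?Y = "sol M (carrier M) s [(D, H)]"
  have invY: "act_inv M (carrier M) ?Y"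
    by (rule act_inv_sol[OF is_grp subgroup_self])
  have ker_sol: "x \<in> sol M ker s [(D, H)]" if "x \<in> ?Y" for x
    using that ker_subset by (auto simp: sol_def)
  have near: "\<exists>x\<in>X. agree M cell (win (m + n)) x y" if "y \<in> ?Y" for y n
    using that
  proof (induction n arbitrary: y)
    case 0
    then show ?case using ker_sol[of y] DH(2) by (metis projE add_0_right)
  next
    case (Suc n)
    have "(\<lambda>p. y (T (- 1) p)) \<in> ?Y" using act_inv_T[OF invY Suc.prems] .
    from Suc.IH[OF this] obtain x1 where x1: "x1 \<in> X" "agree M cell (win (m + n)) x1 (\<lambda>p. y (T (- 1) p))"
      by blast
    \<comment> \<open>The induction hypothesis for \<open>y\<close> moved by one level gives, after
      moving back, a point that fits on the levels below 0. Level 0 comes from \<open>a\<close>,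
      which fits the window rule, and the two match on m levels.\<close>
    define b where "b p = x1 (T 1 p)" for p
    have b: "b \<in> X" unfolding b_def using act_inv_T[OF X(4) x1(1)] .
    have yb: "agree M cell ({- int (m + Suc n)..-1} \<times> L) b y"
    proof -
      have "agree M cell {(i, l). (i + 1, l) \<in> win (m + n)} b y"
        using agree_T[OF x1(2), of 1] by (simp add: b_def[abs_def])
      then show ?thesis by (rule agree_mono) (auto simp: win_def)
    qed
    obtain a where a: "a \<in> X" "agree M cell (win m) a y"
      using ker_sol[OF Suc.prems] DH(2) by (metis projE)
    have "agree M cell ({- int m..-1} \<times> L) a b"
      by (rule agree_trans[OF agree_mono[OF a(2)] agree_sym[OF agree_mono[OF yb]]]) (auto simp: win_def)
    from m[OF a(1) b this] obtain x where x: "x \<in> X" "agree M cell ({0} \<times> L) x a" "agree M cell ({..-1} \<times> L) x b"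
      by blast
    have "agree M cell ({0} \<times> L) x y"
      by (rule agree_trans[OF x(2) agree_mono[OF a(2)]]) (auto simp: win_def)
    moreover have "agree M cell ({- int (m + Suc n)..-1} \<times> L) x y"
      by (rule agree_trans[OF agree_mono[OF x(3)] yb]) auto
    moreover have "win (m + Suc n) = {0} \<times> L \<union> {- int (m + Suc n)..-1} \<times> L"
      by (auto simp: win_def)
    ultimately show ?case using x(1) by (metis agree_Un)
  qed
  have "X = ?Y"
  proof
    show "X \<subseteq> ?Y"
    proof
      fix x assume x: "x \<in> X"
      have "map (\<lambda>p. x (act M g p)) D \<in> set H" if "g \<in> carrier M" for g
      proof -
        have "(\<lambda>p. x (act M g p)) \<in> sol M ker s [(D, H)]"
          using act_invD[OF X(4) x that] proj_subset[OF X(1)] DH(2) by blast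
        from solD[OF this, of \<one> "(D, H)"] show ?thesis by (simp add: is_grp ker_def)
      qed
      then show "x \<in> ?Y" using x X(1) by (auto simp: sol_def)
    qed
  next
    show "?Y \<subseteq> X"
    proof
      fix y assume y: "y \<in> ?Y"
      show "y \<in> X"
      proof (rule closed_cfg_dep[OF X(2,5,1)])
        show "y \<in> cfg s" using y sol_cfg by blast
        fix W :: "site set" assume W: "finite W" "\<And>p. p \<in> W \<Longrightarrow> fst p \<in> carrier M \<and> snd p \<in> L"
        \<comment> \<open>The windows end at level 0, so the levels -b..b occupied by
          \<open>W\<close> are moved down to -2b..0.\<close>
        define b where "b = Max (insert 0 ((\<lambda>p. \<bar>lev (fst p)\<bar>) ` W))"
        have b: "\<bar>lev (fst p)\<bar> \<le> b" if "p \<in> W" for p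
          unfolding b_def using W(1) that by (intro Max_ge) auto
        have "0 \<le> b" unfolding b_def using W(1) by (intro Max_ge) auto
        obtain x where x: "x \<in> X" "agree M cell (win (m + nat (2 * b))) x (\<lambda>p. y (T b p))"
          using near[OF act_inv_T[OF invY y]] by blast
        have "x (T (- b) p) = y p" if "p \<in> W" for p
        proof -
          have "- b \<le> lev (fst p)" "lev (fst p) \<le> b" using b[OF that] by auto
          then show ?thesis
            using agreeD[OF x(2), of "T (- b) p"] W(2)[OF that] \<open>0 \<le> b\<close>
            by (simp add: win_def cell_def)
        qed
        then show "\<exists>x\<in>X. \<forall>p\<in>W. x p = y p"
          by (intro bexI[of _ "\<lambda>p. x (T (- b) p)"] ballI act_inv_T[OF X(4) x(1)])
      qed
    qed
  qed
  moreover have "on_cells M snd L [(D, H)]"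
    using DH(1) by (auto simp: on_cells_def win_def cell_def)
  ultimately show "\<exists>D H. on_cells M snd L [(D, H)] \<and> X = sol M (carrier M) s [(D, H)]" by blast
qed

text \<open>The certificate is cut out of the common solutions of \<open>cs1\<close> and
  \<open>cs2\<close>: \<open>csQ\<close> describes their trace on the window \<open>A\<close>, and
  \<open>csZ\<close> the trace of the solutions of \<open>cs1\<close> on \<open>C\<close>. Both
  traces are group shifts over the kernel on finitely many cells, so finite rules exist. The
  continuation statements hold because \<open>splice\<close> reconciles a point seen on
  \<open>A\<close> with one seen on \<open>C\<close>.\<close>

lemma ext_complete:
  fixes L :: "nat set"
  assumes mk: "markov M ker cell" and \<Sigma>: "group \<Sigma>" "carrier \<Sigma> = {..<s}" and L: "finite L"
    and cs: "on_cells M snd L cs1" "on_cells M snd UNIV cs2"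
    and X1: "sub_cfg \<Sigma> (sol M (carrier M) s cs1)" and X2: "sub_cfg \<Sigma> (sol M (carrier M) s cs2)"
    and ext: "\<And>z. z \<in> sol M (carrier M) s cs1 \<Longrightarrow> \<exists>x\<in>sol M (carrier M) s cs2. agree M snd L x z"
  shows "\<exists>A C csQ csZ. finite A \<and> C = {(k, l). l \<in> L \<and> ((k, l) \<in> A \<or> (k - 1, l) \<in> A)} \<and>
    (\<forall>a b k l. (a, l) \<in> A \<longrightarrow> (b, l) \<in> A \<longrightarrow> a \<le> k \<longrightarrow> k \<le> b \<longrightarrow> (k, l) \<in> A) \<and>
    on_cells M cell A csQ \<and> on_cells M cell C csZ \<and> on_cells M cell A cs2 \<and>
    sol M (carrier M) s cs1 \<subseteq> sol M ker s csZ \<and> sol M ker s csQ \<subseteq> sol M ker s cs2 \<and>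
    sub_cfg \<Sigma> (sol M ker s csQ) \<and> sub_cfg \<Sigma> (sol M ker s csZ) \<and>
    (\<forall>z\<in>sol M ker s csZ. \<exists>q\<in>sol M ker s csQ. agree M cell C q z) \<and>
    (\<forall>p\<in>sol M ker s csQ \<inter> sol M ker s csZ.
      \<exists>x\<in>cfg s. (\<lambda>r. x (act M t r)) \<in> sol M ker s csQ \<and> agree M cell (A \<union> C) x p) \<and>
    (\<forall>p\<in>sol M ker s csZ. (\<lambda>r. p (act M t r)) \<in> sol M ker s csQ \<longrightarrow>
      (\<exists>x\<in>sol M ker s csQ. agree M cell ({(k, l). (k - 1, l) \<in> A} \<union> C) x p))"
proof -
  let ?X1 = "sol M (carrier M) s cs1" and ?X2 = "sol M (carrier M) s cs2"
  define X where "X = ?X1 \<inter> ?X2"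
  have inv: "act_inv M (carrier M) ?X1" "act_inv M (carrier M) ?X2"
    by (rule act_inv_sol[OF is_grp subgroup_self])+
  have X: "X \<subseteq> cfg s" "closed_cfg X" "sub_cfg \<Sigma> X" "act_inv M (carrier M) X"
    unfolding X_def using sol_cfg closed_cfg_sol inv
    by (blast, auto intro!: closed_cfg_Int sub_cfg_Int X1 X2 act_inv_Int)
  have Xker: "act_inv M ker X" using X(4) ker_subset by (rule act_inv_subset)
  have dep1: "dep M snd s L ?X1"
    by (rule dep_sol[OF is_grp _ cs(1)]) auto
  \<comment> \<open>Since \<open>cs1\<close> reads the layers \<open>L\<close> only, an extension of
    \<open>z\<close> that satisfies \<open>cs2\<close> still satisfies \<open>cs1\<close>.\<close>
  have lift: "\<exists>x\<in>X. agree M cell (UNIV \<times> L) x z" if "z \<in> ?X1" for z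
  proof -
    obtain x where x: "x \<in> ?X2" "agree M snd L x z" using ext \<open>z \<in> ?X1\<close> by blast
    then have "x \<in> ?X1"
      using subsetD[OF sol_cfg x(1)] by (intro depD[OF dep1 \<open>z \<in> ?X1\<close>]) (auto intro: agree_sym)
    then show ?thesis using x by (auto simp: X_def agree_layers)
  qed
  define P where "P = (\<Union>r\<in>set cs2. set (fst r))"
  have "finite P" by (simp add: P_def)
  then have finP: "finite (insert 0 ((\<lambda>p. \<bar>lev (fst p)\<bar>) ` P))" by simp
  define m where "m = Max (insert 0 ((\<lambda>p. \<bar>lev (fst p)\<bar>) ` P))"
  have m: "\<bar>lev (fst p)\<bar> \<le> m" if "p \<in> P" for p
    unfolding m_def by (rule Max_ge[OF finP]) (use that in auto)
  \<comment> \<open>All cells read by \<open>cs2\<close>, filled up to an interval of levels in each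
    layer, which makes the window convex.\<close>
  define S where "S = {-m..m} \<times> snd ` P"
  have "finite S" using \<open>finite P\<close> by (simp add: S_def)
  define band where "band n = {- int n..int n} \<times> L" for n
  have "(\<Union>n. band n) = UNIV \<times> L"
  proof -
    have "(k, l) \<in> band (nat \<bar>k\<bar>)" if "l \<in> L" for k l
      using that by (auto simp: band_def)
    moreover have "band n \<subseteq> UNIV \<times> L" for n by (auto simp: band_def)
    ultimately show ?thesis by fast
  qed
  moreover have "band i \<subseteq> band j" if "i \<le> j" for i j
    using that by (auto simp: band_def)
  ultimately obtain n where n: "\<And>a b. a \<in> X \<Longrightarrow> b \<in> X \<Longrightarrow> agree M cell (band n) a b \<Longrightarrow>
    \<exists>x\<in>X. agree M cell S x a \<and> agree M cell (UNIV \<times> L) x b"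
    using splice[OF mk \<Sigma> \<open>finite S\<close> X(1-3) Xker, of band] by metis
  define N where "N = max n (nat m)"
  have N: "\<exists>x\<in>X. agree M cell S x a \<and> agree M cell (UNIV \<times> L) x b"
    if "a \<in> X" "b \<in> X" "agree M cell (band N) a b" for a b
    by (rule n[OF that(1,2) agree_mono[OF that(3)]]) (auto simp: band_def N_def)
  \<comment> \<open>The band on the prescribed layers is as wide as \<open>splice\<close> requires
    for gluing on \<open>S\<close>.\<close>
  define A where "A = S \<union> band N"
  define C where "C = {(k, l). l \<in> L \<and> ((k, l) \<in> A \<or> (k - 1, l) \<in> A)}"
  have "finite A" using \<open>finite S\<close> L by (simp add: A_def band_def)
  have "finite C"
  proof (rule finite_subset)
    show "C \<subseteq> A \<union> (\<lambda>(k, l). (k + 1, l)) ` A"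
      by (auto simp: C_def) (metis (no_types, lifting) case_prod_conv diff_add_cancel image_eqI)
    show "finite (A \<union> (\<lambda>(k, l). (k + 1, l)) ` A)" using \<open>finite A\<close> by simp
  qed
  have CL: "C \<subseteq> UNIV \<times> L" by (auto simp: C_def)
  have conv: "(k, l) \<in> A" if "(a, l) \<in> A" "(b, l) \<in> A" "a \<le> k" "k \<le> b" for a b k l
    using that unfolding A_def S_def band_def by auto
  have cs2A: "on_cells M cell A cs2"
    unfolding on_cells_def
  proof (intro ballI conjI)
    fix r p assume rp: "r \<in> set cs2" "p \<in> set (fst r)"
    then show "fst p \<in> carrier M" using cs(2) by (auto simp: on_cells_def)
    have "p \<in> P" using rp by (auto simp: P_def)
    then show "cell p \<in> A" using m[of p] by (auto simp: A_def S_def cell_def)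
  qed
  obtain DQ HQ where Q: "on_cells M cell A [(DQ, HQ)]" "proj M cell s A X = sol M ker s [(DQ, HQ)]"
    by (rule markovD[OF mk \<Sigma> \<open>finite A\<close> proj_cfg closed_cfg_proj[OF X(2,1)] sub_cfg_proj[OF \<Sigma> X(3)]
          act_inv_proj[OF is_grp ker_subset Xker cell_ker] dep_proj])
  obtain DZ HZ where Z: "on_cells M cell C [(DZ, HZ)]" "proj M cell s C ?X1 = sol M ker s [(DZ, HZ)]"
    by (rule markovD[OF mk \<Sigma> \<open>finite C\<close> proj_cfg closed_cfg_proj[OF closed_cfg_sol sol_cfg]
          sub_cfg_proj[OF \<Sigma> X1] act_inv_proj[OF is_grp ker_subset act_inv_subset[OF inv(1) ker_subset] cell_ker] dep_proj])
  let ?Q = "proj M cell s A X" and ?Z = "proj M cell s C ?X1"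
  have XQ: "X \<subseteq> ?Q" and XZ: "?X1 \<subseteq> ?Z"
    using X(1) sol_cfg by (simp_all add: proj_subset)
  have Zlift: "\<exists>x\<in>X. agree M cell C x z" if "z \<in> ?Z" for z
  proof -
    obtain z' where z': "z' \<in> ?X1" "agree M cell C z' z" using \<open>z \<in> ?Z\<close> by (elim projE)
    then obtain x where x: "x \<in> X" "agree M cell (UNIV \<times> L) x z'" using lift by blast
    show ?thesis
      by (rule bexI[of _ x], rule agree_trans[OF agree_mono[OF x(2) CL] z'(2)], rule x(1))
  qed
  have cs2Q: "?Q \<subseteq> sol M ker s cs2"
  proof
    fix y assume "y \<in> ?Q"
    then obtain x where x: "x \<in> X" "y \<in> cfg s" "agree M cell A x y" by (elim projE)
    have "dep M cell s A (sol M ker s cs2)"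
      by (rule dep_sol[OF is_grp ker_subset cs2A cell_ker])
    moreover have "x \<in> sol M ker s cs2" using x(1) ker_subset by (auto simp: X_def sol_def)
    ultimately show "y \<in> sol M ker s cs2" using x by (metis depD)
  qed
  have E0: "\<exists>q\<in>?Q. agree M cell C q z" if "z \<in> ?Z" for z
    using Zlift[OF that] XQ by blast
  \<comment> \<open>A point of \<open>X\<close> seen on \<open>A\<close> and one seen on
    \<open>C\<close> both agree with \<open>p\<close> on the band, so they can be glued: the first
    supplies \<open>S\<close>, the second all prescribed layers. Shifted by \<open>t\<close> the
    result is again in \<open>X\<close>.\<close>
  have E1: "\<exists>x\<in>cfg s. (\<lambda>r. x (act M t r)) \<in> ?Q \<and> agree M cell (A \<union> C) x p" if p: "p \<in> ?Q" "p \<in> ?Z" for p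
  proof -
    obtain a where a: "a \<in> X" "agree M cell A a p" using p(1) by (elim projE)
    obtain b where b: "b \<in> X" "agree M cell C b p" using Zlift[OF p(2)] by blast
    have "agree M cell (band N) a b"
      by (rule agree_trans[OF agree_mono[OF a(2)] agree_sym[OF agree_mono[OF b(2)]]])
        (auto simp: A_def C_def band_def)
    from N[OF a(1) b(1) this] obtain x where x: "x \<in> X" "agree M cell S x a" "agree M cell (UNIV \<times> L) x b" by blast
    have "agree M cell S x p"
      by (rule agree_trans[OF x(2) agree_mono[OF a(2)]]) (auto simp: A_def)
    moreover have xC: "agree M cell C x p"
      by (rule agree_trans[OF agree_mono[OF x(3)] b(2)]) (auto simp: C_def)
    moreover have "agree M cell (band N) x p"
      by (rule agree_mono[OF xC]) (auto simp: A_def C_def band_def)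
    moreover have "(\<lambda>r. x (act M t r)) \<in> ?Q"
      using act_invD[OF X(4) x(1)] XQ by auto
    ultimately show ?thesis
      using subsetD[OF X(1) x(1)] by (intro bexI[of _ x] conjI) (simp_all add: A_def agree_Un)
  qed
  \<comment> \<open>As for \<open>E1\<close>, but with the window one level higher: the gluing takes
    place after a shift by \<open>T 1\<close>, which \<open>T (- 1)\<close> undoes.\<close>
  have E2: "\<exists>x\<in>?Q. agree M cell ({(k, l). (k - 1, l) \<in> A} \<union> C) x p"
    if p: "(\<lambda>r. p (act M t r)) \<in> ?Q" "p \<in> ?Z" for p
  proof -
    obtain a where a: "a \<in> X" "agree M cell A a (\<lambda>r. p (T 1 r))" using p(1) unfolding T_1 by (elim projE)
    have a': "agree M cell {(k, l). (k - 1, l) \<in> A} (\<lambda>r. a (T (- 1) r)) p"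
      using agree_T[OF a(2), of "- 1"] by simp
    have aX: "(\<lambda>r. a (T (- 1) r)) \<in> X" using act_inv_T[OF X(4) a(1)] .
    obtain b where b: "b \<in> X" "agree M cell C b p" using Zlift[OF p(2)] by blast
    have bX: "(\<lambda>r. b (T 1 r)) \<in> X" using act_inv_T[OF X(4) b(1)] .
    have "agree M cell (band N) (\<lambda>r. b (T 1 r)) (\<lambda>r. p (T 1 r))"
      by (rule agree_mono[OF agree_T[OF b(2), of 1]]) (auto simp: A_def C_def band_def)
    then have "agree M cell (band N) a (\<lambda>r. b (T 1 r))"
      using agree_mono[OF a(2), of "band N"] by (auto simp: A_def intro: agree_trans agree_sym)
    from N[OF a(1) bX this] obtain x where x: "x \<in> X" "agree M cell S x a"
      "agree M cell (UNIV \<times> L) x (\<lambda>r. b (T 1 r))" by blast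
    let ?x = "\<lambda>r. x (T (- 1) r)"
    have x': "?x \<in> X" using act_inv_T[OF X(4) x(1)] .
    have "agree M cell S x (\<lambda>r. p (T 1 r))"
      by (rule agree_trans[OF x(2) agree_mono[OF a(2)]]) (auto simp: A_def)
    from agree_T[OF this, of "- 1"] have S: "agree M cell {(k, l). (k - 1, l) \<in> S} ?x p" by simp
    have "agree M cell (UNIV \<times> L) ?x b"
      using agree_T[OF x(3), of "- 1"] by (simp add: agree_def mem_Times_iff case_prod_beta)
    then have xC: "agree M cell C ?x p"
      by (rule agree_trans[OF agree_mono[OF _ CL] b(2)])
    have "agree M cell {(k, l). (k - 1, l) \<in> band N} ?x p"
      by (rule agree_mono[OF xC]) (auto simp: A_def C_def band_def)
    moreover have "{(k, l). (k - 1, l) \<in> A} = {(k, l). (k - 1, l) \<in> S} \<union> {(k, l). (k - 1, l) \<in> band N}"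
      by (auto simp: A_def)
    ultimately have "agree M cell ({(k, l). (k - 1, l) \<in> A} \<union> C) ?x p"
      using S xC by (simp add: agree_Un)
    then show ?thesis by (rule bexI[of _ ?x], intro subsetD[OF XQ x'])
  qed
  have sub: "sub_cfg \<Sigma> ?Q" "sub_cfg \<Sigma> ?Z"
    by (intro sub_cfg_proj[OF \<Sigma>] X(3) X1)+
  show ?thesis
  proof (rule exI[of _ A], rule exI[of _ C], rule exI[of _ "[(DQ, HQ)]"], rule exI[of _ "[(DZ, HZ)]"],
      intro conjI)
    show "finite A" by fact
    show "C = {(k, l). l \<in> L \<and> ((k, l) \<in> A \<or> (k - 1, l) \<in> A)}" by (fact C_def)
    show "\<forall>a b k l. (a, l) \<in> A \<longrightarrow> (b, l) \<in> A \<longrightarrow> a \<le> k \<longrightarrow> k \<le> b \<longrightarrow> (k, l) \<in> A"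
      by (intro allI impI) (rule conv)
    show "on_cells M cell A [(DQ, HQ)]" "on_cells M cell C [(DZ, HZ)]" "on_cells M cell A cs2"
      by fact+
    show "?X1 \<subseteq> sol M ker s [(DZ, HZ)]" "sol M ker s [(DQ, HQ)] \<subseteq> sol M ker s cs2"
      "sub_cfg \<Sigma> (sol M ker s [(DQ, HQ)])" "sub_cfg \<Sigma> (sol M ker s [(DZ, HZ)])"
      unfolding Q(2)[symmetric] Z(2)[symmetric] by fact+
    show "\<forall>z\<in>sol M ker s [(DZ, HZ)]. \<exists>q\<in>sol M ker s [(DQ, HQ)]. agree M cell C q z"
      unfolding Q(2)[symmetric] Z(2)[symmetric] by (intro ballI E0)
    show "\<forall>p\<in>sol M ker s [(DQ, HQ)] \<inter> sol M ker s [(DZ, HZ)].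
      \<exists>x\<in>cfg s. (\<lambda>r. x (act M t r)) \<in> sol M ker s [(DQ, HQ)] \<and> agree M cell (A \<union> C) x p"
      unfolding Q(2)[symmetric] Z(2)[symmetric] by (intro ballI E1) simp_all
    show "\<forall>p\<in>sol M ker s [(DZ, HZ)]. (\<lambda>r. p (act M t r)) \<in> sol M ker s [(DQ, HQ)] \<longrightarrow>
      (\<exists>x\<in>sol M ker s [(DQ, HQ)]. agree M cell ({(k, l). (k - 1, l) \<in> A} \<union> C) x p)"
      unfolding Q(2)[symmetric] Z(2)[symmetric] by (intro ballI impI E2)
  qed
qed

end

section \<open>Effective groups\<close>

definition effgrp :: "nat monoid \<Rightarrow> bool" where
  "effgrp K \<longleftrightarrow> group K \<and> decidable (\<lambda>a. a \<in> carrier K) \<and> computable (\<lambda>p. fst p \<otimes>\<^bsub>K\<^esub> snd p)"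

lemma decidable_carrier:
  "effgrp K \<Longrightarrow> computable f \<Longrightarrow> decidable (\<lambda>x. f x \<in> carrier K)"
  unfolding effgrp_def by (elim conjE) (rule decidable_compose)

lemma computable_group_mult:
  "effgrp K \<Longrightarrow> computable f \<Longrightarrow> computable g \<Longrightarrow> computable (\<lambda>x. f x \<otimes>\<^bsub>K\<^esub> g x)"
  unfolding effgrp_def by (rule computable_apply2) auto

lemma computable_act:
  assumes "effgrp K" "computable f" "computable g"
  shows "computable (\<lambda>x. act K (f x) (g x))"
  unfolding act_def
  by (intro comp_intro decidable_carrier[OF assms(1)] computable_group_mult[OF assms(1)] assms(2,3))

definition map_rules :: "(site \<Rightarrow> site) \<Rightarrow> rules \<Rightarrow> rules" where
  "map_rules f cs = map (\<lambda>r. (map f (fst r), snd r)) cs"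

lemma computable_map_rules:
  assumes "computable (\<lambda>p. f (fst p) (snd p))" "computable cs"
  shows "computable (\<lambda>x. map_rules (f x) (cs x))"
  unfolding map_rules_def
  by (intro comp_intro assms(2) computable_compose[OF assms(1), of "\<lambda>p. (fst (fst p), snd p)", simplified])

subsection \<open>Inclusion of shifts of finite type\<close>

text \<open>A word on the sites \<open>T\<close> read as a configuration: sites that are not listed
  get 0, a legal symbol as soon as s > 0.\<close>

definition look :: "site list \<Rightarrow> nat list \<Rightarrow> site \<Rightarrow> nat" where
  "look T v p = foldr (\<lambda>qa r. if fst qa = p then snd qa else r) (zip T v) 0"

lemma look_map: "p \<in> set T \<Longrightarrow> look T (map x T) p = x p"
  unfolding look_def by (induction T) auto

lemma look_less:
  assumes "s > 0" "set v \<subseteq> {..<s}" shows "look T v p < s"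
proof -
  have "foldr (\<lambda>qa r. if fst qa = p then snd qa else r) zs 0 < s" if "\<forall>qa\<in>set zs. snd qa < s" for zs
    using that assms(1) by (induction zs) auto
  moreover have "\<forall>qa\<in>set (zip T v). snd qa < s"
    using assms(2) by (auto dest!: set_zip_rightD)
  ultimately show ?thesis unfolding look_def by blast
qed

lemma computable_look [comp_intro]:
  assumes "computable f" "computable g" "computable h"
  shows "computable (\<lambda>x. look (f x) (g x) (h x))"
  unfolding look_def by (intro comp_intro assms computable_compose[OF assms(3), of fst])

definition incl_sites :: "nat monoid \<Rightarrow> nat list \<Rightarrow> rules \<Rightarrow> rules \<Rightarrow> site list" where
  "incl_sites K C cs1 cs2 =
    concat (map (\<lambda>g. concat (map (\<lambda>r. map (act K g) (fst r)) cs1)) C) @ concat (map fst cs2)"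

text \<open>The conclusion is tested at the identity only, since invariance under \<open>B\<close>
  carries it to all translates. Quantifying over words on finitely many sites makes the test
  decidable.\<close>

definition incl_check :: "nat monoid \<Rightarrow> nat set \<Rightarrow> nat \<Rightarrow> rules \<Rightarrow> rules \<Rightarrow> nat list \<Rightarrow> bool" where
  "incl_check K B s cs1 cs2 C \<longleftrightarrow> (\<forall>g\<in>set C. g \<in> B) \<and>
    (\<forall>v\<in>set (List.n_lists (length (incl_sites K C cs1 cs2)) [0..<s]).
      (\<forall>g\<in>set C. \<forall>r\<in>set cs1. map (\<lambda>p. look (incl_sites K C cs1 cs2) v (act K g p)) (fst r) \<in> set (snd r)) \<longrightarrow>
      (\<forall>r\<in>set cs2. map (look (incl_sites K C cs1 cs2) v) (fst r) \<in> set (snd r)))"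

definition incl :: "nat monoid \<Rightarrow> nat set \<Rightarrow> nat \<times> rules \<times> rules \<Rightarrow> bool" where
  "incl K B z \<longleftrightarrow> (\<exists>C. incl_check K B (fst z) (fst (snd z)) (snd (snd z)) C)"

lemma re_pred_incl:
  assumes "effgrp K" "decidable (\<lambda>g. g \<in> B)"
  shows "re_pred (incl K B)"
proof -
  have sites: "computable (\<lambda>x. incl_sites K (C x) (cs1 x) (cs2 x))"
    if "computable C" "computable cs1" "computable cs2" for C :: "'z::encodable \<Rightarrow> _" and cs1 cs2
    unfolding incl_sites_def
    by (intro comp_intro that computable_act[OF assms(1)] computable_compose[OF that(2), of fst])
  have "re_pred (\<lambda>z. \<exists>C. incl_check K B (fst z) (fst (snd z)) (snd (snd z)) C)"
    unfolding incl_check_def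
    by (intro re_pred_ex re_pred_decidable comp_intro decidable_compose[OF assms(2)] sites computable_act[OF assms(1)])
  then show ?thesis by (simp add: incl_def[abs_def])
qed

lemma incl_sound:
  assumes K: "group K" "subgroup B K" and i: "incl K B (s, cs1, cs2)"
  shows "sol K B s cs1 \<subseteq> sol K B s cs2"
proof
  fix x assume x: "x \<in> sol K B s cs1"
  obtain C where C: "incl_check K B s cs1 cs2 C" using i by (auto simp: incl_def)
  let ?T = "incl_sites K C cs1 cs2"
  have "map y (fst r) \<in> set (snd r)" if y: "y \<in> sol K B s cs1" and r: "r \<in> set cs2" for y r
  proof -
    have "map y ?T \<in> set (List.n_lists (length ?T) [0..<s])"
      using y by (auto simp: set_n_lists sol_def cfg_def)
    moreover have "map (\<lambda>p. look ?T (map y ?T) (act K g p)) (fst q) \<in> set (snd q)"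
      if "g \<in> set C" "q \<in> set cs1" for g q
    proof -
      have "look ?T (map y ?T) (act K g p) = y (act K g p)" if "p \<in> set (fst q)" for p
        by (rule look_map) (use \<open>g \<in> set C\<close> \<open>q \<in> set cs1\<close> that in \<open>force simp: incl_sites_def\<close>)
      then have "map (\<lambda>p. look ?T (map y ?T) (act K g p)) (fst q) = map (\<lambda>p. y (act K g p)) (fst q)"
        by simp
      then show ?thesis using solD[OF y _ that(2), of g] C that by (metis incl_check_def)
    qed
    ultimately have "map (look ?T (map y ?T)) (fst r) \<in> set (snd r)"
      using C r unfolding incl_check_def by blast
    moreover have "look ?T (map y ?T) p = y p" if "p \<in> set (fst r)" for p
      by (rule look_map) (use r that in \<open>auto simp: incl_sites_def\<close>)
    ultimately show ?thesis by (metis (no_types, lifting) map_cong)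
  qed
  from this[OF act_invD[OF act_inv_sol[OF K] x]]
  have "map (\<lambda>p. x (act K g p)) (fst r) \<in> set (snd r)" if "g \<in> B" "r \<in> set cs2" for g r
    using that .
  then show "x \<in> sol K B s cs2"
    using subsetD[OF sol_cfg x] by (simp add: sol_def)
qed

text \<open>Compactness: if all finite \<open>C\<close> fail, the counterexample words accumulate at
  a configuration that obeys \<open>cs1\<close> everywhere and violates \<open>cs2\<close> at the
  identity.\<close>

lemma incl_complete:
  assumes K: "group K" "subgroup B K" and s: "s > 0"
    and sub: "sol K B s cs1 \<subseteq> sol K B s cs2"
  shows "incl K B (s, cs1, cs2)"
proof (rule ccontr)
  assume "\<not> ?thesis"
  then have no: "\<not> incl_check K B s cs1 cs2 C" for C by (auto simp: incl_def)
  \<comment> \<open>Group elements are numbers, so the sets \<open>C n\<close> exhaust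
    \<open>B\<close>.\<close>
  define C where "C n = filter (\<lambda>g. g \<in> B) [0..<n]" for n
  define T where "T n = incl_sites K (C n) cs1 cs2" for n
  have "\<exists>v. set v \<subseteq> {..<s} \<and>
      (\<forall>g\<in>set (C n). \<forall>r\<in>set cs1. map (\<lambda>p. look (T n) v (act K g p)) (fst r) \<in> set (snd r)) \<and>
      \<not> (\<forall>r\<in>set cs2. map (look (T n) v) (fst r) \<in> set (snd r))" for n
  proof -
    have "\<forall>g\<in>set (C n). g \<in> B" by (simp add: C_def)
    with no[of "C n"] obtain v where v: "v \<in> set (List.n_lists (length (T n)) [0..<s])"
      "\<forall>g\<in>set (C n). \<forall>r\<in>set cs1. map (\<lambda>p. look (T n) v (act K g p)) (fst r) \<in> set (snd r)"
      "\<not> (\<forall>r\<in>set cs2. map (look (T n) v) (fst r) \<in> set (snd r))"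
      unfolding incl_check_def T_def by blast
    have "set v \<subseteq> {..<s}" using v(1) by (auto simp: set_n_lists)
    with v(2,3) show ?thesis by blast
  qed
  then obtain v where v: "\<And>n. set (v n) \<subseteq> {..<s}"
    "\<And>n g r. g \<in> set (C n) \<Longrightarrow> r \<in> set cs1 \<Longrightarrow> map (\<lambda>p. look (T n) (v n) (act K g p)) (fst r) \<in> set (snd r)"
    "\<And>n. \<not> (\<forall>r\<in>set cs2. map (look (T n) (v n)) (fst r) \<in> set (snd r))" by metis
  have "closed_cfg (cfg s)"
    unfolding closed_cfg_def
  proof (intro allI impI)
    fix x :: config assume "\<forall>W. finite W \<longrightarrow> (\<exists>y\<in>cfg s. \<forall>p\<in>W. y p = x p)"
    from this[rule_format, of "{_}"] show "x \<in> cfg s" by (auto simp: cfg_def) metis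
  qed
  moreover have "look (T n) (v n) \<in> cfg s" for n
    using look_less[OF s v(1)] by (simp add: cfg_def)
  ultimately obtain x where x: "x \<in> cfg s"
    "\<And>W m. finite W \<Longrightarrow> \<exists>n\<ge>m. \<forall>p\<in>W. look (T n) (v n) p = x p"
    using closed_cfg_accumulate[of "cfg s" s "\<lambda>n. look (T n) (v n)"] by auto
  have "map (\<lambda>p. x (act K g p)) (fst r) \<in> set (snd r)" if "g \<in> B" "r \<in> set cs1" for g r
  proof -
    obtain n where n: "n \<ge> Suc g" "\<forall>p\<in>act K g ` set (fst r). look (T n) (v n) p = x p"
      using x(2)[of "act K g ` set (fst r)" "Suc g"] by auto
    have "g \<in> set (C n)" using n(1) that(1) by (auto simp: C_def)
    from v(2)[OF this that(2)] show ?thesis using n(2) by (simp cong: map_cong)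
  qed
  then have "x \<in> sol K B s cs1" using x(1) by (simp add: sol_def)
  then have "x \<in> sol K B s cs2" using sub by blast
  then have "map x (fst r) \<in> set (snd r)" if "r \<in> set cs2" for r
    using solD[of x K B s cs2 "\<one>\<^bsub>K\<^esub>" r] that K by (simp add: subgroup.one_closed)
  moreover obtain n where "\<forall>p\<in>(\<Union>r\<in>set cs2. set (fst r)). look (T n) (v n) p = x p"
    using x(2)[of "\<Union>r\<in>set cs2. set (fst r)" 0] by auto
  then have "map (look (T n) (v n)) (fst r) = map x (fst r)" if "r \<in> set cs2" for r
    using that by auto
  ultimately show False using v(3)[of n] by metis
qed

subsection \<open>Enumerating extension statements\<close>

definition exts :: "nat monoid \<Rightarrow> nat set \<Rightarrow> (site \<Rightarrow> 'c) \<Rightarrow> nat \<Rightarrow> 'c set \<Rightarrow> rules \<Rightarrow> rules \<Rightarrow> bool" where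
  "exts K B c s A cs1 cs2 \<longleftrightarrow> (\<forall>z\<in>sol K B s cs1. \<exists>x\<in>sol K B s cs2. agree K c A x z)"

text \<open>Soundness needs no algebra; completeness is only claimed for group shifts.\<close>

definition ext_enum :: "nat monoid \<Rightarrow> nat set \<Rightarrow> (site \<Rightarrow> 'c::encodable) \<Rightarrow> bool" where
  "ext_enum K B c \<longleftrightarrow> (\<exists>C. re_pred C \<and> (\<forall>s A cs1 cs2.
    on_cells K c UNIV cs1 \<longrightarrow> on_cells K c UNIV cs2 \<longrightarrow>
    (C (s, A, cs1, cs2) \<longrightarrow> exts K B c s (set A) cs1 cs2) \<and>
    (\<forall>\<Sigma>. group \<Sigma> \<longrightarrow> carrier \<Sigma> = {..<s} \<longrightarrow> on_cells K c (set A) cs1 \<longrightarrow>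
      sub_cfg \<Sigma> (sol K B s cs1) \<longrightarrow> sub_cfg \<Sigma> (sol K B s cs2) \<longrightarrow>
      exts K B c s (set A) cs1 cs2 \<longrightarrow> C (s, A, cs1, cs2))))"

lemma sol_append: "sol K B s (cs @ cs') = sol K B s cs \<inter> sol K B s cs'"
  by (auto simp: sol_def)

lemma on_cells_append: "on_cells K c A (cs @ cs') \<longleftrightarrow> on_cells K c A cs \<and> on_cells K c A cs'"
  by (auto simp: on_cells_def)

lemma on_cells_mono: "on_cells K c A cs \<Longrightarrow> A \<subseteq> A' \<Longrightarrow> on_cells K c A' cs"
  unfolding on_cells_def by blast

lemma on_cells_UNIV: "on_cells K c A cs \<Longrightarrow> on_cells K c' UNIV cs"
  unfolding on_cells_def by blast

lemma on_cells_map_rules: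
  "on_cells K c A (map_rules f cs) \<longleftrightarrow> (\<forall>r\<in>set cs. \<forall>p\<in>set (fst r). fst (f p) \<in> carrier K \<and> c (f p) \<in> A)"
  by (simp add: on_cells_def map_rules_def)

section \<open>Certificates over an infinite cyclic extension\<close>

context zext
begin

text \<open>The kernel is normal, so conjugation by t permutes its elements, and moving the rules by
  t amounts to composing configurations with t.\<close>

lemma sol_act_t:
  "x \<in> sol M ker s (map_rules (act M t) cs) \<longleftrightarrow> x \<in> cfg s \<and> (\<lambda>p. x (act M t p)) \<in> sol M ker s cs"
proof -
  have conj: "act M g (act M t p) = act M t (act M (inv t \<otimes> g \<otimes> t) p)"
    "act M t (act M g p) = act M (t \<otimes> g \<otimes> inv t) (act M t p)" if "g \<in> carrier M" for g p
    using that by (simp_all add: act_mult is_grp m_assoc, simp_all flip: m_assoc)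
  have ker: "inv t \<otimes> g \<otimes> t \<in> ker" "t \<otimes> g \<otimes> inv t \<in> ker" "g \<in> carrier M" if "g \<in> ker" for g
    using that by (auto simp: ker_def lev_mult lev_inv)
  show ?thesis
    unfolding sol_def map_rules_def
  proof (intro iffI; clarsimp simp: o_def cfg_compose)
    fix g D H
    assume "\<forall>g\<in>ker. \<forall>r\<in>set cs. map (\<lambda>p. x (act M g (act M t p))) (fst r) \<in> set (snd r)" "g \<in> ker" "(D, H) \<in> set cs"
    then show "map (\<lambda>p. x (act M t (act M g p))) D \<in> set H"
      using ker[of g] by (fastforce simp: conj(2))
  next
    fix g D H
    assume "\<forall>g\<in>ker. \<forall>r\<in>set cs. map (\<lambda>p. x (act M t (act M g p))) (fst r) \<in> set (snd r)" "g \<in> ker" "(D, H) \<in> set cs"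
    then show "map (\<lambda>p. x (act M g (act M t p))) D \<in> set H"
      using ker[of g] by (fastforce simp: conj(1))
  qed
qed

lemma sub_cfg_act_t:
  assumes "group \<Sigma>" "carrier \<Sigma> = {..<s}" "sub_cfg \<Sigma> (sol M ker s cs)"
  shows "sub_cfg \<Sigma> (sol M ker s (map_rules (act M t) cs))"
proof -
  interpret \<Sigma>: group \<Sigma> by fact
  have cfg: "x \<in> cfg s \<longleftrightarrow> (\<forall>p. x p \<in> carrier \<Sigma>)" for x by (auto simp: cfg_def assms(2))
  show ?thesis
    using sub_cfg_one[OF assms(3)] sub_cfg_mult[OF assms(3)] sub_cfg_inv[OF assms(3)]
    by (auto simp: sub_cfg_def sol_act_t cfg)
qed

definition up :: "(int \<times> nat) list \<Rightarrow> (int \<times> nat) list" where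
  "up A = map (\<lambda>c. (fst c + 1, snd c)) A"

lemma set_up: "set (up A) = {(k, l). (k - 1, l) \<in> set A}"
  by (auto simp: up_def image_iff) (metis diff_add_cancel fst_conv snd_conv)

lemma ext_enum_zext:
  assumes eff: "effgrp M" and lev: "computable lev" and mk: "markov M ker cell" and en: "ext_enum M ker cell"
  shows "ext_enum M (carrier M) snd"
proof -
  obtain C where C: "re_pred C" and
    sound: "\<And>s A cs1 cs2. on_cells M cell UNIV cs1 \<Longrightarrow> on_cells M cell UNIV cs2 \<Longrightarrow>
      C (s, A, cs1, cs2) \<Longrightarrow> exts M ker cell s (set A) cs1 cs2" and
    complete: "\<And>s A cs1 cs2 \<Sigma>. on_cells M cell UNIV cs1 \<Longrightarrow> on_cells M cell UNIV cs2 \<Longrightarrow>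
      group \<Sigma> \<Longrightarrow> carrier \<Sigma> = {..<s} \<Longrightarrow> on_cells M cell (set A) cs1 \<Longrightarrow>
      sub_cfg \<Sigma> (sol M ker s cs1) \<Longrightarrow> sub_cfg \<Sigma> (sol M ker s cs2) \<Longrightarrow>
      exts M ker cell s (set A) cs1 cs2 \<Longrightarrow> C (s, A, cs1, cs2)"
    using en unfolding ext_enum_def by blast
  \<comment> \<open>The cells that \<open>ext_sound\<close> calls \<open>C\<close>, as a
    list.\<close>
  define bd where "bd A L = filter (\<lambda>c. snd c \<in> set L) (A @ up A)" for A and L :: "nat list"
  define oc where "oc A cs \<longleftrightarrow> (\<forall>r\<in>set cs. \<forall>p\<in>set (fst r). fst p \<in> carrier M \<and> cell p \<in> set A)" for A and cs :: rules
  \<comment> \<open>The three occurrences of \<open>C\<close> express \<open>E0\<close>,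
    \<open>E1\<close> and \<open>E2\<close> of \<open>ext_sound\<close>; that a shifted
    configuration lies in Q becomes obedience to the rules of Q moved by t. The first conjunct is
    convexity of the window in each layer.\<close>
  define cert where "cert s L cs1 cs2 A csQ csZ \<longleftrightarrow>
    (\<forall>a\<in>set A. \<forall>b\<in>set A. snd a = snd b \<longrightarrow> (\<forall>i<nat (fst b - fst a). (fst a + int i, snd a) \<in> set A)) \<and>
    oc A csQ \<and> oc (bd A L) csZ \<and> oc A cs2 \<and>
    incl M (carrier M) (s, cs1, csZ) \<and> incl M ker (s, csQ, cs2) \<and>
    C (s, bd A L, csZ, csQ) \<and> C (s, A @ bd A L, csQ @ csZ, map_rules (act M t) csQ) \<and>
    C (s, up A @ bd A L, map_rules (act M t) csQ @ csZ, csQ)" for s L cs1 cs2 A csQ csZ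
  define C' where "C' z \<longleftrightarrow> (\<exists>A csQ csZ. cert (fst z) (fst (snd z)) (fst (snd (snd z))) (snd (snd (snd z))) A csQ csZ)"
    for z :: "nat \<times> nat list \<times> rules \<times> rules"
  have re: "re_pred C'"
  proof -
    have cell: "computable (\<lambda>x. cell (f x))" if "computable f" for f :: "'z::encodable \<Rightarrow> site"
      unfolding cell_def by (intro comp_intro computable_compose[OF lev] that)
    have up: "computable (\<lambda>x. up (f x))" if "computable f" for f :: "'z::encodable \<Rightarrow> _"
      unfolding up_def by (intro comp_intro that)
    have bd: "computable (\<lambda>x. bd (f x) (g x))" if "computable f" "computable g" for f :: "'z::encodable \<Rightarrow> _" and g
      unfolding bd_def by (intro comp_intro that up computable_compose[OF that(2), of fst])
    have oc: "decidable (\<lambda>x. oc (f x) (g x))" if "computable f" "computable g" for f :: "'z::encodable \<Rightarrow> _" and g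
      unfolding oc_def
      by (intro comp_intro that cell decidable_carrier[OF eff] computable_compose[OF that(1), of "\<lambda>p. fst (fst p)"])
    have car: "decidable (\<lambda>g. g \<in> carrier M)" using eff by (simp add: effgrp_def)
    have ker: "decidable (\<lambda>g. g \<in> ker)"
      unfolding ker_def mem_Collect_eq by (intro comp_intro car lev)
    have tr: "computable (\<lambda>x. map_rules (act M t) (f x))" if "computable f" for f :: "'z::encodable \<Rightarrow> _"
      by (intro computable_map_rules computable_act[OF eff] comp_intro that)
    show ?thesis
      unfolding C'_def[abs_def] cert_def
      by (intro re_pred_ex re_pred_conj re_pred_compose[OF C] re_pred_compose[OF re_pred_incl[OF eff car]]
          re_pred_compose[OF re_pred_incl[OF eff ker]])
        (intro re_pred_decidable comp_intro up bd oc tr)+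
  qed
  have oc: "oc A cs \<longleftrightarrow> on_cells M cell (set A) cs" for A cs
    by (simp add: oc_def on_cells_def)
  have bd: "set (bd A L) = {(k, l). l \<in> set L \<and> ((k, l) \<in> set A \<or> (k - 1, l) \<in> set A)}" for A L
    unfolding bd_def set_filter set_append set_up by auto
  have t_cells: "on_cells M cell (set (up A)) (map_rules (act M t) cs)" if "on_cells M cell (set A) cs" for A cs
    using that[unfolded on_cells_def] by (simp add: on_cells_map_rules set_up is_grp cell_act lev_t)
  have ker_sol: "sol M (carrier M) s cs \<subseteq> sol M ker s cs" for s cs
    using ker_subset by (auto simp: sol_def)
  have snd': "exts M (carrier M) snd s (set L) cs1 cs2"
    if v: "on_cells M snd UNIV cs1" "on_cells M snd UNIV cs2" and ce: "cert s L cs1 cs2 A csQ csZ"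
    for s L cs1 cs2 A csQ csZ
  proof -
    let ?Q = "sol M ker s csQ" and ?Z = "sol M ker s csZ"
    have Q: "on_cells M cell (set A) csQ" and Z: "on_cells M cell (set (bd A L)) csZ"
      and cs2: "on_cells M cell (set A) cs2" using ce unfolding cert_def oc by blast+
    note val = on_cells_UNIV[where c' = cell, OF Q] on_cells_UNIV[where c' = cell, OF Z]
      on_cells_UNIV[where c' = cell, OF t_cells[OF Q]]
    have "exts M ker cell s (set (bd A L)) csZ csQ"
      by (rule sound[OF val(2,1)]) (use ce in \<open>simp add: cert_def\<close>)
    then have E0: "\<exists>q\<in>?Q. agree M cell (set (bd A L)) q z" if "z \<in> ?Z" for z
      using that by (auto simp: exts_def)
    have "exts M ker cell s (set (A @ bd A L)) (csQ @ csZ) (map_rules (act M t) csQ)"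
      by (rule sound) (use ce val in \<open>simp_all add: cert_def on_cells_append\<close>)
    then have E1: "\<exists>x\<in>cfg s. (\<lambda>r. x (act M t r)) \<in> ?Q \<and> agree M cell (set A \<union> set (bd A L)) x p"
      if "p \<in> ?Q" "p \<in> ?Z" for p
    proof -
      from \<open>exts M ker cell s (set (A @ bd A L)) (csQ @ csZ) _\<close> that
      obtain x where "x \<in> sol M ker s (map_rules (act M t) csQ)" "agree M cell (set A \<union> set (bd A L)) x p"
        by (auto simp: exts_def sol_append)
      then show ?thesis unfolding sol_act_t by blast
    qed
    have "exts M ker cell s (set (up A @ bd A L)) (map_rules (act M t) csQ @ csZ) csQ"
      by (rule sound) (use ce val in \<open>simp_all add: cert_def on_cells_append\<close>)
    then have E2: "\<exists>x\<in>?Q. agree M cell (set (up A) \<union> set (bd A L)) x p"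
      if "(\<lambda>r. p (act M t r)) \<in> ?Q" "p \<in> ?Z" for p
      using that sol_cfg by (auto simp: exts_def sol_append sol_act_t subset_iff)
    have conv: "(k, l) \<in> set A" if "(a, l) \<in> set A" "(b, l) \<in> set A" "a \<le> k" "k \<le> b" for a b k l
    proof (cases "k = b")
      case False
      have "\<forall>i<nat (b - a). (a + int i, l) \<in> set A" using ce that(1,2) unfolding cert_def by force
      from this[rule_format, of "nat (k - a)"] show ?thesis using that False by auto
    qed (use that in simp)
    have X1: "sol M (carrier M) s cs1 \<subseteq> ?Z"
      using incl_sound[OF is_grp subgroup_self] ce ker_sol unfolding cert_def by blast
    have Qs: "?Q \<subseteq> sol M ker s cs2"
      using incl_sound[OF is_grp subgroup_ker] ce unfolding cert_def by blast
    have "\<exists>x\<in>sol M (carrier M) s cs2. agree M snd (set L) x z" if "z \<in> sol M (carrier M) s cs1" for z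
    proof (rule ext_sound[where A = "set A" and L = "set L" and Q = ?Q and Z = ?Z and s = s and cs = cs2,
          folded bd set_up])
      show "dep M cell s (set A) ?Q" by (rule dep_sol[OF is_grp ker_subset Q cell_ker])
      show "dep M cell s (set (bd A L)) ?Z" by (rule dep_sol[OF is_grp ker_subset Z cell_ker])
      show "sol M (carrier M) s cs1 \<subseteq> ?Z" "z \<in> sol M (carrier M) s cs1" "?Q \<subseteq> sol M ker s cs2"
        "on_cells M cell (set A) cs2" by fact+
      show "act_inv M (carrier M) (sol M (carrier M) s cs1)" by (rule act_inv_sol[OF is_grp subgroup_self])
    qed (use E0 E1 E2 conv sol_cfg in blast)+
    then show ?thesis by (simp add: exts_def)
  qed
  have complete': "\<exists>A csQ csZ. cert s L cs1 cs2 A csQ csZ"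
    if \<Sigma>: "group \<Sigma>" "carrier \<Sigma> = {..<s}" and v: "on_cells M snd (set L) cs1" "on_cells M snd UNIV cs2"
      and sub: "sub_cfg \<Sigma> (sol M (carrier M) s cs1)" "sub_cfg \<Sigma> (sol M (carrier M) s cs2)"
      and ex: "exts M (carrier M) snd s (set L) cs1 cs2" for s L cs1 cs2 \<Sigma>
  proof -
    have ex': "\<exists>x\<in>sol M (carrier M) s cs2. agree M snd (set L) x z" if "z \<in> sol M (carrier M) s cs1" for z
      using ex that by (simp add: exts_def)
    obtain A' csQ csZ where fin: "finite A'" and
      conv: "\<forall>a b k l. (a, l) \<in> A' \<longrightarrow> (b, l) \<in> A' \<longrightarrow> a \<le> k \<longrightarrow> k \<le> b \<longrightarrow> (k, l) \<in> A'" and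
      Q: "on_cells M cell A' csQ" and
      Z: "on_cells M cell {(k, l). l \<in> set L \<and> ((k, l) \<in> A' \<or> (k - 1, l) \<in> A')} csZ" and
      cs2: "on_cells M cell A' cs2" and X1: "sol M (carrier M) s cs1 \<subseteq> sol M ker s csZ" and
      Qs: "sol M ker s csQ \<subseteq> sol M ker s cs2" and
      subs: "sub_cfg \<Sigma> (sol M ker s csQ)" "sub_cfg \<Sigma> (sol M ker s csZ)" and
      E0: "\<forall>z\<in>sol M ker s csZ. \<exists>q\<in>sol M ker s csQ.
        agree M cell {(k, l). l \<in> set L \<and> ((k, l) \<in> A' \<or> (k - 1, l) \<in> A')} q z" and
      E1: "\<forall>p\<in>sol M ker s csQ \<inter> sol M ker s csZ.
        \<exists>x\<in>cfg s. (\<lambda>r. x (act M t r)) \<in> sol M ker s csQ \<and>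
          agree M cell (A' \<union> {(k, l). l \<in> set L \<and> ((k, l) \<in> A' \<or> (k - 1, l) \<in> A')}) x p" and
      E2: "\<forall>p\<in>sol M ker s csZ. (\<lambda>r. p (act M t r)) \<in> sol M ker s csQ \<longrightarrow>
        (\<exists>x\<in>sol M ker s csQ.
          agree M cell ({(k, l). (k - 1, l) \<in> A'} \<union> {(k, l). l \<in> set L \<and> ((k, l) \<in> A' \<or> (k - 1, l) \<in> A')}) x p)"
      using ext_complete[OF mk \<Sigma> finite_set v sub ex'] by blast
    obtain A where A: "A' = set A" using finite_list[OF fin] by blast
    note Z = Z[unfolded A, folded bd] and E0 = E0[unfolded A, folded bd] and E1 = E1[unfolded A, folded bd]
      and E2 = E2[unfolded A, folded bd set_up] and Q = Q[unfolded A] and cs2 = cs2[unfolded A]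
    note val = on_cells_UNIV[where c' = cell, OF Q] on_cells_UNIV[where c' = cell, OF Z]
      on_cells_UNIV[where c' = cell, OF t_cells[OF Q]]
    have s: "s > 0" using \<Sigma> group.is_monoid monoid.one_closed by fastforce
    have tsub: "sub_cfg \<Sigma> (sol M ker s (map_rules (act M t) csQ))"
      by (rule sub_cfg_act_t[OF \<Sigma> subs(1)])
    \<comment> \<open>The inclusion provided by \<open>ext_complete\<close> has rules over the
      kernel on its right-hand side. Solutions of \<open>cs1\<close> are invariant under
      \<open>M\<close>, so they obey \<open>csZ\<close> at every element of \<open>M\<close>, and
      both sides can be compared over \<open>M\<close>.\<close>
    have "incl M (carrier M) (s, cs1, csZ)"
    proof (rule incl_complete[OF is_grp subgroup_self s])
      show "sol M (carrier M) s cs1 \<subseteq> sol M (carrier M) s csZ"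
      proof
        fix x assume x: "x \<in> sol M (carrier M) s cs1"
        have "map (\<lambda>p. x (act M g p)) (fst r) \<in> set (snd r)" if "g \<in> carrier M" "r \<in> set csZ" for g r
          using solD[OF subsetD[OF X1 act_invD[OF act_inv_sol[OF is_grp subgroup_self] x that(1)]]
              subgroup.one_closed[OF subgroup_ker] that(2)] by (simp add: is_grp)
        then show "x \<in> sol M (carrier M) s csZ" using subsetD[OF sol_cfg x] by (simp add: sol_def)
      qed
    qed
    moreover have "incl M ker (s, csQ, cs2)"
      by (rule incl_complete[OF is_grp subgroup_ker s Qs])
    moreover have "C (s, bd A L, csZ, csQ)"
      by (rule complete[OF val(2,1) \<Sigma> Z subs(2,1)]) (use E0 in \<open>simp add: exts_def\<close>)
    moreover have "C (s, A @ bd A L, csQ @ csZ, map_rules (act M t) csQ)"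
    proof (rule complete[OF _ val(3) \<Sigma> _ _ tsub])
      show "on_cells M cell UNIV (csQ @ csZ)" "on_cells M cell (set (A @ bd A L)) (csQ @ csZ)"
        using val Q Z by (auto simp: on_cells_append elim: on_cells_mono)
      show "sub_cfg \<Sigma> (sol M ker s (csQ @ csZ))" unfolding sol_append by (rule sub_cfg_Int[OF subs])
      show "exts M ker cell s (set (A @ bd A L)) (csQ @ csZ) (map_rules (act M t) csQ)"
        unfolding exts_def
      proof
        fix z assume "z \<in> sol M ker s (csQ @ csZ)"
        with E1 obtain x where "x \<in> cfg s" "(\<lambda>r. x (act M t r)) \<in> sol M ker s csQ"
          "agree M cell (set A \<union> set (bd A L)) x z" by (auto simp: sol_append)
        then show "\<exists>x\<in>sol M ker s (map_rules (act M t) csQ). agree M cell (set (A @ bd A L)) x z"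
          by (intro bexI[of _ x]) (simp_all add: sol_act_t)
      qed
    qed
    moreover have "C (s, up A @ bd A L, map_rules (act M t) csQ @ csZ, csQ)"
    proof (rule complete[OF _ val(1) \<Sigma> _ _ subs(1)])
      show "on_cells M cell UNIV (map_rules (act M t) csQ @ csZ)"
        "on_cells M cell (set (up A @ bd A L)) (map_rules (act M t) csQ @ csZ)"
        using val t_cells[OF Q] Z by (auto simp: on_cells_append elim: on_cells_mono)
      show "sub_cfg \<Sigma> (sol M ker s (map_rules (act M t) csQ @ csZ))"
        unfolding sol_append by (rule sub_cfg_Int[OF tsub subs(2)])
      show "exts M ker cell s (set (up A @ bd A L)) (map_rules (act M t) csQ @ csZ) csQ"
        using E2 by (auto simp: exts_def sol_append sol_act_t)
    qed
    moreover have "\<forall>a\<in>set A. \<forall>b\<in>set A. snd a = snd b \<longrightarrow> (\<forall>i<nat (fst b - fst a). (fst a + int i, snd a) \<in> set A)"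
    proof (intro ballI impI allI)
      fix a b i assume ab: "a \<in> set A" "b \<in> set A" "snd a = snd b" "i < nat (fst b - fst a)"
      have "(fst a, snd a) \<in> set A" using ab(1) by simp
      moreover have "(fst b, snd a) \<in> set A" using ab by (metis prod.collapse)
      moreover have "fst a + int i \<le> fst b" using ab(4) by (simp add: zless_nat_eq_int_zless)
      ultimately show "(fst a + int i, snd a) \<in> set A"
        using conv[unfolded A, rule_format, of "fst a" "snd a" "fst b" "fst a + int i"] by simp
    qed
    ultimately have "cert s L cs1 cs2 A csQ csZ"
      using Q Z cs2 unfolding cert_def oc by blast
    then show ?thesis by blast
  qed
  show ?thesis
    unfolding ext_enum_def
  proof (intro exI[of _ C'] conjI allI impI re)
    fix s L cs1 cs2 assume v: "on_cells M snd UNIV cs1" "on_cells M snd UNIV cs2"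
    show "exts M (carrier M) snd s (set L) cs1 cs2" if "C' (s, L, cs1, cs2)"
      using that snd'[OF v] by (auto simp: C'_def)
    show "C' (s, L, cs1, cs2)" if "group \<Sigma>" "carrier \<Sigma> = {..<s}" "on_cells M snd (set L) cs1"
      "sub_cfg \<Sigma> (sol M (carrier M) s cs1)" "sub_cfg \<Sigma> (sol M (carrier M) s cs2)"
      "exts M (carrier M) snd s (set L) cs1 cs2" for \<Sigma>
      using complete'[OF that(1-3) v(2) that(4-6)] by (simp add: C'_def)
  qed
qed

end

subsection \<open>Passing from a normal subgroup to a cyclic extension\<close>

text \<open>
  The elements of \<open>M\<close> are \<open>a t\<^sup>k\<close> with \<open>a\<close> in the normal subgroup \<open>N\<close>, coded as \<open>enc (a, k)\<close>, where
  \<open>k\<close> ranges over the integers for \<open>r = 0\<close> (since \<open>k mod 0 = k\<close>) and over \<open>{0..<r}\<close> otherwise.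
\<close>

locale cyclic_step =
  fixes N M :: "nat monoid" and r t :: nat
  assumes effN: "effgrp N" and effM: "effgrp M"
    and carM: "carrier M = {m. fst (dec m :: nat \<times> int) \<in> carrier N \<and> snd (dec m :: nat \<times> int) mod int r = snd (dec m :: nat \<times> int)}"
    and t: "t \<in> carrier M"
    and enc_eq: "\<And>a k. a \<in> carrier N \<Longrightarrow> k mod int r = k \<Longrightarrow> enc (a, k) = enc (a, 0 :: int) \<otimes>\<^bsub>M\<^esub> t [^]\<^bsub>M\<^esub> k"
    and emb_mult: "\<And>a b. a \<in> carrier N \<Longrightarrow> b \<in> carrier N \<Longrightarrow>
      enc (a \<otimes>\<^bsub>N\<^esub> b, 0 :: int) = enc (a, 0 :: int) \<otimes>\<^bsub>M\<^esub> enc (b, 0 :: int)"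
    and lev_add: "\<And>m m'. r = 0 \<Longrightarrow> m \<in> carrier M \<Longrightarrow> m' \<in> carrier M \<Longrightarrow>
      snd (dec (m \<otimes>\<^bsub>M\<^esub> m') :: nat \<times> int) = snd (dec m :: nat \<times> int) + snd (dec m' :: nat \<times> int)"
begin

sublocale N: group N using effN by (simp add: effgrp_def)
sublocale M: group M using effM by (simp add: effgrp_def)

section \<open>Levels of M as layers over N\<close>

definition lev :: "nat \<Rightarrow> int" where "lev m = snd (dec m :: nat \<times> int)"
definition base :: "nat \<Rightarrow> nat" where "base m = fst (dec m :: nat \<times> int)"
definition emb :: "nat \<Rightarrow> nat" where "emb a = enc (a, 0 :: int)"
definition B :: "nat set" where "B = {m \<in> carrier M. lev m = 0}"
definition cell :: "site \<Rightarrow> int \<times> nat" where "cell p = (lev (fst p), snd p)"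

text \<open>The level moves from the group element into the layer: a site of M in level k and layer
  l becomes a site of N in layer \<open>enc (k, l)\<close>. \<open>to_M\<close> and
  \<open>to_N\<close> are inverse on all sites; for r > 0, layers whose level is not a residue
  correspond to sites outside M.\<close>

definition to_M :: "site \<Rightarrow> site" where
  "to_M p = (enc (fst p, fst (dec (snd p) :: int \<times> nat)), snd (dec (snd p) :: int \<times> nat))"

definition to_N :: "site \<Rightarrow> site" where
  "to_N p = (base (fst p), enc (cell p))"

lemma lev_enc [simp]: "lev (enc (a, k :: int)) = k" and base_enc [simp]: "base (enc (a, k :: int)) = a"
  by (simp_all add: lev_def base_def)

lemma enc_base_lev [simp]: "enc (base m, lev m) = m"
  by (simp add: lev_def base_def)

lemma carM': "m \<in> carrier M \<longleftrightarrow> base m \<in> carrier N \<and> lev m mod int r = lev m"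
  unfolding carM base_def lev_def by simp

lemma computable_lev [comp_intro]: "computable f \<Longrightarrow> computable (\<lambda>x. lev (f x))"
proof -
  have "computable (dec :: nat \<Rightarrow> nat \<times> int)" by (simp add: computable_def total_rec_proj)
  then show "computable f \<Longrightarrow> computable (\<lambda>x. lev (f x))"
    unfolding lev_def by (rule computable_snd[OF computable_compose])
qed

lemma computable_base [comp_intro]: "computable f \<Longrightarrow> computable (\<lambda>x. base (f x))"
proof -
  have "computable (dec :: nat \<Rightarrow> nat \<times> int)" by (simp add: computable_def total_rec_proj)
  then show "computable f \<Longrightarrow> computable (\<lambda>x. base (f x))"
    unfolding base_def by (rule computable_fst[OF computable_compose])
qed

lemma computable_to_N [comp_intro]: "computable f \<Longrightarrow> computable (\<lambda>x. to_N (f x))"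
  unfolding to_N_def cell_def by (intro comp_intro)

lemma to_M_to_N [simp]: "to_M (to_N p) = p"
  by (simp add: to_M_def to_N_def cell_def)

lemma to_N_to_M [simp]: "to_N (to_M p) = p"
  by (simp add: to_M_def to_N_def cell_def)

lemma emb_B: "a \<in> carrier N \<Longrightarrow> emb a \<in> B" and B_base: "m \<in> B \<Longrightarrow> base m \<in> carrier N \<and> m = emb (base m)"
  by (auto simp: B_def emb_def carM' intro: enc_base_lev[symmetric]) (metis enc_base_lev)

lemma emb_closed [simp]: "a \<in> carrier N \<Longrightarrow> emb a \<in> carrier M"
  using emb_B by (simp add: B_def)

lemma emb_hom: "a \<in> carrier N \<Longrightarrow> b \<in> carrier N \<Longrightarrow> emb (a \<otimes>\<^bsub>N\<^esub> b) = emb a \<otimes>\<^bsub>M\<^esub> emb b"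
  by (simp add: emb_def emb_mult)

lemma emb_one: "emb \<one>\<^bsub>N\<^esub> = \<one>\<^bsub>M\<^esub>"
  using emb_hom[of "\<one>\<^bsub>N\<^esub>" "\<one>\<^bsub>N\<^esub>"] M.l_cancel_one'[of "emb \<one>\<^bsub>N\<^esub>" "emb \<one>\<^bsub>N\<^esub>"] by simp

lemma emb_inv: "a \<in> carrier N \<Longrightarrow> inv\<^bsub>M\<^esub> emb a = emb (inv\<^bsub>N\<^esub> a)"
  by (rule M.inv_equality) (simp_all add: emb_one flip: emb_hom)

lemma subgroup_B: "subgroup B M"
proof
  show "B \<subseteq> carrier M" by (auto simp: B_def)
  show "\<one>\<^bsub>M\<^esub> \<in> B" using emb_B[of "\<one>\<^bsub>N\<^esub>"] by (simp add: emb_one)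
  fix x assume x: "x \<in> B"
  show "inv\<^bsub>M\<^esub> x \<in> B" using B_base[OF x] emb_inv[of "base x"] emb_B[of "inv\<^bsub>N\<^esub> base x"] by auto
  fix y assume "y \<in> B"
  then show "x \<otimes>\<^bsub>M\<^esub> y \<in> B"
    using B_base[OF x] B_base[of y] emb_hom[of "base x" "base y"] emb_B[of "base x \<otimes>\<^bsub>N\<^esub> base y"] by auto
qed

lemma B_sub: "B \<subseteq> carrier M"
  by (auto simp: B_def)

lemma emb_enc: "a \<in> carrier N \<Longrightarrow> b \<in> carrier N \<Longrightarrow> k mod int r = k \<Longrightarrow>
    emb a \<otimes>\<^bsub>M\<^esub> enc (b, k) = enc (a \<otimes>\<^bsub>N\<^esub> b, k)"
  using enc_eq[of b k] enc_eq[of "a \<otimes>\<^bsub>N\<^esub> b" k] emb_hom[of a b] t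
  by (simp add: M.m_assoc emb_def[symmetric])

lemma fst_to_M: "fst (to_M p) \<in> carrier M \<longleftrightarrow>
    fst p \<in> carrier N \<and> fst (dec (snd p) :: int \<times> nat) mod int r = fst (dec (snd p) :: int \<times> nat)"
  by (simp add: to_M_def carM')

lemma act_to_M:
  "a \<in> carrier N \<Longrightarrow> fst (to_M p) \<in> carrier M \<Longrightarrow> act M (emb a) (to_M p) = to_M (act N a p)"
  using fst_to_M[of p] by (simp add: act_def) (simp add: to_M_def emb_enc)

lemma cell_to_M: "cell (to_M p) = dec (snd p)"
  by (simp add: cell_def to_M_def)

lemma cfg_to_M: "(\<lambda>p. x (to_M p)) \<in> cfg s \<longleftrightarrow> x \<in> cfg s"
  by (simp add: cfg_def) (metis to_M_to_N)

text \<open>\<open>B\<close> multiplies M from the left without changing the level, as N multiplies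
  itself. On sites of M the two actions correspond under \<open>to_M\<close>, and the rules read no
  other sites.\<close>

lemma sol_transfer:
  assumes "on_cells M c UNIV cs"
  shows "x \<in> sol M B s cs \<longleftrightarrow> (\<lambda>p. x (to_M p)) \<in> sol N (carrier N) s (map_rules to_N cs)"
proof -
  have "map (\<lambda>p. x (to_M (act N a (to_N p)))) (fst q) = map (\<lambda>p. x (act M (emb a) p)) (fst q)"
    if "a \<in> carrier N" "q \<in> set cs" for a q
    using assms that act_to_M[of a "to_N _"] by (auto simp: on_cells_def simp flip: act_to_M)
  then have eq: "map (\<lambda>p. x (to_M (act N a p))) (map to_N (fst q)) = map (\<lambda>p. x (act M (emb a) p)) (fst q)"
    if "a \<in> carrier N" "q \<in> set cs" for a q
    using that by (simp add: o_def)
  have B: "(\<forall>g\<in>B. P g) \<longleftrightarrow> (\<forall>a\<in>carrier N. P (emb a))" for P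
    using emb_B B_base by metis
  show ?thesis
    unfolding sol_def mem_Collect_eq cfg_to_M B map_rules_def set_map ball_simps fst_conv snd_conv
    using eq by (metis (no_types, lifting))
qed

lemma agree_transfer:
  assumes "\<And>c. c \<in> A \<Longrightarrow> fst c mod int r = fst c"
  shows "agree N snd (enc ` A) (\<lambda>p. x (to_M p)) (\<lambda>p. y (to_M p)) \<longleftrightarrow> agree M cell A x y"
proof
  assume a: "agree N snd (enc ` A) (\<lambda>p. x (to_M p)) (\<lambda>p. y (to_M p))"
  show "agree M cell A x y"
    unfolding agree_def
  proof (intro allI impI)
    fix p assume "fst p \<in> carrier M \<and> cell p \<in> A"
    then have "fst (to_N p) \<in> carrier N" "snd (to_N p) \<in> enc ` A"
      by (auto simp: to_N_def carM')
    from agreeD[OF a this] show "x p = y p" by simp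
  qed
next
  assume a: "agree M cell A x y"
  show "agree N snd (enc ` A) (\<lambda>p. x (to_M p)) (\<lambda>p. y (to_M p))"
    unfolding agree_def
  proof (intro allI impI)
    fix p assume p: "fst p \<in> carrier N \<and> snd p \<in> enc ` A"
    then have "dec (snd p) \<in> A" by auto
    then show "x (to_M p) = y (to_M p)"
      using assms[of "dec (snd p)"] p by (intro agreeD[OF a]) (auto simp: fst_to_M cell_to_M)
  qed
qed

lemma cell_valid: "fst p \<in> carrier M \<Longrightarrow> fst (cell p) mod int r = fst (cell p)"
  by (simp add: cell_def carM')

text \<open>Cells whose level is not a residue contain no site of M.\<close>

lemma agree_valid: "agree M cell A x y \<longleftrightarrow> agree M cell {c \<in> A. fst c mod int r = fst c} x y"
  using cell_valid by (auto simp: agree_def)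

lemma markov_transfer:
  assumes mk: "markov N (carrier N) snd"
  shows "markov M B cell"
  unfolding markov_def
proof (intro allI impI, elim conjE)
  fix s \<Sigma> X and A :: "(int \<times> nat) set"
  assume \<Sigma>: "group \<Sigma>" "carrier \<Sigma> = {..<s}" and fin: "finite A" and X: "X \<subseteq> cfg s" "closed_cfg X"
    "sub_cfg \<Sigma> X" "act_inv M B X" "dep M cell s A X"
  define A' where "A' = {c \<in> A. fst c mod int r = fst c}"
  have depA': "dep M cell s A' X"
    using X(5) unfolding dep_def A'_def by (subst (asm) agree_valid) 
  define Y where "Y = {y. (\<lambda>p. y (to_N p)) \<in> X}"
  have XY: "x \<in> X \<longleftrightarrow> (\<lambda>p. x (to_M p)) \<in> Y" for x by (simp add: Y_def)
  have Ycfg: "Y \<subseteq> cfg s"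
  proof
    fix y assume "y \<in> Y"
    then have "(\<lambda>p. y (to_N p)) \<in> cfg s" using X(1) by (auto simp: Y_def)
    from this[THEN cfg_compose, of to_M] show "y \<in> cfg s" by simp
  qed
  have Yclosed: "closed_cfg Y"
    unfolding closed_cfg_def
  proof (intro allI impI)
    fix y assume a: "\<forall>W. finite W \<longrightarrow> (\<exists>z\<in>Y. \<forall>p\<in>W. z p = y p)"
    have "(\<lambda>p. y (to_N p)) \<in> X"
    proof (rule X(2)[unfolded closed_cfg_def, rule_format])
      fix W :: "site set" assume "finite W"
      then obtain z where z: "z \<in> Y" "\<forall>p\<in>to_N ` W. z p = y p" using a by (metis finite_imageI)
      then show "\<exists>x\<in>X. \<forall>p\<in>W. x p = y (to_N p)"
        by (intro bexI[of _ "\<lambda>p. z (to_N p)"]) (auto simp: Y_def)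
    qed
    then show "y \<in> Y" by (simp add: Y_def)
  qed
  have Ysub: "sub_cfg \<Sigma> Y"
    using X(3) by (simp add: sub_cfg_def Y_def)
  have Yinv: "act_inv N (carrier N) Y"
    unfolding act_inv_def
  proof (intro ballI)
    fix y a assume y: "y \<in> Y" and a: "a \<in> carrier N"
    have "(\<lambda>p. y (to_N (act M (emb a) p))) \<in> X"
      using act_invD[OF X(4) _ emb_B[OF a], of "\<lambda>p. y (to_N p)"] y by (simp add: Y_def)
    moreover have "(\<lambda>p. y (act N a (to_N p))) \<in> cfg s"
      by (rule cfg_compose[OF subsetD[OF Ycfg y]])
    \<comment> \<open>Outside M the two actions can differ, as N moves bases also in layers that do
      not come from M; \<open>X\<close> does not depend on such sites.\<close>
    moreover have "agree M cell A (\<lambda>p. y (to_N (act M (emb a) p))) (\<lambda>p. y (act N a (to_N p)))"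
      unfolding agree_def
    proof (intro allI impI)
      fix p assume "fst p \<in> carrier M \<and> cell p \<in> A"
      then have "act M (emb a) p = to_M (act N a (to_N p))" using act_to_M[OF a, of "to_N p"] by simp
      then show "y (to_N (act M (emb a) p)) = y (act N a (to_N p))" by simp
    qed
    ultimately have "(\<lambda>p. y (act N a (to_N p))) \<in> X" by (rule depD[OF X(5)])
    then show "(\<lambda>p. y (act N a p)) \<in> Y" by (simp add: Y_def)
  qed
  have Ydep: "dep N snd s (enc ` A') Y"
    unfolding dep_def
  proof (intro ballI impI)
    fix y z assume y: "y \<in> Y" and z: "z \<in> cfg s" and "agree N snd (enc ` A') y z"
    then have "agree M cell A' (\<lambda>p. y (to_N p)) (\<lambda>p. z (to_N p))"
      using agree_transfer[of A' "\<lambda>p. y (to_N p)" "\<lambda>p. z (to_N p)"] by (simp add: A'_def)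
    then show "z \<in> Y" using depD[OF depA' _ cfg_compose[OF z]] y by (simp add: Y_def)
  qed
  have "finite (enc ` A')" using fin by (simp add: A'_def)
  then obtain D H where DH: "on_cells N snd (enc ` A') [(D, H)]" "Y = sol N (carrier N) s [(D, H)]"
    by (rule markovD[OF mk \<Sigma> _ Ycfg Yclosed Ysub Yinv Ydep])
  let ?cs = "map_rules to_M [(D, H)]"
  have on: "on_cells M cell A' ?cs"
    using DH(1) by (auto simp: on_cells_def map_rules_def fst_to_M cell_to_M A'_def)
  have cancel: "map_rules to_N ?cs = [(D, H)]" by (simp add: map_rules_def o_def)
  have "x \<in> X \<longleftrightarrow> x \<in> sol M B s ?cs" for x
    unfolding XY DH(2) sol_transfer[OF on_cells_UNIV[where c' = cell, OF on]] cancel ..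
  then have "X = sol M B s ?cs" by blast
  moreover have "on_cells M cell A ?cs"
    using on by (rule on_cells_mono) (auto simp: A'_def)
  moreover have "?cs = [(map to_M D, H)]" by (simp add: map_rules_def)
  ultimately show "\<exists>D H. on_cells M cell A [(D, H)] \<and> X = sol M B s [(D, H)]" by metis
qed

lemma sub_cfg_transfer:
  assumes "on_cells M c UNIV cs" "sub_cfg \<Sigma> (sol M B s cs)"
  shows "sub_cfg \<Sigma> (sol N (carrier N) s (map_rules to_N cs))"
proof -
  have "y \<in> sol N (carrier N) s (map_rules to_N cs) \<longleftrightarrow> (\<lambda>p. y (to_N p)) \<in> sol M B s cs" for y
    using sol_transfer[OF assms(1), of "\<lambda>p. y (to_N p)"] by simp
  then show ?thesis using assms(2) by (simp add: sub_cfg_def)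
qed

text \<open>Composition with \<open>to_M\<close> is a bijection of configurations, so both
  quantifiers can be substituted.\<close>

lemma exts_transfer:
  assumes "on_cells M c UNIV cs1" "on_cells M c UNIV cs2"
  shows "exts N (carrier N) snd s (enc ` {c \<in> A. fst c mod int r = fst c}) (map_rules to_N cs1) (map_rules to_N cs2)
    \<longleftrightarrow> exts M B cell s A cs1 cs2"
proof -
  let ?A = "enc ` {c \<in> A. fst c mod int r = fst c}"
  let ?S1 = "sol N (carrier N) s (map_rules to_N cs1)" and ?S2 = "sol N (carrier N) s (map_rules to_N cs2)"
  have all: "(\<forall>z. P z) \<longleftrightarrow> (\<forall>x. P (\<lambda>p. x (to_M p)))" for P :: "config \<Rightarrow> bool"
  proof (intro iffI allI)
    fix z :: config assume "\<forall>x :: config. P (\<lambda>p. x (to_M p))"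
    from this[rule_format, of "\<lambda>p. z (to_N p)"] show "P z" by simp
  qed simp
  have ex: "(\<exists>z. P z) \<longleftrightarrow> (\<exists>x. P (\<lambda>p. x (to_M p)))" for P :: "config \<Rightarrow> bool"
  proof
    assume "\<exists>z. P z"
    then obtain z where "P z" ..
    then show "\<exists>x :: config. P (\<lambda>p. x (to_M p))"
      by (intro exI[of _ "\<lambda>p. z (to_N p)"]) simp
  next
    assume "\<exists>x :: config. P (\<lambda>p. x (to_M p))"
    then obtain x :: config where "P (\<lambda>p. x (to_M p))" ..
    then show "\<exists>z. P z" by (rule exI[of P])
  qed
  have agr: "agree N snd ?A (\<lambda>p. x (to_M p)) (\<lambda>p. y (to_M p)) \<longleftrightarrow> agree M cell A x y" for x y
    by (subst agree_transfer) (auto simp flip: agree_valid)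
  have "exts N (carrier N) snd s ?A (map_rules to_N cs1) (map_rules to_N cs2) \<longleftrightarrow>
      (\<forall>z. (\<lambda>p. z (to_M p)) \<in> ?S1 \<longrightarrow> (\<exists>w\<in>?S2. agree N snd ?A w (\<lambda>p. z (to_M p))))"
    unfolding exts_def Ball_def by (rule all)
  moreover have "(\<exists>w\<in>?S2. agree N snd ?A w (\<lambda>p. z (to_M p))) \<longleftrightarrow>
      (\<exists>x. (\<lambda>p. x (to_M p)) \<in> ?S2 \<and> agree N snd ?A (\<lambda>p. x (to_M p)) (\<lambda>p. z (to_M p)))" for z
    unfolding Bex_def by (rule ex)
  ultimately show ?thesis
    by (simp add: agr exts_def Ball_def Bex_def sol_transfer[OF assms(1)] sol_transfer[OF assms(2)])
qed

lemma ext_enum_transfer: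
  assumes en: "ext_enum N (carrier N) snd"
  shows "ext_enum M B cell"
proof -
  obtain C where C: "re_pred C" and
    sound: "\<And>s A cs1 cs2. on_cells N snd UNIV cs1 \<Longrightarrow> on_cells N snd UNIV cs2 \<Longrightarrow>
      C (s, A, cs1, cs2) \<Longrightarrow> exts N (carrier N) snd s (set A) cs1 cs2" and
    complete: "\<And>s A cs1 cs2 \<Sigma>. on_cells N snd UNIV cs1 \<Longrightarrow> on_cells N snd UNIV cs2 \<Longrightarrow>
      group \<Sigma> \<Longrightarrow> carrier \<Sigma> = {..<s} \<Longrightarrow> on_cells N snd (set A) cs1 \<Longrightarrow>
      sub_cfg \<Sigma> (sol N (carrier N) s cs1) \<Longrightarrow> sub_cfg \<Sigma> (sol N (carrier N) s cs2) \<Longrightarrow>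
      exts N (carrier N) snd s (set A) cs1 cs2 \<Longrightarrow> C (s, A, cs1, cs2)"
    using en unfolding ext_enum_def by blast
  define R where "R A = map enc (filter (\<lambda>c. fst c mod int r = fst c) A)" for A :: "(int \<times> nat) list"
  have R: "set (R A) = enc ` {c \<in> set A. fst c mod int r = fst c}" for A by (simp add: R_def)
  define C' where "C' z = C (fst z, R (fst (snd z)), map_rules to_N (fst (snd (snd z))), map_rules to_N (snd (snd (snd z))))" for z
  have "re_pred C'"
    unfolding C'_def[abs_def] R_def
    by (intro re_pred_compose[OF C] comp_intro computable_map_rules)
  have valN: "on_cells N snd UNIV (map_rules to_N cs)" if "on_cells M cell UNIV cs" for cs
    using that by (auto simp: map_rules_def on_cells_def to_N_def carM')
  have onN: "on_cells N snd (set (R A)) (map_rules to_N cs)" if "on_cells M cell (set A) cs" for A cs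
    unfolding on_cells_map_rules
  proof (intro ballI conjI)
    fix q p assume "q \<in> set cs" "p \<in> set (fst q)"
    then have p: "fst p \<in> carrier M" "cell p \<in> set A" using that by (auto simp: on_cells_def)
    then show "fst (to_N p) \<in> carrier N" by (simp add: to_N_def carM')
    show "snd (to_N p) \<in> set (R A)" unfolding R using p cell_valid[of p] by (auto simp: to_N_def)
  qed
  show ?thesis
    unfolding ext_enum_def
  proof (intro exI[of _ C'] conjI allI impI)
    show "re_pred C'" by fact
    fix s A cs1 cs2 assume v: "on_cells M cell UNIV cs1" "on_cells M cell UNIV cs2"
    show "exts M B cell s (set A) cs1 cs2" if "C' (s, A, cs1, cs2)"
      using sound[OF valN[OF v(1)] valN[OF v(2)], of s "R A"] that
      unfolding R exts_transfer[OF v] by (simp add: C'_def)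
    show "C' (s, A, cs1, cs2)" if "group \<Sigma>" "carrier \<Sigma> = {..<s}" "on_cells M cell (set A) cs1"
      "sub_cfg \<Sigma> (sol M B s cs1)" "sub_cfg \<Sigma> (sol M B s cs2)" "exts M B cell s (set A) cs1 cs2" for \<Sigma>
      using complete[OF valN[OF v(1)] valN[OF v(2)] that(1,2) onN[OF that(3)]
          sub_cfg_transfer[OF v(1) that(4)] sub_cfg_transfer[OF v(2) that(5)]] that(6)
      unfolding R exts_transfer[OF v] by (simp add: C'_def)
  qed
qed

section \<open>From the normal subgroup to the whole group\<close>

lemma lev_mult: "r = 0 \<Longrightarrow> m \<in> carrier M \<Longrightarrow> m' \<in> carrier M \<Longrightarrow> lev (m \<otimes>\<^bsub>M\<^esub> m') = lev m + lev m'"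
  unfolding lev_def by (rule lev_add)

lemma zext: "r = 0 \<Longrightarrow> zext M t lev"
proof unfold_locales
  assume "r = 0"
  then have "t = enc (\<one>\<^bsub>N\<^esub>, 1 :: int)"
    using enc_eq[of "\<one>\<^bsub>N\<^esub>" 1] emb_one t by (simp add: emb_def M.int_pow_1)
  then show "lev t = 1" by simp
qed (auto simp: t lev_mult)

text \<open>For r > 0 there are only r levels, so a shift on finitely many layers is a shift over
  \<open>B\<close> on finitely many cells. By invariance under M, the rule found over
  \<open>B\<close> holds at all elements of M and describes the same set.\<close>

lemma markov_M:
  assumes mk: "markov N (carrier N) snd"
  shows "markov M (carrier M) snd"
proof (cases "r = 0")
  case True
  then interpret Z: zext M t lev by (rule zext)
  have "Z.ker = B" "Z.cell = cell" by (auto simp: Z.ker_def B_def Z.cell_def cell_def fun_eq_iff)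
  then show ?thesis using Z.markov_ext markov_transfer[OF mk] by simp
next
  case False
  note mkB = markov_transfer[OF mk]
  show ?thesis
    unfolding markov_def
  proof (intro allI impI, elim conjE)
    fix s \<Sigma> X and L :: "nat set"
    assume \<Sigma>: "group \<Sigma>" "carrier \<Sigma> = {..<s}" and L: "finite L" and X: "X \<subseteq> cfg s" "closed_cfg X"
      "sub_cfg \<Sigma> X" "act_inv M (carrier M) X" "dep M snd s L X"
    have fin: "finite ({0..<int r} \<times> L)" using L by simp
    have range: "0 \<le> lev m \<and> lev m < int r" if "m \<in> carrier M" for m
      using that False pos_mod_bound[of "int r" "lev m"] pos_mod_sign[of "int r" "lev m"] by (simp add: carM')
    have "agree M cell ({0..<int r} \<times> L) x y \<longleftrightarrow> agree M snd L x y" for x y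
      using range by (auto simp: agree_def cell_def)
    then have dep: "dep M cell s ({0..<int r} \<times> L) X" using X(5) by (simp add: dep_def)
    obtain D H where DH: "on_cells M cell ({0..<int r} \<times> L) [(D, H)]" "X = sol M B s [(D, H)]"
      by (rule markovD[OF mkB \<Sigma> fin X(1-3) act_inv_subset[OF X(4) B_sub] dep])
    have "X = sol M (carrier M) s [(D, H)]"
    proof
      show "sol M (carrier M) s [(D, H)] \<subseteq> X"
        unfolding DH(2) using B_sub by (auto simp: sol_def)
      show "X \<subseteq> sol M (carrier M) s [(D, H)]"
      proof
        fix x assume x: "x \<in> X"
        have "map (\<lambda>p. x (act M g p)) (fst q) \<in> set (snd q)" if "g \<in> carrier M" "q \<in> set [(D, H)]" for g q
          using solD[of "\<lambda>p. x (act M g p)" M B s "[(D, H)]" "\<one>\<^bsub>M\<^esub>" q] act_invD[OF X(4) x that(1)] that(2)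
            subgroup.one_closed[OF subgroup_B] unfolding DH(2)[symmetric] by (simp add: M.is_group)
        then show "x \<in> sol M (carrier M) s [(D, H)]" using subsetD[OF X(1) x] by (simp add: sol_def)
      qed
    qed
    moreover have "on_cells M snd L [(D, H)]" using DH(1) by (auto simp: on_cells_def cell_def)
    ultimately show "\<exists>D H. on_cells M snd L [(D, H)] \<and> X = sol M (carrier M) s [(D, H)]" by blast
  qed
qed

definition translates :: "rules \<Rightarrow> rules" where
  "translates cs = concat (map (\<lambda>i. map_rules (act M (enc (\<one>\<^bsub>N\<^esub>, int i))) cs) [0..<r])"

lemma sol_translates:
  assumes "r \<noteq> 0"
  shows "sol M B s (translates cs) = sol M (carrier M) s cs"
proof -
  let ?t = "\<lambda>i. enc (\<one>\<^bsub>N\<^esub>, int i)"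
  have tc: "?t i \<in> carrier M" if "i < r" for i using that by (simp add: carM')
  have split: "\<exists>g'\<in>B. \<exists>i<r. g = g' \<otimes>\<^bsub>M\<^esub> ?t i" if "g \<in> carrier M" for g
  proof (intro bexI exI conjI)
    have g: "base g \<in> carrier N" "lev g mod int r = lev g" using that by (auto simp: carM')
    then have "0 \<le> lev g" "lev g < int r"
      using assms pos_mod_bound[of "int r" "lev g"] pos_mod_sign[of "int r" "lev g"] by simp_all
    then show "nat (lev g) < r" "g = emb (base g) \<otimes>\<^bsub>M\<^esub> ?t (nat (lev g))"
      using g by (simp_all add: emb_enc)
    show "emb (base g) \<in> B" using g by (simp add: emb_B)
  qed
  have all: "(\<forall>g\<in>carrier M. P g) \<longleftrightarrow> (\<forall>g\<in>B. \<forall>i<r. P (g \<otimes>\<^bsub>M\<^esub> ?t i))" for P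
  proof (intro iffI ballI allI impI)
    fix g i assume "\<forall>g\<in>carrier M. P g" "g \<in> B" "i < r"
    then show "P (g \<otimes>\<^bsub>M\<^esub> ?t i)" using tc[of i] subsetD[OF B_sub, of g] by simp
  next
    fix g assume "\<forall>g\<in>B. \<forall>i<r. P (g \<otimes>\<^bsub>M\<^esub> ?t i)" "g \<in> carrier M"
    then show "P g" using split[of g] by auto
  qed
  have rules: "(\<forall>c\<in>set (translates cs). Q c) \<longleftrightarrow>
      (\<forall>i<r. \<forall>c\<in>set cs. Q (map (act M (?t i)) (fst c), snd c))" for Q
    by (auto simp: translates_def map_rules_def)
  have acts: "map (\<lambda>p. x (act M g p)) (map (act M (?t i)) D) = map (\<lambda>p. x (act M (g \<otimes>\<^bsub>M\<^esub> ?t i) p)) D"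
    if "g \<in> B" "i < r" for x :: config and g i D
    using that B_sub tc by (simp add: act_mult M.is_group subset_iff)
  have "(\<forall>g\<in>B. \<forall>c\<in>set (translates cs). map (\<lambda>p. x (act M g p)) (fst c) \<in> set (snd c)) \<longleftrightarrow>
      (\<forall>g\<in>carrier M. \<forall>c\<in>set cs. map (\<lambda>p. x (act M g p)) (fst c) \<in> set (snd c))" for x :: config
    unfolding all rules fst_conv snd_conv by (intro ball_cong refl all_cong) (simp only: acts)
  then show ?thesis unfolding sol_def by blast
qed

lemma computable_translates [comp_intro]: "computable f \<Longrightarrow> computable (\<lambda>x. translates (f x))"
proof -
  assume f: "computable f"
  have "computable (\<lambda>x. concat (map (\<lambda>i. map_rules (act M (enc (\<one>\<^bsub>N\<^esub>, int i))) (f x)) [0..<r]))"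
    by (intro comp_intro computable_map_rules computable_act[OF effM] computable_compose[OF f, of fst])
  then show ?thesis by (simp only: translates_def)
qed

lemma ext_enum_M:
  assumes mk: "markov N (carrier N) snd" and en: "ext_enum N (carrier N) snd"
  shows "ext_enum M (carrier M) snd"
proof (cases "r = 0")
  case True
  then interpret Z: zext M t lev by (rule zext)
  have "Z.ker = B" "Z.cell = cell" by (auto simp: Z.ker_def B_def Z.cell_def cell_def fun_eq_iff)
  then show ?thesis
    using Z.ext_enum_zext[OF effM] markov_transfer[OF mk] ext_enum_transfer[OF en]
      computable_lev[OF computable_id] by simp
next
  case False
  obtain C where C: "re_pred C" and
    sound: "\<And>s A cs1 cs2. on_cells M cell UNIV cs1 \<Longrightarrow> on_cells M cell UNIV cs2 \<Longrightarrow>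
      C (s, A, cs1, cs2) \<Longrightarrow> exts M B cell s (set A) cs1 cs2" and
    complete: "\<And>s A cs1 cs2 \<Sigma>. on_cells M cell UNIV cs1 \<Longrightarrow> on_cells M cell UNIV cs2 \<Longrightarrow>
      group \<Sigma> \<Longrightarrow> carrier \<Sigma> = {..<s} \<Longrightarrow> on_cells M cell (set A) cs1 \<Longrightarrow>
      sub_cfg \<Sigma> (sol M B s cs1) \<Longrightarrow> sub_cfg \<Sigma> (sol M B s cs2) \<Longrightarrow>
      exts M B cell s (set A) cs1 cs2 \<Longrightarrow> C (s, A, cs1, cs2)"
    using ext_enum_transfer[OF en] unfolding ext_enum_def by blast
  have range: "0 \<le> lev m \<and> lev m < int r" if "m \<in> carrier M" for m
    using that False pos_mod_bound[of "int r" "lev m"] pos_mod_sign[of "int r" "lev m"] by (simp add: carM')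
  define cells where "cells L = concat (map (\<lambda>i. map (\<lambda>l. (int i, l)) L) [0..<r])" for L :: "nat list"
  have cells: "set (cells L) = {0..<int r} \<times> set L" for L
  proof -
    have "set (cells L) = int ` {0..<r} \<times> set L" by (auto simp: cells_def)
    then show ?thesis by (simp add: image_int_atLeastLessThan)
  qed
  have agr: "agree M cell (set (cells L)) x y \<longleftrightarrow> agree M snd (set L) x y" for L x y
    using range by (auto simp: agree_def cell_def cells)
  have exts: "exts M B cell s (set (cells L)) (translates cs1) (translates cs2) \<longleftrightarrow>
      exts M (carrier M) snd s (set L) cs1 cs2" for s L cs1 cs2
    unfolding exts_def sol_translates[OF False] agr ..
  have tc: "enc (\<one>\<^bsub>N\<^esub>, int i) \<in> carrier M" if "i < r" for i
    using that by (simp add: carM')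
  have tr: "on_cells M cell (set (cells L)) (translates cs)" if "on_cells M snd (set L) cs" for L cs
    using that range tc
    by (auto simp: on_cells_def translates_def map_rules_def cells cell_def M.is_group)
  have trU: "on_cells M cell UNIV (translates cs)" if "on_cells M snd UNIV cs" for cs
    using that tc by (auto simp: on_cells_def translates_def map_rules_def M.is_group)
  define C' where "C' z = C (fst z, cells (fst (snd z)), translates (fst (snd (snd z))), translates (snd (snd (snd z))))" for z
  have "re_pred C'"
    unfolding C'_def[abs_def] cells_def
    by (intro re_pred_compose[OF C] comp_intro)
  show ?thesis
    unfolding ext_enum_def
  proof (intro exI[of _ C'] conjI allI impI)
    show "re_pred C'" by fact
    fix s L cs1 cs2 assume v: "on_cells M snd UNIV cs1" "on_cells M snd UNIV cs2"
    show "exts M (carrier M) snd s (set L) cs1 cs2" if "C' (s, L, cs1, cs2)"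
      using sound[OF trU[OF v(1)] trU[OF v(2)], of s "cells L"] that
      unfolding exts by (simp add: C'_def)
    show "C' (s, L, cs1, cs2)" if "group \<Sigma>" "carrier \<Sigma> = {..<s}" "on_cells M snd (set L) cs1"
      "sub_cfg \<Sigma> (sol M (carrier M) s cs1)" "sub_cfg \<Sigma> (sol M (carrier M) s cs2)"
      "exts M (carrier M) snd s (set L) cs1 cs2" for \<Sigma>
      using complete[OF trU[OF v(1)] trU[OF v(2)] that(1,2) tr[OF that(3)]] that(4-6)
      unfolding exts sol_translates[OF False] by (simp add: C'_def)
  qed
qed

end

text \<open>Codes of an extension are multiplied by means of conjugation by a lift of the generator.
  That conjugation is only known to be a homomorphism; this property, which passes up the tower,
  makes it computable.\<close>

definition homlift :: "nat monoid \<Rightarrow> bool" where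
  "homlift N \<longleftrightarrow> (\<forall>K h. effgrp K \<longrightarrow> h \<in> hom N K \<longrightarrow> (\<exists>h'. computable h' \<and> (\<forall>a\<in>carrier N. h' a = h a)))"

lemma computable_int_pow:
  assumes "effgrp K" "g \<in> carrier K"
  obtains P :: "int \<Rightarrow> nat" where "computable P" "\<And>k. P k = g [^]\<^bsub>K\<^esub> k"
proof -
  interpret group K using assms(1) by (simp add: effgrp_def)
  define pw where "pw x n = rec_nat \<one>\<^bsub>K\<^esub> (\<lambda>_ y. y \<otimes>\<^bsub>K\<^esub> x) n" for x and n :: nat
  have pw: "pw x n = x [^]\<^bsub>K\<^esub> n" for x n
    unfolding pw_def by (induction n) simp_all
  \<comment> \<open>Negative powers are powers of the fixed element inv g, so inversion enters as a
    constant.\<close>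
  define P where "P k = (if 0 \<le> k then pw g (nat k) else pw (inv\<^bsub>K\<^esub> g) (nat (- k)))" for k :: int
  have "computable P"
    unfolding P_def[abs_def] pw_def by (intro comp_intro computable_group_mult[OF assms(1)])
  moreover have "P k = g [^]\<^bsub>K\<^esub> k" for k
    by (cases k rule: int_cases2)
      (simp_all add: P_def pw int_pow_int int_pow_neg_int nat_pow_inv assms(2))
  ultimately show thesis by (rule that)
qed

text \<open>On a t^k the homomorphism takes the value of a times the k-th power of the value of t;
  the first factor is computable over N, the second is a power of a constant.\<close>

lemma (in cyclic_step) homlift_M:
  assumes "homlift N" shows "homlift M"
  unfolding homlift_def
proof (intro allI impI)
  fix K h assume K: "effgrp K" and h: "h \<in> hom M K"
  interpret K: group K using K by (simp add: effgrp_def)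
  interpret h: group_hom M K h by unfold_locales (rule h)
  have "(\<lambda>a. h (emb a)) \<in> hom N K"
    by (rule homI) (simp_all add: emb_hom)
  then obtain f where f: "computable f" "\<And>a. a \<in> carrier N \<Longrightarrow> f a = h (emb a)"
    using assms K unfolding homlift_def by blast
  obtain P where P: "computable P" "\<And>k :: int. P k = h t [^]\<^bsub>K\<^esub> k"
    using computable_int_pow[OF K h.hom_closed[OF t]] by blast
  have "computable (\<lambda>m. f (base m) \<otimes>\<^bsub>K\<^esub> P (lev m))"
    by (intro computable_group_mult[OF K] computable_compose[OF f(1)] computable_compose[OF P(1)] comp_intro)
  moreover have "f (base m) \<otimes>\<^bsub>K\<^esub> P (lev m) = h m" if "m \<in> carrier M" for m
  proof -
    have m: "base m \<in> carrier N" "lev m mod int r = lev m" using that by (auto simp: carM')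
    have "h m = h (emb (base m) \<otimes>\<^bsub>M\<^esub> t [^]\<^bsub>M\<^esub> lev m)"
      using enc_eq[OF m] by (simp add: emb_def)
    also have "\<dots> = h (emb (base m)) \<otimes>\<^bsub>K\<^esub> h t [^]\<^bsub>K\<^esub> lev m"
      using m t by (simp add: h.hom_int_pow)
    finally show ?thesis using f(2)[OF m(1)] P(2) by simp
  qed
  ultimately show "\<exists>h'. computable h' \<and> (\<forall>a\<in>carrier M. h' a = h a)" by blast
qed

definition good :: "nat monoid \<Rightarrow> bool" where
  "good K \<longleftrightarrow> effgrp K \<and> homlift K \<and> markov K (carrier K) snd \<and> ext_enum K (carrier K) snd"

lemma (in cyclic_step) good_M: "good N \<Longrightarrow> good M"
  unfolding good_def using effM homlift_M markov_M ext_enum_M by blast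

subsection \<open>The trivial group\<close>

definition triv :: "nat monoid" where
  "triv = \<lparr>carrier = {0}, mult = \<lambda>_ _. 0, one = 0\<rparr>"

lemma group_triv: "group triv"
  by (rule groupI) (auto simp: triv_def)

lemma act_triv [simp]: "act triv 0 p = p"
  by (cases p) (simp add: act_def triv_def)

lemma sol_triv: "sol triv {0} s cs = {x \<in> cfg s. \<forall>r\<in>set cs. map x (fst r) \<in> set (snd r)}"
  by (auto simp: sol_def)

text \<open>The rule lists the words that occur in \<open>X\<close> on the finitely many sites with
  layer in \<open>L\<close>; there are finitely many of them.\<close>

lemma markov_triv: "markov triv {0} snd"
  unfolding markov_def
proof (intro allI impI, elim conjE)
  fix s and \<Sigma> :: "nat monoid" and X :: "config set" and L :: "nat set"
  assume L: "finite L" and X: "X \<subseteq> cfg s" "dep triv snd s L X"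
  obtain D :: "site list" where D: "set D = {0} \<times> L" using finite_list[of "{0 :: nat} \<times> L"] L by auto
  have "finite ((\<lambda>x. map x D) ` X)"
  proof (rule finite_subset)
    show "(\<lambda>x. map x D) ` X \<subseteq> {xs. set xs \<subseteq> {..<s} \<and> length xs = length D}"
      using subsetD[OF X(1)] by (auto simp: cfg_def)
    show "finite {xs. set xs \<subseteq> {..<s} \<and> length xs = length D}"
      by (rule finite_lists_length_eq) simp
  qed
  from finite_list[OF this] obtain H where H: "set H = (\<lambda>x. map x D) ` X" ..
  have "x \<in> X" if x: "x \<in> cfg s" "map x D \<in> set H" for x
  proof -
    obtain y where y: "y \<in> X" "map x D = map y D" using x(2) unfolding H by (elim imageE)
    have "agree triv snd L y x"
      unfolding agree_def
    proof (intro allI impI)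
      fix p assume "fst p \<in> carrier triv \<and> snd p \<in> L"
      then have "p \<in> set D" by (simp add: D triv_def mem_Times_iff)
      then show "y p = x p" using y(2) by simp
    qed
    then show ?thesis by (rule depD[OF X(2) y(1) x(1)])
  qed
  moreover have "x \<in> cfg s \<and> map x D \<in> set H" if "x \<in> X" for x
    unfolding H using that X(1) by (intro conjI imageI) auto
  ultimately have "x \<in> X \<longleftrightarrow> x \<in> sol triv {0} s [(D, H)]" for x
    unfolding sol_triv by simp metis
  then have "X = sol triv {0} s [(D, H)]" by blast
  moreover have "on_cells triv snd L [(D, H)]" using D by (auto simp: on_cells_def triv_def)
  ultimately show "\<exists>D H. on_cells triv snd L [(D, H)] \<and> X = sol triv {0} s [(D, H)]" by blast
qed

text \<open>Over the trivial group only the finitely many sites in the rules and in the layers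
  \<open>L\<close> are involved, so the extension statement is decided by listing all words on
  them.\<close>

lemma ext_enum_triv: "ext_enum triv {0} snd"
proof -
  define T where "T L cs1 cs2 = concat (map fst cs1) @ concat (map fst cs2) @ map (Pair 0) L"
    for L :: "nat list" and cs1 cs2 :: rules
  define ok where "ok U cs v \<longleftrightarrow> (\<forall>r\<in>set cs. map (look U v) (fst r) \<in> set (snd r))" for U and cs :: rules and v
  define C where "C z \<longleftrightarrow> (\<forall>v\<in>set (List.n_lists (length (T (fst (snd z)) (fst (snd (snd z))) (snd (snd (snd z))))) [0..<fst z]).
     ok (T (fst (snd z)) (fst (snd (snd z))) (snd (snd (snd z)))) (fst (snd (snd z))) v \<longrightarrow>
     (\<exists>w\<in>set (List.n_lists (length (T (fst (snd z)) (fst (snd (snd z))) (snd (snd (snd z))))) [0..<fst z]).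
       ok (T (fst (snd z)) (fst (snd (snd z))) (snd (snd (snd z)))) (snd (snd (snd z))) w \<and>
       (\<forall>l\<in>set (fst (snd z)). look (T (fst (snd z)) (fst (snd (snd z))) (snd (snd (snd z)))) w (0, l) =
          look (T (fst (snd z)) (fst (snd (snd z))) (snd (snd (snd z)))) v (0, l))))"
    for z :: "nat \<times> nat list \<times> rules \<times> rules"
  have T: "computable (\<lambda>x. T (f x) (g x) (h x))" if "computable f" "computable g" "computable h"
    for f :: "'z::encodable \<Rightarrow> _" and g h
    unfolding T_def by (intro comp_intro that)
  have ok: "decidable (\<lambda>x. ok (f x) (g x) (h x))" if "computable f" "computable g" "computable h"
    for f :: "'z::encodable \<Rightarrow> _" and g h
    unfolding ok_def
    by (intro comp_intro that computable_compose[OF that(1), of "\<lambda>p. fst (fst p)"]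
        computable_compose[OF that(3), of "\<lambda>p. fst (fst p)"])
  have "re_pred C"
    unfolding C_def[abs_def] by (intro re_pred_decidable comp_intro T ok)
  moreover have "exts triv {0} snd s (set L) cs1 cs2" if C: "C (s, L, cs1, cs2)" for s L cs1 cs2
    unfolding exts_def
  proof
    fix z assume z: "z \<in> sol triv {0} s cs1"
    let ?T = "T L cs1 cs2"
    have lk: "look ?T (map z ?T) p = z p" if "p \<in> set ?T" for p using that by (rule look_map)
    have "map z ?T \<in> set (List.n_lists (length ?T) [0..<s])"
      using z by (auto simp: set_n_lists sol_def cfg_def)
    moreover have "ok ?T cs1 (map z ?T)"
      unfolding ok_def
    proof
      fix r assume r: "r \<in> set cs1"
      then have eq: "map (look ?T (map z ?T)) (fst r) = map z (fst r)"
        by (intro map_cong refl lk) (auto simp: T_def)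
      show "map (look ?T (map z ?T)) (fst r) \<in> set (snd r)"
        unfolding eq using z r by (simp add: sol_triv)
    qed
    ultimately obtain w where w: "w \<in> set (List.n_lists (length ?T) [0..<s])" "ok ?T cs2 w"
      "\<forall>l\<in>set L. look ?T w (0, l) = look ?T (map z ?T) (0, l)"
      using C unfolding C_def fst_conv snd_conv by blast
    have "s > 0" using z by (metis (no_types, lifting) cfg_def gr_zeroI less_nat_zero_code mem_Collect_eq sol_def)
    then have "look ?T w \<in> cfg s" using w(1) by (auto simp: cfg_def set_n_lists intro!: look_less)
    then have "look ?T w \<in> sol triv {0} s cs2" using w(2) by (simp add: sol_triv ok_def)
    moreover have "agree triv snd (set L) (look ?T w) z"
      unfolding agree_def
    proof (intro allI impI)
      fix p assume "fst p \<in> carrier triv \<and> snd p \<in> set L"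
      then obtain l where p: "p = (0, l)" "l \<in> set L" by (cases p) (auto simp: triv_def)
      then have "p \<in> set ?T" by (simp add: T_def)
      from lk[OF this] show "look ?T w p = z p" using w(3) p by simp
    qed
    ultimately show "\<exists>x\<in>sol triv {0} s cs2. agree triv snd (set L) x z" by blast
  qed
  moreover have "C (s, L, cs1, cs2)" if ex: "exts triv {0} snd s (set L) cs1 cs2" and s: "s > 0" for s L cs1 cs2
    unfolding C_def fst_conv snd_conv
  proof (intro ballI impI)
    let ?T = "T L cs1 cs2"
    fix v assume v: "v \<in> set (List.n_lists (length ?T) [0..<s])" "ok ?T cs1 v"
    have "look ?T v \<in> cfg s" using v(1) s by (auto simp: cfg_def set_n_lists intro!: look_less)
    then have "look ?T v \<in> sol triv {0} s cs1" using v(2) by (simp add: sol_triv ok_def)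
    then obtain x where x: "x \<in> sol triv {0} s cs2" "agree triv snd (set L) x (look ?T v)"
      using ex by (auto simp: exts_def)
    have lk: "look ?T (map x ?T) p = x p" if "p \<in> set ?T" for p using that by (rule look_map)
    have "map x ?T \<in> set (List.n_lists (length ?T) [0..<s])"
      using x(1) by (auto simp: set_n_lists sol_def cfg_def)
    moreover have "ok ?T cs2 (map x ?T)"
      unfolding ok_def
    proof
      fix r assume r: "r \<in> set cs2"
      then have eq: "map (look ?T (map x ?T)) (fst r) = map x (fst r)"
        by (intro map_cong refl lk) (auto simp: T_def)
      show "map (look ?T (map x ?T)) (fst r) \<in> set (snd r)"
        unfolding eq using x(1) r by (simp add: sol_triv)
    qed
    moreover have "look ?T (map x ?T) (0, l) = look ?T v (0, l)" if "l \<in> set L" for l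
      using lk[of "(0, l)"] agreeD[OF x(2), of "(0, l)"] that by (simp add: T_def triv_def)
    ultimately show "\<exists>w\<in>set (List.n_lists (length ?T) [0..<s]). ok ?T cs2 w \<and>
      (\<forall>l\<in>set L. look ?T w (0, l) = look ?T v (0, l))" by blast
  qed
  moreover have "s > 0" if "group \<Sigma>" "carrier \<Sigma> = {..<s}" for s and \<Sigma> :: "nat monoid"
    using that group.is_monoid monoid.one_closed by fastforce
  ultimately show ?thesis unfolding ext_enum_def by blast
qed

lemma good_triv: "good triv"
proof -
  have "effgrp triv"
    unfolding effgrp_def by (simp add: group_triv) (simp add: triv_def decidable_eq computable_id computable_const)
  moreover have "homlift triv"
    unfolding homlift_def
  proof (intro allI impI)
    fix K and h :: "nat \<Rightarrow> nat"
    show "\<exists>h'. computable h' \<and> (\<forall>a\<in>carrier triv. h' a = h a)"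
      by (intro exI[of _ "\<lambda>_. h 0"]) (simp add: computable_const triv_def)
  qed
  moreover have "carrier triv = {0}" by (simp add: triv_def)
  ultimately show ?thesis unfolding good_def using markov_triv ext_enum_triv by simp
qed

subsection \<open>Polycyclic groups\<close>

text \<open>The axioms are pulled back along an injective multiplicative map, so associativity never
  has to be checked on the formula for the product in \<open>M\<close>.\<close>

lemma group_transport:
  assumes "group G" "subgroup S G" "bij_betw \<phi> (carrier M) S"
    and closed: "\<And>a b. a \<in> carrier M \<Longrightarrow> b \<in> carrier M \<Longrightarrow> a \<otimes>\<^bsub>M\<^esub> b \<in> carrier M"
    and hom: "\<And>a b. a \<in> carrier M \<Longrightarrow> b \<in> carrier M \<Longrightarrow> \<phi> (a \<otimes>\<^bsub>M\<^esub> b) = \<phi> a \<otimes>\<^bsub>G\<^esub> \<phi> b"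
    and one: "\<one>\<^bsub>M\<^esub> \<in> carrier M" "\<phi> \<one>\<^bsub>M\<^esub> = \<one>\<^bsub>G\<^esub>"
  shows "group M"
proof -
  interpret G: group G by fact
  have inj: "inj_on \<phi> (carrier M)" and img: "\<phi> ` carrier M = S"
    using assms(3) by (auto simp: bij_betw_def)
  have \<phi>: "\<phi> a \<in> carrier G" if "a \<in> carrier M" for a
    using that img G.subgroupE(1)[OF assms(2)] by auto
  show ?thesis
  proof (rule groupI)
    fix x y z assume "x \<in> carrier M" "y \<in> carrier M" "z \<in> carrier M"
    then show "x \<otimes>\<^bsub>M\<^esub> y \<otimes>\<^bsub>M\<^esub> z = x \<otimes>\<^bsub>M\<^esub> (y \<otimes>\<^bsub>M\<^esub> z)"
      by (intro inj_onD[OF inj]) (simp_all add: hom closed \<phi> G.m_assoc)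
  next
    fix x assume x: "x \<in> carrier M"
    then show "\<one>\<^bsub>M\<^esub> \<otimes>\<^bsub>M\<^esub> x = x"
      by (intro inj_onD[OF inj]) (simp_all add: hom closed \<phi> one)
    have "inv\<^bsub>G\<^esub> \<phi> x \<in> S" using x img subgroup.m_inv_closed[OF assms(2)] by auto
    then obtain y where "y \<in> carrier M" "\<phi> y = inv\<^bsub>G\<^esub> \<phi> x" using img by auto
    then show "\<exists>y\<in>carrier M. y \<otimes>\<^bsub>M\<^esub> x = \<one>\<^bsub>M\<^esub>"
      using x by (intro bexI[of _ y] inj_onD[OF inj]) (simp_all add: hom closed \<phi> one)
  qed (use closed one in auto)
qed

definition codes :: "('g, 'b) monoid_scheme \<Rightarrow> nat monoid \<Rightarrow> (nat \<Rightarrow> 'g) \<Rightarrow> 'g set \<Rightarrow> bool" where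
  "codes G K h S \<longleftrightarrow> bij_betw h (carrier K) S \<and>
    (\<forall>a\<in>carrier K. \<forall>b\<in>carrier K. h (a \<otimes>\<^bsub>K\<^esub> b) = h a \<otimes>\<^bsub>G\<^esub> h b)"

text \<open>Every element of S' is uniquely n \<tau>^k with n in S and k reduced modulo r. The
  product of a \<tau>^k and b \<tau>^l is a (\<tau>^k b \<tau>^-k) \<tau>^(k+l), and the last factor
  splits into a power of u = \<tau>^r, which lies in S, and \<tau>^((k+l) mod r).\<close>

lemma good_cyclic_extension:
  fixes G (structure)
  assumes G: "group G" and S: "subgroup S G" "subgroup S' G"
    and \<tau>: "\<tau> \<in> S'" and gen: "\<And>m. m \<in> S' \<Longrightarrow> \<exists>n\<in>S. \<exists>k::int. m = n \<otimes> \<tau> [^] k"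
    and sub: "S \<subseteq> S'" and normal: "\<And>n m. n \<in> S \<Longrightarrow> m \<in> S' \<Longrightarrow> m \<otimes> n \<otimes> inv m \<in> S"
    and N: "good N" "codes G N h S"
  obtains M \<phi> where "good M" "codes G M \<phi> S'"
proof -
  interpret group G by fact
  have Sc [simp]: "n \<in> carrier G" if "n \<in> S" for n using that subgroupE(1)[OF S(1)] by blast
  have \<tau>c [simp]: "\<tau> \<in> carrier G" using \<tau> subgroupE(1)[OF S(2)] by blast
  have pc [simp]: "\<tau> [^] (k::int) \<in> carrier G" for k by (rule int_pow_closed[OF \<tau>c])
  have pS': "\<tau> [^] (k::int) \<in> S'" for k
    using \<tau> S(2) by (metis subgroup_int_pow_closed)
  have effN: "effgrp N" and liftN: "homlift N" using N(1) by (auto simp: good_def)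
  interpret N: group N using effN by (simp add: effgrp_def)
  have bij: "bij_betw h (carrier N) S"
    and h_mult: "\<And>a b. a \<in> carrier N \<Longrightarrow> b \<in> carrier N \<Longrightarrow> h (a \<otimes>\<^bsub>N\<^esub> b) = h a \<otimes> h b"
    using N(2) by (auto simp: codes_def)
  have h_inj: "inj_on h (carrier N)" and h_img: "h ` carrier N = S" using bij by (auto simp: bij_betw_def)
  have hS: "h a \<in> S" if "a \<in> carrier N" for a using that h_img by auto
  have hc [simp]: "h a \<in> carrier G" if "a \<in> carrier N" for a using hS[OF that] by simp
  interpret h: group_hom N G h
    by unfold_locales (rule homI; simp add: h_mult)
  define hi where "hi = inv_into (carrier N) h"
  have hi: "hi n \<in> carrier N" "h (hi n) = n" if "n \<in> S" for n
    using that h_img by (auto simp: hi_def inv_into_into f_inv_into_f)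
  have hi_eq: "a = b" if "a \<in> carrier N" "b \<in> carrier N" "h a = h b" for a b
    using inj_onD[OF h_inj that(3,1,2)] .

  \<comment> \<open>The order of \<tau> modulo S, with 0 for infinite order; since k mod 0 = k, both
    cases share one formula.\<close>
  define r where "r = (if \<exists>k>0. \<tau> [^] (k::nat) \<in> S then LEAST k. k > 0 \<and> \<tau> [^] (k::nat) \<in> S else 0)"
  have pow_S: "\<tau> [^] (k::int) \<in> S \<longleftrightarrow> k mod int r = 0" for k
  proof (cases "\<exists>k>0. \<tau> [^] (k::nat) \<in> S")
    case True
    then have r: "r > 0" "\<tau> [^] r \<in> S" "\<And>j. 0 < j \<Longrightarrow> \<tau> [^] j \<in> S \<Longrightarrow> r \<le> j"
      using LeastI_ex[of "\<lambda>k. k > 0 \<and> \<tau> [^] (k::nat) \<in> S"] Least_le[of "\<lambda>k. k > 0 \<and> \<tau> [^] (k::nat) \<in> S"]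
      by (auto simp: r_def)
    have mult: "\<tau> [^] (int r * q) \<in> S" for q
      using r(2) subgroup_int_pow_closed[OF S(1), of "\<tau> [^] r" q] by (simp add: int_pow_pow int_pow_int[symmetric])
    have "\<tau> [^] k = \<tau> [^] (int r * (k div int r)) \<otimes> \<tau> [^] (k mod int r)"
      by (simp flip: int_pow_mult)
    then have "\<tau> [^] k \<in> S \<longleftrightarrow> \<tau> [^] (k mod int r) \<in> S"
      using mult[of "k div int r"] S(1) pc
      by (metis Sc inv_solve_left subgroup.m_closed subgroup.m_inv_closed)
    also have "\<dots> \<longleftrightarrow> k mod int r = 0"
    proof
      assume S: "\<tau> [^] (k mod int r) \<in> S"
      have b: "0 \<le> k mod int r" "k mod int r < int r" using r(1) by simp_all
      then have "\<tau> [^] (k mod int r) = \<tau> [^] nat (k mod int r)" by (metis int_nat_eq int_pow_int)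
      with S have nS: "\<tau> [^] nat (k mod int r) \<in> S" by simp
      show "k mod int r = 0"
      proof (rule ccontr)
        assume "k mod int r \<noteq> 0"
        then have "0 < nat (k mod int r)" using b by linarith
        from r(3)[OF this nS] show False using b by linarith
      qed
    qed (simp add: subgroup.one_closed[OF S(1)])
    finally show ?thesis .
  next
    case False
    then have r: "r = 0" unfolding r_def by (rule if_not_P)
    have "\<tau> [^] k \<notin> S" if "k \<noteq> 0"
    proof
      assume "\<tau> [^] k \<in> S"
      moreover from this have "inv (\<tau> [^] k) \<in> S" by (rule subgroup.m_inv_closed[OF S(1)])
      then have "\<tau> [^] (- k) \<in> S" by (simp add: int_pow_neg)
      ultimately have "\<tau> [^] nat \<bar>k\<bar> \<in> S"
        by (cases "k \<ge> 0") (auto simp flip: int_pow_int)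
      then show False using False that by (metis zero_less_abs_iff zero_less_nat_eq)
    qed
    then show ?thesis using subgroup.one_closed[OF S(1)] by (auto simp: r)
  qed
  \<comment> \<open>For r = 0 this is the code of the identity, and a quotient by 0 is 0, so the
    power of \<open>u\<close> in the product formula disappears.\<close>
  define u where "u = hi (\<tau> [^] int r)"
  have "\<tau> [^] int r \<in> S" by (simp add: pow_S)
  then have u: "u \<in> carrier N" "h u = \<tau> [^] int r" using hi by (auto simp: u_def)
  obtain P where P: "computable P" "\<And>k :: int. P k = u [^]\<^bsub>N\<^esub> k"
    using computable_int_pow[OF effN u(1)] by blast
  have hP: "P k \<in> carrier N" "h (P k) = \<tau> [^] (int r * k)" for k
    using u by (simp_all add: P(2) h.hom_int_pow int_pow_pow)
  \<comment> \<open>Conjugation by an element of S', read on codes, is an endomorphism of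
    \<open>N\<close>; \<open>hi\<close> is merely chosen, and computability comes from
    \<open>homlift\<close>.\<close>
  have conj: "\<exists>c. computable c \<and> (\<forall>a\<in>carrier N. c a \<in> carrier N \<and> h (c a) = m \<otimes> h a \<otimes> inv m)" if m: "m \<in> S'" for m
  proof -
    have mc: "m \<in> carrier G" using m subgroupE(1)[OF S(2)] by blast
    have *: "hi (m \<otimes> h a \<otimes> inv m) \<in> carrier N" "h (hi (m \<otimes> h a \<otimes> inv m)) = m \<otimes> h a \<otimes> inv m" if "a \<in> carrier N" for a
      using hi[OF normal[OF hS[OF that] m]] by auto
    have "(\<lambda>a. hi (m \<otimes> h a \<otimes> inv m)) \<in> hom N N"
    proof (rule homI)
      fix a b assume ab: "a \<in> carrier N" "b \<in> carrier N"
      show "hi (m \<otimes> h (a \<otimes>\<^bsub>N\<^esub> b) \<otimes> inv m) = hi (m \<otimes> h a \<otimes> inv m) \<otimes>\<^bsub>N\<^esub> hi (m \<otimes> h b \<otimes> inv m)"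
      proof (rule hi_eq)
        have cancel: "inv m \<otimes> (m \<otimes> x) = x" if "x \<in> carrier G" for x using that mc by (simp flip: m_assoc)
        have e1: "h (hi (m \<otimes> h (a \<otimes>\<^bsub>N\<^esub> b) \<otimes> inv m)) = m \<otimes> h (a \<otimes>\<^bsub>N\<^esub> b) \<otimes> inv m"
          by (rule *(2)) (use ab in simp)
        have e2: "h (hi (m \<otimes> h a \<otimes> inv m) \<otimes>\<^bsub>N\<^esub> hi (m \<otimes> h b \<otimes> inv m)) =
            (m \<otimes> h a \<otimes> inv m) \<otimes> (m \<otimes> h b \<otimes> inv m)"
          by (simp only: h_mult[OF *(1)[OF ab(1)] *(1)[OF ab(2)]] *(2)[OF ab(1)] *(2)[OF ab(2)])
        show "h (hi (m \<otimes> h (a \<otimes>\<^bsub>N\<^esub> b) \<otimes> inv m)) = h (hi (m \<otimes> h a \<otimes> inv m) \<otimes>\<^bsub>N\<^esub> hi (m \<otimes> h b \<otimes> inv m))"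
          unfolding e1 e2 using ab mc by (simp add: h_mult m_assoc cancel)
      qed (fact *(1)[OF N.m_closed[OF ab]], fact N.m_closed[OF *(1)[OF ab(1)] *(1)[OF ab(2)]])
    qed (use * in auto)
    then obtain c where "computable c" "\<forall>a\<in>carrier N. c a = hi (m \<otimes> h a \<otimes> inv m)"
      using liftN effN unfolding homlift_def by blast
    then show ?thesis using * by auto
  qed
  obtain cp where cp: "computable cp" "\<And>a. a \<in> carrier N \<Longrightarrow> cp a \<in> carrier N \<and> h (cp a) = \<tau> \<otimes> h a \<otimes> inv \<tau>"
    using conj[OF \<tau>] by blast
  obtain cm where cm: "computable cm" "\<And>a. a \<in> carrier N \<Longrightarrow> cm a \<in> carrier N \<and> h (cm a) = inv \<tau> \<otimes> h a \<otimes> \<tau>"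
    using conj[OF subgroup.m_inv_closed[OF S(2) \<tau>]] by auto
  \<comment> \<open>The code of \<tau>^k b \<tau>^-k, obtained by iterating conjugation by \<tau> or
    by its inverse.\<close>
  define \<beta> where "\<beta> k b = (if 0 \<le> k then rec_nat b (\<lambda>_. cp) (nat k) else rec_nat b (\<lambda>_. cm) (nat (- k)))" for k :: int and b
  have \<beta>: "\<beta> k b \<in> carrier N \<and> h (\<beta> k b) \<otimes> \<tau> [^] k = \<tau> [^] k \<otimes> h b" if b: "b \<in> carrier N" for k b
  proof -
    have p: "rec_nat b (\<lambda>_. cp) n \<in> carrier N \<and> h (rec_nat b (\<lambda>_. cp) n) \<otimes> \<tau> [^] n = \<tau> [^] n \<otimes> h b" for n :: nat
    proof (induction n)
      case (Suc n)
      let ?x = "rec_nat b (\<lambda>_. cp) n"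
      have x: "?x \<in> carrier N" "h ?x \<otimes> \<tau> [^] n = \<tau> [^] n \<otimes> h b" using Suc by auto
      have "h (cp ?x) \<otimes> \<tau> [^] Suc n = \<tau> \<otimes> h ?x \<otimes> (inv \<tau> \<otimes> \<tau> [^] Suc n)"
        using cp(2)[OF x(1)] x(1) by (simp add: m_assoc)
      also have "inv \<tau> \<otimes> \<tau> [^] Suc n = \<tau> [^] n"
        by (simp only: nat_pow_Suc2[OF \<tau>c]) (simp flip: m_assoc)
      also have "\<tau> \<otimes> h ?x \<otimes> \<tau> [^] n = \<tau> \<otimes> \<tau> [^] n \<otimes> h b" using x b by (simp add: m_assoc)
      also have "\<dots> = \<tau> [^] Suc n \<otimes> h b" by (simp only: nat_pow_Suc2[OF \<tau>c])
      finally show ?case using cp(2)[OF x(1)] by simp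
    qed (use b in simp)
    have m: "rec_nat b (\<lambda>_. cm) n \<in> carrier N \<and> \<tau> [^] n \<otimes> h (rec_nat b (\<lambda>_. cm) n) = h b \<otimes> \<tau> [^] n" for n :: nat
    proof (induction n)
      case (Suc n)
      let ?x = "rec_nat b (\<lambda>_. cm) n"
      have x: "?x \<in> carrier N" "\<tau> [^] n \<otimes> h ?x = h b \<otimes> \<tau> [^] n" using Suc by auto
      have "\<tau> [^] Suc n \<otimes> h (cm ?x) = \<tau> [^] n \<otimes> (\<tau> \<otimes> (inv \<tau> \<otimes> (h ?x \<otimes> \<tau>)))"
        using cm(2)[OF x(1)] x(1) by (simp add: m_assoc)
      also have "\<tau> \<otimes> (inv \<tau> \<otimes> (h ?x \<otimes> \<tau>)) = h ?x \<otimes> \<tau>" using x(1) by (simp flip: m_assoc)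
      also have "\<tau> [^] n \<otimes> (h ?x \<otimes> \<tau>) = h b \<otimes> \<tau> [^] Suc n" using x b by (simp flip: m_assoc)
      finally show ?case using cm(2)[OF x(1)] by simp
    qed (use b in simp)
    show ?thesis
    proof (cases "0 \<le> k")
      case True
      then obtain n where "k = int n" by (metis nonneg_int_cases)
      then show ?thesis using p[of n] by (simp add: \<beta>_def int_pow_int)
    next
      case False
      then obtain n where k: "k = - int n" "n > 0" by (metis neg_int_cases not_le)
      let ?x = "rec_nat b (\<lambda>_. cm) n"
      have x: "?x \<in> carrier N" "\<tau> [^] n \<otimes> h ?x = h b \<otimes> \<tau> [^] n" using m[of n] by auto
      have "h ?x \<otimes> inv (\<tau> [^] n) = inv (\<tau> [^] n) \<otimes> (\<tau> [^] n \<otimes> h ?x) \<otimes> inv (\<tau> [^] n)"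
        using x(1) by (simp flip: m_assoc)
      also have "\<dots> = inv (\<tau> [^] n) \<otimes> h b" unfolding x(2) using b by (simp add: m_assoc)
      finally show ?thesis using k x(1) by (simp add: \<beta>_def int_pow_neg_int)
    qed
  qed

  let ?base = "\<lambda>m. fst (dec m :: nat \<times> int)" and ?lev = "\<lambda>m. snd (dec m :: nat \<times> int)"
  define M :: "nat monoid" where "M = \<lparr>carrier = {m. ?base m \<in> carrier N \<and> ?lev m mod int r = ?lev m},
    mult = \<lambda>m m'. enc (?base m \<otimes>\<^bsub>N\<^esub> \<beta> (?lev m) (?base m') \<otimes>\<^bsub>N\<^esub> P ((?lev m + ?lev m') div int r),
      (?lev m + ?lev m') mod int r), one = enc (\<one>\<^bsub>N\<^esub>, 0 :: int)\<rparr>"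
  have carM: "carrier M = {m. ?base m \<in> carrier N \<and> ?lev m mod int r = ?lev m}" by (simp add: M_def)
  have multM: "m \<otimes>\<^bsub>M\<^esub> m' = enc (?base m \<otimes>\<^bsub>N\<^esub> \<beta> (?lev m) (?base m') \<otimes>\<^bsub>N\<^esub> P ((?lev m + ?lev m') div int r),
      (?lev m + ?lev m') mod int r)" for m m' by (simp add: M_def)
  define \<phi> where "\<phi> m = h (?base m) \<otimes> \<tau> [^] ?lev m" for m
  have closedM: "m \<otimes>\<^bsub>M\<^esub> m' \<in> carrier M" if "m \<in> carrier M" "m' \<in> carrier M" for m m'
    using that \<beta> hP(1) by (simp add: multM) (simp add: carM)
  have homM: "\<phi> (m \<otimes>\<^bsub>M\<^esub> m') = \<phi> m \<otimes> \<phi> m'" if "m \<in> carrier M" "m' \<in> carrier M" for m m'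
  proof -
    define a k b l where "a = ?base m" "k = ?lev m" "b = ?base m'" "l = ?lev m'"
    note defs = this
    have ab: "a \<in> carrier N" "b \<in> carrier N" using that by (auto simp: carM defs)
    have "\<phi> (m \<otimes>\<^bsub>M\<^esub> m') = h a \<otimes> h (\<beta> k b) \<otimes> (\<tau> [^] (int r * ((k + l) div int r)) \<otimes> \<tau> [^] ((k + l) mod int r))"
      using ab \<beta>[OF ab(2), of k] hP by (simp add: \<phi>_def multM h_mult m_assoc flip: defs)
    also have "\<tau> [^] (int r * ((k + l) div int r)) \<otimes> \<tau> [^] ((k + l) mod int r) = \<tau> [^] k \<otimes> \<tau> [^] l"
      by (simp flip: int_pow_mult)
    also have "h a \<otimes> h (\<beta> k b) \<otimes> (\<tau> [^] k \<otimes> \<tau> [^] l) = h a \<otimes> (h (\<beta> k b) \<otimes> \<tau> [^] k) \<otimes> \<tau> [^] l"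
      using ab \<beta>[OF ab(2), of k, THEN conjunct1] by (simp add: m_assoc)
    also have "\<dots> = h a \<otimes> (\<tau> [^] k \<otimes> h b) \<otimes> \<tau> [^] l"
      using \<beta>[OF ab(2), of k] by simp
    also have "\<dots> = \<phi> m \<otimes> \<phi> m'"
      using ab by (simp add: \<phi>_def m_assoc flip: defs)
    finally show ?thesis .
  qed
  have bijM: "bij_betw \<phi> (carrier M) S'"
    unfolding bij_betw_def
  proof (intro conjI inj_onI equalityI subsetI)
    fix m m' assume m: "m \<in> carrier M" "m' \<in> carrier M" and eq: "\<phi> m = \<phi> m'"
    define a k b l where "a = ?base m" "k = ?lev m" "b = ?base m'" "l = ?lev m'"
    note defs = this
    have ab: "a \<in> carrier N" "b \<in> carrier N" "k mod int r = k" "l mod int r = l" using m by (auto simp: carM defs)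
    have "h a \<otimes> \<tau> [^] k = h b \<otimes> \<tau> [^] l" using eq by (simp add: \<phi>_def defs)
    then have "inv (h b) \<otimes> h a = \<tau> [^] l \<otimes> inv (\<tau> [^] k)"
      using ab by (metis hc inv_closed inv_solve_left' inv_solve_right m_assoc m_closed pc)
    then have "inv (h b) \<otimes> h a = \<tau> [^] (l - k)" by (simp add: int_pow_diff)
    moreover have "inv (h b) \<otimes> h a \<in> S"
      using ab hS by (intro subgroup.m_closed[OF S(1)] subgroup.m_inv_closed[OF S(1)])
    ultimately have "(l - k) mod int r = 0" by (simp add: pow_S)
    then have "l = k" using ab by (metis mod_eq_dvd_iff mod_0_imp_dvd)
    moreover from this have "h a = h b" using \<open>h a \<otimes> \<tau> [^] k = h b \<otimes> \<tau> [^] l\<close> ab by simp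
    ultimately have "dec m = (dec m' :: nat \<times> int)"
      using hi_eq[OF ab(1,2)] by (simp add: defs prod_eq_iff)
    then show "m = m'" by (metis enc_dec)
  next
    fix g assume "g \<in> \<phi> ` carrier M"
    then obtain m where "m \<in> carrier M" "g = \<phi> m" by blast
    then show "g \<in> S'"
      using hS sub pS' by (auto simp: \<phi>_def carM intro!: subgroup.m_closed[OF S(2)])
  next
    fix g assume "g \<in> S'"
    then obtain n k where n: "n \<in> S" "g = n \<otimes> \<tau> [^] (k::int)" using gen by blast
    let ?n = "n \<otimes> \<tau> [^] (int r * (k div int r))"
    have nS: "?n \<in> S" by (intro subgroup.m_closed[OF S(1)] n) (simp add: pow_S)
    have "\<tau> [^] k = \<tau> [^] (int r * (k div int r)) \<otimes> \<tau> [^] (k mod int r)"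
      by (simp flip: int_pow_mult)
    then have "g = ?n \<otimes> \<tau> [^] (k mod int r)" using n by (simp add: m_assoc)
    then have "g = \<phi> (enc (hi ?n, k mod int r))" using hi[OF nS] by (simp add: \<phi>_def)
    moreover have "enc (hi ?n, k mod int r) \<in> carrier M" using hi[OF nS] by (simp add: carM)
    ultimately show "g \<in> \<phi> ` carrier M" by blast
  qed
  have oneM: "\<one>\<^bsub>M\<^esub> \<in> carrier M" "\<phi> \<one>\<^bsub>M\<^esub> = \<one>"
    by (simp_all add: M_def \<phi>_def)
  have grpM: "group M" by (rule group_transport[OF G S(2) bijM closedM homM oneM])
  interpret M: group M by (rule grpM)
  have decP: "computable (\<lambda>m. dec m :: nat \<times> int)" by (simp add: computable_def total_rec_proj)
  have base: "computable (\<lambda>x. ?base (f x))" and lev: "computable (\<lambda>x. ?lev (f x))" if "computable f" for f :: "'z::encodable \<Rightarrow> nat"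
    by (rule computable_fst[OF computable_compose[OF decP that]], rule computable_snd[OF computable_compose[OF decP that]])
  have \<beta>c: "computable (\<lambda>x. \<beta> (f x) (g x))" if "computable f" "computable g" for f :: "'z::encodable \<Rightarrow> int" and g
    unfolding \<beta>_def by (intro comp_intro that computable_compose[OF cp(1)] computable_compose[OF cm(1)])
  have effM: "effgrp M"
    unfolding effgrp_def multM unfolding carM mem_Collect_eq
    by (intro conjI grpM comp_intro decidable_carrier[OF effN] computable_group_mult[OF effN] \<beta>c base lev
        computable_compose[OF P(1)])
  have \<phi>c: "\<phi> m \<in> carrier G" if "m \<in> carrier M" for m
    using that by (simp add: \<phi>_def carM)
  interpret \<phi>: group_hom M G \<phi>
    by unfold_locales (rule homI; simp add: \<phi>c homM)
  have \<phi>_eq: "m = m'" if "m \<in> carrier M" "m' \<in> carrier M" "\<phi> m = \<phi> m'" for m m'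
    using bijM that by (auto simp: bij_betw_def inj_on_def)
  obtain t where t: "t \<in> carrier M" "\<phi> t = \<tau>" using bijM \<tau> by (auto simp: bij_betw_def)
  interpret cyclic_step N M r t
  proof
    fix a and k :: int assume a: "a \<in> carrier N" and k: "k mod int r = k"
    have e: "enc (a, 0 :: int) \<in> carrier M" using a by (simp add: carM)
    show "enc (a, k) = enc (a, 0 :: int) \<otimes>\<^bsub>M\<^esub> t [^]\<^bsub>M\<^esub> k"
    proof (rule \<phi>_eq)
      show "enc (a, k) \<in> carrier M" using a k by (simp add: carM)
      show "\<phi> (enc (a, k)) = \<phi> (enc (a, 0 :: int) \<otimes>\<^bsub>M\<^esub> t [^]\<^bsub>M\<^esub> k)"
        using a e t by (simp add: homM \<phi>.hom_int_pow) (simp add: \<phi>_def)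
    qed (use e t in simp)
  next
    fix a b assume ab: "a \<in> carrier N" "b \<in> carrier N"
    have e: "enc (a, 0 :: int) \<in> carrier M" "enc (b, 0 :: int) \<in> carrier M" "enc (a \<otimes>\<^bsub>N\<^esub> b, 0 :: int) \<in> carrier M"
      using ab by (simp_all add: carM)
    show "enc (a \<otimes>\<^bsub>N\<^esub> b, 0 :: int) = enc (a, 0 :: int) \<otimes>\<^bsub>M\<^esub> enc (b, 0 :: int)"
      by (rule \<phi>_eq[OF e(3) M.m_closed[OF e(1,2)]]) (use ab e in \<open>simp add: homM, simp add: \<phi>_def h_mult\<close>)
  next
    fix m m' assume "r = 0"
    then show "?lev (m \<otimes>\<^bsub>M\<^esub> m') = ?lev m + ?lev m'" by (simp add: multM)
  qed (use effN effM carM t in auto)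
  have "codes G M \<phi> S'" using bijM homM by (simp add: codes_def)
  then show thesis using that good_M[OF N(1)] by blast
qed

text \<open>Induction along the series; a representative of a generator of the cyclic factor serves
  as \<tau>.\<close>

theorem polycyclic_good:
  fixes G (structure)
  assumes "polycyclic G"
  obtains K h where "good K" "codes G K h (carrier G)"
proof -
  interpret group G using assms by (simp add: polycyclic_def)
  obtain n :: nat and H where H: "H 0 = {\<one>}" "H n = carrier G" "\<And>i. i \<le> n \<Longrightarrow> subgroup (H i) G"
    "\<And>i. i < n \<Longrightarrow> H i \<lhd> G\<lparr>carrier := H (Suc i)\<rparr>"
    "\<And>i. i < n \<Longrightarrow> cyclic_group (G\<lparr>carrier := H (Suc i)\<rparr> Mod H i)"
    using assms unfolding polycyclic_def by blast
  have "\<exists>K h. good K \<and> codes G K h (H i)" if "i \<le> n" for i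
    using that
  proof (induction i)
    case 0
    have "codes G triv (\<lambda>_. \<one>) (H 0)" by (simp add: codes_def triv_def bij_betw_def H(1))
    then show ?case using good_triv by blast
  next
    case (Suc i)
    then obtain N h where N: "good N" "codes G N h (H i)" by auto
    let ?S = "H (Suc i)"
    let ?GS = "G\<lparr>carrier := ?S\<rparr>"
    have i: "i < n" and S: "subgroup (H i) G" "subgroup ?S G" using Suc.prems H(3) by auto
    interpret GS: group ?GS using S(2) subgroup.subgroup_is_group is_group by blast
    interpret nrm: normal "H i" ?GS using H(4)[OF i] .
    interpret Q: group "?GS Mod H i" by (rule nrm.factorgroup_is_group)
    interpret q: group_hom ?GS "?GS Mod H i" "\<lambda>a. H i #>\<^bsub>?GS\<^esub> a"
      by unfold_locales (rule nrm.r_coset_hom_Mod)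
    obtain x where x: "x \<in> carrier (?GS Mod H i)" "carrier (?GS Mod H i) = range (\<lambda>k::int. x [^]\<^bsub>?GS Mod H i\<^esub> k)"
      using H(5)[OF i] Q.cyclic_group by auto
    obtain \<tau> where \<tau>: "\<tau> \<in> ?S" "x = H i #>\<^bsub>?GS\<^esub> \<tau>"
      using x(1) by (auto simp: FactGroup_def RCOSETS_def)
    have sub: "H i \<subseteq> ?S" using nrm.subset by simp
    have gen: "\<exists>a\<in>H i. \<exists>k::int. m = a \<otimes> \<tau> [^] k" if m: "m \<in> ?S" for m
    proof -
      have "H i #>\<^bsub>?GS\<^esub> m \<in> carrier (?GS Mod H i)" using m by (intro q.hom_closed) simp
      then obtain k :: int where "H i #>\<^bsub>?GS\<^esub> m = x [^]\<^bsub>?GS Mod H i\<^esub> k" using x(2) by auto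
      also have "\<dots> = H i #>\<^bsub>?GS\<^esub> (\<tau> [^]\<^bsub>?GS\<^esub> k)" using q.hom_int_pow[of \<tau> k] \<tau> by simp
      also have "\<tau> [^]\<^bsub>?GS\<^esub> k = \<tau> [^] k" using int_pow_consistent[OF S(2) \<tau>(1)] by simp
      finally have "m \<in> H i #>\<^bsub>?GS\<^esub> (\<tau> [^] k)"
        using GS.rcos_self[of m "H i"] m nrm.is_subgroup by simp
      then show ?thesis by (auto simp: r_coset_def)
    qed
    have nrml: "m \<otimes> a \<otimes> inv m \<in> H i" if "a \<in> H i" "m \<in> ?S" for a m
      using nrm.inv_op_closed2[of m a] that m_inv_consistent[OF S(2)] by simp
    obtain M \<phi> where "good M" "codes G M \<phi> ?S"
      by (rule good_cyclic_extension[OF is_group S \<tau>(1) gen sub nrml N])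
    then show ?case by blast
  qed
  from this[of n] show thesis using that H(2) by auto
qed

section \<open>Words and codes\<close>

type_synonym nword = "(nat \<times> nat) list"

text \<open>\<open>bool\<close> has no bijective code, so the bit of a letter becomes 0 or 1;
  \<open>enc\<close> then gives exactly the prescribed code of the word.\<close>

definition nword :: "word \<Rightarrow> nword" where
  "nword w = map (\<lambda>l. (fst l, of_bool (snd l))) w"

lemma list_code_enc:
  assumes "\<And>x. c x = enc (f x)" shows "list_code c xs = enc (map f xs)"
proof -
  have "c = (\<lambda>x. enc (f x))" using assms by auto
  then show ?thesis by (simp add: list_code_def enc_list_def o_def)
qed

lemma word_code_nword: "word_code w = enc (nword w)"
  unfolding word_code_def nword_def by (rule list_code_enc) (simp add: pair_code_def enc_prod_def)

definition npattern :: "pattern_desc \<Rightarrow> (nword \<times> nat) list" where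
  "npattern d = map (\<lambda>e. (nword (fst e), snd e)) d"

lemma patterns_code_nword: "patterns_code ds = enc (map npattern ds)"
  unfolding patterns_code_def
proof (rule list_code_enc)
  show "list_code (pair_code word_code id) d = enc (npattern d)" for d
    unfolding npattern_def by (rule list_code_enc) (simp add: pair_code_def enc_prod_def word_code_nword)
qed

lemma list_code_id: "list_code id xs = enc xs"
  using list_code_enc[of id id xs] by simp

lemma rule_code_nword: "rule_code r = enc (map nword (fst r), snd r)"
proof -
  have "list_code word_code (fst r) = enc (map nword (fst r))"
    by (rule list_code_enc) (rule word_code_nword)
  moreover have "list_code (pair_code (list_code id) id) (snd r) = enc (map (\<lambda>e. e) (snd r))"
    by (rule list_code_enc) (simp add: pair_code_def enc_prod_def list_code_id)
  ultimately show ?thesis by (simp add: rule_code_def pair_code_def enc_prod_def)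
qed

lemma table_code_enc: "table_code T = enc T"
  using list_code_enc[of "list_code id" "\<lambda>x. x" T] by (simp add: table_code_def list_code_id)

text \<open>Finitely many values can be built into a program, whatever \<open>f\<close> is. This is
  how chosen, non-effective data such as the codes of the generators enter an algorithm.\<close>

lemma computable_table: "computable (\<lambda>i. if i < n then f i else c)" for n :: nat
proof (induction n)
  case (Suc n)
  have "computable (\<lambda>i. if i = n then f n else if i < n then f i else c)"
    by (intro computable_If decidable_eq comp_intro Suc)
  moreover have "(\<lambda>i. if i = n then f n else if i < n then f i else c) = (\<lambda>i. if i < Suc n then f i else c)"
    by (auto simp: less_Suc_eq)
  ultimately show ?case by simp
qed (simp add: computable_const)

lemma computable_dec: "computable f \<Longrightarrow> computable (\<lambda>x. dec (f x) :: 'b::encodable)"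
proof -
  have "computable (dec :: nat \<Rightarrow> 'b)" by (simp add: computable_def total_rec_proj)
  then show "computable f \<Longrightarrow> computable (\<lambda>x. dec (f x) :: 'b)" by (rule computable_compose)
qed

locale coded_group = group G for G :: "('g, 'b) monoid_scheme" (structure) +
  fixes gs :: "'g list" and K :: "nat monoid" and h :: "nat \<Rightarrow> 'g"
  assumes gs: "set gs \<subseteq> carrier G" "generate G (set gs) = carrier G"
    and goodK: "good K" and codesK: "codes G K h (carrier G)"
begin

lemma effK: "effgrp K" using goodK by (simp add: good_def)

sublocale K: group K using effK by (simp add: effgrp_def)

lemma h_bij: "bij_betw h (carrier K) (carrier G)"
  and h_mult [simp]: "a \<in> carrier K \<Longrightarrow> b \<in> carrier K \<Longrightarrow> h (a \<otimes>\<^bsub>K\<^esub> b) = h a \<otimes> h b"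
  using codesK by (auto simp: codes_def)

lemma h_closed [simp]: "a \<in> carrier K \<Longrightarrow> h a \<in> carrier G"
  using h_bij by (auto simp: bij_betw_def)

sublocale h: group_hom K G h
  by unfold_locales (rule homI; simp)

definition hi :: "'g \<Rightarrow> nat" where "hi = inv_into (carrier K) h"

lemma hi_closed [simp]: "g \<in> carrier G \<Longrightarrow> hi g \<in> carrier K"
  and h_hi [simp]: "g \<in> carrier G \<Longrightarrow> h (hi g) = g"
  and hi_h [simp]: "a \<in> carrier K \<Longrightarrow> hi (h a) = a"
  using h_bij by (auto simp: hi_def bij_betw_def inv_into_into f_inv_into_f)

text \<open>The identity as default gives every list of letters a value in \<open>K\<close>, so
  evaluation involves no check of its input.\<close>

definition gen_code :: "bool \<Rightarrow> nat \<Rightarrow> nat" where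
  "gen_code b i = (if i < length gs then hi (if b then gs ! i else inv (gs ! i)) else \<one>\<^bsub>K\<^esub>)"

definition nletter :: "nat \<times> nat \<Rightarrow> nat" where
  "nletter l = (if snd l = 1 then gen_code True (fst l) else gen_code False (fst l))"

definition nval :: "nword \<Rightarrow> nat" where
  "nval w = foldr (\<lambda>l a. nletter l \<otimes>\<^bsub>K\<^esub> a) w \<one>\<^bsub>K\<^esub>"

lemma computable_nval [comp_intro]: "computable f \<Longrightarrow> computable (\<lambda>x. nval (f x))"
proof -
  have gc: "computable (gen_code b)" for b
    unfolding gen_code_def[abs_def] by (rule computable_table)
  have nl: "computable (\<lambda>x. nletter (f x))" if "computable f" for f :: "'z::encodable \<Rightarrow> _"
    unfolding nletter_def
    by (intro comp_intro that computable_compose[OF gc])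
  then show "computable f \<Longrightarrow> computable (\<lambda>x. nval (f x))"
    unfolding nval_def by (intro comp_intro computable_group_mult[OF effK] nl)
qed

lemma gs_closed: "i < length gs \<Longrightarrow> gs ! i \<in> carrier G"
  using gs(1) nth_mem by blast

lemma nletter_closed [simp]: "nletter l \<in> carrier K"
  by (simp add: nletter_def gen_code_def gs_closed)

lemma nval_closed [simp]: "nval w \<in> carrier K"
  unfolding nval_def by (induction w) simp_all

lemma h_nval: "is_word gs w \<Longrightarrow> h (nval (nword w)) = word_value G gs w"
proof (induction w)
  case Nil
  then show ?case by (simp add: nval_def nword_def word_value_def)
next
  case (Cons l w)
  then have l: "fst l < length gs" and IH: "h (nval (nword w)) = word_value G gs w" by (auto simp: is_word_def)
  have "nval (nword (l # w)) = nletter (fst l, of_bool (snd l)) \<otimes>\<^bsub>K\<^esub> nval (nword w)"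
    by (simp add: nval_def nword_def)
  moreover have "h (nletter (fst l, of_bool (snd l))) = letter_value G gs l"
    using l gs_closed[OF l] by (simp add: nletter_def gen_code_def letter_value_def)
  ultimately show ?case using IH by (simp add: word_value_def)
qed

lemma word_value_closed [simp]: "is_word gs w \<Longrightarrow> word_value G gs w \<in> carrier G"
  using h_nval[of w] by (metis h_closed nval_closed)

lemma is_word_append [simp]: "is_word gs (w @ v) \<longleftrightarrow> is_word gs w \<and> is_word gs v"
  by (auto simp: is_word_def)

lemma word_value_append:
  "is_word gs w \<Longrightarrow> is_word gs v \<Longrightarrow> word_value G gs (w @ v) = word_value G gs w \<otimes> word_value G gs v"
proof (induction w)
  case (Cons l w)
  then have l: "fst l < length gs" and w: "is_word gs w" "is_word gs v" "is_word gs (w @ v)" by (auto simp: is_word_def)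
  have "letter_value G gs l \<in> carrier G" using gs_closed[OF l] by (simp add: letter_value_def)
  then show ?case
    using Cons.IH[OF w(1,2)] word_value_closed[OF w(1)] word_value_closed[OF w(2)]
    by (simp add: word_value_def m_assoc)
next
  case Nil
  then show ?case using word_value_closed[of v] by (simp add: word_value_def)
qed

lemma ex_word: "g \<in> carrier G \<Longrightarrow> \<exists>w. is_word gs w \<and> word_value G gs w = g"
  unfolding gs(2)[symmetric]
proof (induction rule: generate.induct)
  case one
  show ?case by (intro exI[of _ "[]"]) (simp add: is_word_def word_value_def)
next
  case (incl g)
  then obtain i where "i < length gs" "g = gs ! i" by (metis in_set_conv_nth)
  then show ?case
    using gs_closed[of i] by (intro exI[of _ "[(i, True)]"]) (simp add: is_word_def word_value_def letter_value_def)
next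
  case (inv g)
  then obtain i where "i < length gs" "g = gs ! i" by (metis in_set_conv_nth)
  then show ?case
    using gs_closed[of i] by (intro exI[of _ "[(i, False)]"]) (simp add: is_word_def word_value_def letter_value_def)
next
  case (eng g g')
  then obtain w v where "is_word gs w" "word_value G gs w = g" "is_word gs v" "word_value G gs v = g'" by blast
  then show ?case
    by (intro exI[of _ "w @ v"]) (simp add: word_value_append)
qed

definition valid_nword :: "nword \<Rightarrow> bool" where
  "valid_nword w \<longleftrightarrow> (\<forall>l\<in>set w. fst l < length gs \<and> snd l < 2)"

lemma valid_nword_iff: "valid_nword w \<longleftrightarrow> (\<exists>v. is_word gs v \<and> w = nword v)"
proof
  assume v: "valid_nword w"
  let ?v = "map (\<lambda>l. (fst l, snd l = 1)) w"
  have "nword ?v = map (\<lambda>l. l) w"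
    unfolding nword_def map_map o_def
    by (intro map_cong refl) (use v in \<open>auto simp: valid_nword_def less_2_cases_iff\<close>)
  then have "w = nword ?v" by simp
  moreover have "is_word gs ?v" using v by (auto simp: valid_nword_def is_word_def)
  ultimately show "\<exists>v. is_word gs v \<and> w = nword v" by blast
qed (auto simp: valid_nword_def is_word_def nword_def)

text \<open>The generators reach every element, so a word can be searched for; the disjunct
  \<open>a \<notin> carrier K\<close> lets the search end on numbers that code no element.\<close>

definition find_word :: "nat \<Rightarrow> nword" where
  "find_word a = dec (LEAST k. a \<notin> carrier K \<or> (valid_nword (dec k) \<and> nval (dec k) = a))"

lemma find_word_ex: "\<exists>k. a \<notin> carrier K \<or> (valid_nword (dec k) \<and> nval (dec k) = a)"
proof (cases "a \<in> carrier K")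
  case True
  obtain w where w: "is_word gs w" "word_value G gs w = h a" using ex_word[OF h_closed[OF True]] by blast
  then have "h (nval (nword w)) = h a" by (simp add: h_nval)
  then have "nval (nword w) = a" using True by (metis hi_h nval_closed)
  then show ?thesis using w(1) valid_nword_iff by (intro exI[of _ "enc (nword w)"]) auto
qed simp

lemma computable_find_word [comp_intro]: "computable f \<Longrightarrow> computable (\<lambda>x. find_word (f x))"
proof (rule computable_compose[of find_word])
  have "computable (\<lambda>a. LEAST k. a \<notin> carrier K \<or> (valid_nword (dec k) \<and> nval (dec k) = a))"
    unfolding valid_nword_def
    by (rule computable_Least[OF _ find_word_ex[unfolded valid_nword_def]])
      (intro comp_intro computable_dec decidable_carrier[OF effK])
  from computable_dec[OF this] show "computable find_word" by (simp add: find_word_def[abs_def])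
qed

lemma find_word:
  assumes "a \<in> carrier K"
  obtains w where "is_word gs w" "find_word a = nword w" "word_value G gs w = h a"
proof -
  have "valid_nword (find_word a) \<and> nval (find_word a) = a"
    using LeastI_ex[OF find_word_ex[of a]] assms by (simp add: find_word_def)
  then show thesis using that valid_nword_iff h_nval by metis
qed

section \<open>The algorithm\<close>

text \<open>
  A symbol \<open>v < s\<^sub>1 * s\<^sub>2\<close> stands for the pair of \<open>v mod s\<^sub>1\<close> and \<open>v div s\<^sub>1\<close>.  Layer 0 carries a
  point of \<open>X\<close> in the first components, layer 1 its image in the second components.
\<close>

definition avoid_rule :: "nat \<Rightarrow> nat \<Rightarrow> (nword \<times> nat) list \<Rightarrow> site list \<times> nat list list" where
  "avoid_rule s1 s d = (map (\<lambda>e. (nval (fst e), 0)) d,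
    filter (\<lambda>v. map (\<lambda>a. a mod s1) v \<noteq> map snd d) (List.n_lists (length d) [0..<s]))"

text \<open>\<open>map_of\<close> with its option coded as a number: 0 for a missing key, a
  successor for a found value.\<close>

definition table_find :: "(nat list \<times> nat) list \<Rightarrow> nat list \<Rightarrow> nat" where
  "table_find R u = foldr (\<lambda>e r. if fst e = u then Suc (snd e) else r) R 0"

definition image_rule :: "nat \<Rightarrow> nat \<Rightarrow> nword list \<Rightarrow> (nat list \<times> nat) list \<Rightarrow> site list \<times> nat list list" where
  "image_rule s1 s ws R = ((\<one>\<^bsub>K\<^esub>, 1) # map (\<lambda>w. (nval w, 0)) ws,
    filter (\<lambda>v. table_find R (map (\<lambda>a. a mod s1) (tl v)) = Suc (hd v div s1)) (List.n_lists (Suc (length ws)) [0..<s]))"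

definition graph_rules :: "nat \<Rightarrow> nat \<Rightarrow> (nword \<times> nat) list list \<Rightarrow> nword list \<times> (nat list \<times> nat) list \<Rightarrow> rules" where
  "graph_rules s1 s ds r = image_rule s1 s (fst r) (snd r) # map (avoid_rule s1 s) ds"

text \<open>A candidate for the image, given by allowed words of second components and lifted to the
  product alphabet with arbitrary first components.\<close>

definition factor_rules :: "nat \<Rightarrow> nat \<Rightarrow> site list \<Rightarrow> nat list list \<Rightarrow> rules" where
  "factor_rules s1 s D H = [(D, filter (\<lambda>v. map (\<lambda>a. a div s1) v \<in> set H) (List.n_lists (length D) [0..<s]))]"

text \<open>Candidates are described by allowed words but the output has to be forbidden patterns,
  hence the complement; its sites are returned as words over the generators.\<close>

definition out_patterns :: "nat \<Rightarrow> site list \<Rightarrow> nat list list \<Rightarrow> (nword \<times> nat) list list" where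
  "out_patterns s2 D H = map (zip (map (\<lambda>p. find_word (fst p)) D)) (filter (\<lambda>b. b \<notin> set H) (List.n_lists (length D) [0..<s2]))"

lemma table_find: "table_find R u = Suc v \<longleftrightarrow> map_of R u = Some v"
  unfolding table_find_def by (induction R) auto

lemma computable_graph_rules:
  assumes "computable s1" "computable s" "computable ds" "computable r"
  shows "computable (\<lambda>x. graph_rules (s1 x) (s x) (ds x) (r x))"
  unfolding graph_rules_def image_rule_def avoid_rule_def table_find_def
  by (intro comp_intro assms computable_compose[OF assms(1), of fst] computable_compose[OF assms(2), of fst]
      computable_compose[OF assms(4), of fst] computable_compose[OF assms(1), of "\<lambda>p. fst (fst p)"]
      computable_compose[OF assms(1), of "\<lambda>p. fst (fst (fst p))"] computable_compose[OF assms(4), of "\<lambda>p. fst (fst p)"])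

lemma computable_factor_rules:
  assumes "computable s1" "computable s" "computable D" "computable H"
  shows "computable (\<lambda>x. factor_rules (s1 x) (s x) (D x) (H x))"
  unfolding factor_rules_def
  by (intro comp_intro assms computable_compose[OF assms(1), of "\<lambda>p. fst (fst p)"] computable_compose[OF assms(4), of fst])

lemma computable_out_patterns:
  assumes "computable s2" "computable D" "computable H"
  shows "computable (\<lambda>x. out_patterns (s2 x) (D x) (H x))"
  unfolding out_patterns_def
  by (intro comp_intro assms computable_compose[OF assms(2), of fst] computable_compose[OF assms(3), of fst])

end

text \<open>If \<open>y\<close> were outside \<open>Y\<close>, a basic open neighbourhood of
  \<open>y\<close> in the complement would constrain finitely many coordinates, and a point of
  \<open>Y\<close> matching \<open>y\<close> there would belong to it.\<close>

lemma closedin_full_shift: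
  assumes Y: "closedin (full_shift_topology G S) Y" and y: "y \<in> carrier G \<rightarrow>\<^sub>E S"
    and approx: "\<And>W. finite W \<Longrightarrow> W \<subseteq> carrier G \<Longrightarrow> \<exists>y'\<in>Y. \<forall>g\<in>W. y' g = y g"
  shows "y \<in> Y"
proof (rule ccontr)
  assume "y \<notin> Y"
  let ?U = "(carrier G \<rightarrow>\<^sub>E S) - Y"
  have top: "topspace (full_shift_topology G S) = carrier G \<rightarrow>\<^sub>E S" by (simp add: full_shift_topology_def)
  have "openin (product_topology (\<lambda>_. discrete_topology S) (carrier G)) ?U"
    using Y unfolding closedin_def top by (simp add: full_shift_topology_def)
  then obtain V where V: "y \<in> PiE (carrier G) V" "finite {g. V g \<noteq> S}" "PiE (carrier G) V \<subseteq> ?U"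
    using product_topology_open_contains_basis[of "\<lambda>_. discrete_topology S" "carrier G" ?U y] y \<open>y \<notin> Y\<close> by auto
  obtain y' where y': "y' \<in> Y" "\<And>g. g \<in> carrier G \<Longrightarrow> V g \<noteq> S \<Longrightarrow> y' g = y g"
    using approx[of "{g. V g \<noteq> S} \<inter> carrier G"] V(2) by auto
  have "y' \<in> carrier G \<rightarrow>\<^sub>E S" using closedin_subset[OF Y] y'(1) unfolding top by blast
  then have "y' \<in> PiE (carrier G) V"
    using y'(2) PiE_mem[OF V(1)] by (intro PiE_I) (metis PiE_mem, metis PiE_arb)
  then show False using V(3) y'(1) by blast
qed

text \<open>The specification in \<open>ext_enum\<close> for a fixed \<open>C\<close>, so that one
  \<open>C\<close> can be chosen before any input is given.\<close>

definition (in coded_group) correct :: "(nat \<times> nat list \<times> rules \<times> rules \<Rightarrow> bool) \<Rightarrow> bool" where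
  "correct C \<longleftrightarrow> (\<forall>s A cs1 cs2. on_cells K snd UNIV cs1 \<longrightarrow> on_cells K snd UNIV cs2 \<longrightarrow>
    (C (s, A, cs1, cs2) \<longrightarrow> exts K (carrier K) snd s (set A) cs1 cs2) \<and>
    (\<forall>\<Sigma>. group \<Sigma> \<longrightarrow> carrier \<Sigma> = {..<s} \<longrightarrow> on_cells K snd (set A) cs1 \<longrightarrow>
      sub_cfg \<Sigma> (sol K (carrier K) s cs1) \<longrightarrow> sub_cfg \<Sigma> (sol K (carrier K) s cs2) \<longrightarrow>
      exts K (carrier K) snd s (set A) cs1 cs2 \<longrightarrow> C (s, A, cs1, cs2)))"

lemma (in coded_group) correct_sound:
  assumes "correct C" "on_cells K snd UNIV cs1" "on_cells K snd UNIV cs2" "C (s, A, cs1, cs2)"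
  shows "exts K (carrier K) snd s (set A) cs1 cs2"
  using assms unfolding correct_def by simp

lemma (in coded_group) correct_complete:
  assumes "correct C" "on_cells K snd UNIV cs1" "on_cells K snd UNIV cs2" "group \<Sigma>" "carrier \<Sigma> = {..<s}"
    "on_cells K snd (set A) cs1" "sub_cfg \<Sigma> (sol K (carrier K) s cs1)" "sub_cfg \<Sigma> (sol K (carrier K) s cs2)"
    "exts K (carrier K) snd s (set A) cs1 cs2"
  shows "C (s, A, cs1, cs2)"
  using assms(1)[unfolded correct_def, rule_format, OF assms(2,3)] assms(4-) by simp

definition tlen :: "nat \<Rightarrow> nat" where "tlen c = length (dec c :: nat list list)"

text \<open>\<open>z\<close> is the list of the four input codes. The list \<open>[1]\<close>
  demands agreement on the layer of images only; \<open>distinct D\<close>, with all sites on one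
  layer, makes the output patterns single-valued.\<close>

definition (in coded_group) cert ::
    "(nat \<times> nat list \<times> rules \<times> rules \<Rightarrow> bool) \<Rightarrow> nat list \<Rightarrow> (nword \<times> nat) list list \<Rightarrow> bool" where
  "cert C z y \<longleftrightarrow> (\<exists>D H.
    (\<forall>p\<in>set D. fst p \<in> carrier K \<and> snd p = 1) \<and> distinct D \<and>
    C (tlen (hd z) * tlen (hd (tl (tl z))), [1], factor_rules (tlen (hd z)) (tlen (hd z) * tlen (hd (tl (tl z)))) D H,
      graph_rules (tlen (hd z)) (tlen (hd z) * tlen (hd (tl (tl z)))) (dec (hd (tl z))) (dec (hd (tl (tl (tl z)))))) \<and>
    incl K (carrier K) (tlen (hd z) * tlen (hd (tl (tl z))),
      graph_rules (tlen (hd z)) (tlen (hd z) * tlen (hd (tl (tl z)))) (dec (hd (tl z))) (dec (hd (tl (tl (tl z))))),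
      factor_rules (tlen (hd z)) (tlen (hd z) * tlen (hd (tl (tl z)))) D H) \<and>
    y = out_patterns (tlen (hd (tl (tl z)))) D H)"

lemma (in coded_group) re_pred_cert:
  assumes "re_pred C" shows "re_pred (\<lambda>p. cert C (fst p) (snd p))"
proof -
  have car: "decidable (\<lambda>g. g \<in> carrier K)" using effK by (simp add: effgrp_def)
  have tlen: "computable (\<lambda>x. tlen (f x))" if "computable f" for f :: "'z::encodable \<Rightarrow> nat"
    unfolding tlen_def by (intro comp_intro computable_dec that)
  show ?thesis
    unfolding cert_def
    by (intro re_pred_ex re_pred_conj re_pred_compose[OF assms] re_pred_compose[OF re_pred_incl[OF effK car]])
      (intro re_pred_decidable comp_intro tlen computable_dec computable_graph_rules computable_factor_rules
        computable_out_patterns decidable_carrier[OF effK])+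
qed

section \<open>One instance of the problem: the graph of the map as a shift of finite type\<close>

locale factor_problem = coded_group G gs K h
  for G :: "('g, 'b) monoid_scheme" (structure) and gs K h +
  fixes \<Sigma>1 \<Sigma>2 :: "nat monoid" and X Y :: "('g \<Rightarrow> nat) set" and f F N \<phi> T1 T2 ds r
  assumes T1: "table_describes T1 \<Sigma>1" and T2: "table_describes T2 \<Sigma>2"
    and ds: "patterns_describe G gs (carrier \<Sigma>1) ds F" and X: "X = shift_avoiding G (carrier \<Sigma>1) F"
    and gX: "group_shift G \<Sigma>1 X" and gY: "group_shift G \<Sigma>2 Y"
    and hom: "group_shift_hom G \<Sigma>1 X \<Sigma>2 Y f" and img: "f ` X = Y"
    and lr: "local_rule G (carrier \<Sigma>1) (carrier \<Sigma>2) X f N \<phi>"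
    and rd: "rule_describes G gs (carrier \<Sigma>1) r N \<phi>"
begin

definition s1 where "s1 = length T1"
definition s2 where "s2 = length T2"
definition s where "s = s1 * s2"

lemma car1: "carrier \<Sigma>1 = {..<s1}" and car2: "carrier \<Sigma>2 = {..<s2}"
  and grp1: "group \<Sigma>1" and grp2: "group \<Sigma>2"
  using T1 T2 by (simp_all add: table_describes_def s1_def s2_def)

sublocale S1: group \<Sigma>1 by (rule grp1)
sublocale S2: group \<Sigma>2 by (rule grp2)

lemma s1_pos: "s1 > 0" and s2_pos: "s2 > 0"
  using S1.one_closed S2.one_closed by (auto simp: car1 car2)

definition px :: "config \<Rightarrow> 'g \<Rightarrow> nat" where "px x = (\<lambda>g\<in>carrier G. x (hi g, 0) mod s1)"
definition py :: "config \<Rightarrow> 'g \<Rightarrow> nat" where "py x = (\<lambda>g\<in>carrier G. x (hi g, 1) div s1)"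
text \<open>A common section of \<open>px\<close> and \<open>py\<close>; the components that neither
  of them reads are 0.\<close>

definition merge :: "('g \<Rightarrow> nat) \<Rightarrow> ('g \<Rightarrow> nat) \<Rightarrow> config" where
  "merge x y p = (if fst p \<in> carrier K \<and> snd p = 0 then x (h (fst p))
    else if fst p \<in> carrier K \<and> snd p = 1 then y (h (fst p)) * s1 else 0)"

lemma div_s1: "v < s \<Longrightarrow> v div s1 < s2"
  by (simp add: s_def less_mult_imp_div_less mult.commute)

lemma px_mem: "px x \<in> carrier G \<rightarrow>\<^sub>E {..<s1}"
  using s1_pos by (auto simp: px_def)

lemma py_mem: "x \<in> cfg s \<Longrightarrow> py x \<in> carrier G \<rightarrow>\<^sub>E {..<s2}"
  by (auto simp: py_def cfg_def div_s1)

lemma px_h: "k \<in> carrier K \<Longrightarrow> px x (h k) = x (k, 0) mod s1"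
  and py_h: "k \<in> carrier K \<Longrightarrow> py x (h k) = x (k, 1) div s1"
  by (simp_all add: px_def py_def)

lemma merge_cfg:
  assumes "x \<in> carrier G \<rightarrow>\<^sub>E {..<s1}" "y \<in> carrier G \<rightarrow>\<^sub>E {..<s2}"
  shows "merge x y \<in> cfg s" "px (merge x y) = x" "py (merge x y) = y"
proof -
  have x: "x g < s1" and y: "y g < s2" if "g \<in> carrier G" for g using assms that by (auto dest: PiE_mem)
  have "x g < s" if "g \<in> carrier G" for g
    using x[OF that] s2_pos by (metis s_def less_le_trans mult.right_neutral mult_le_mono2 Suc_leI One_nat_def)
  moreover have "y g * s1 < s" if "g \<in> carrier G" for g
    using y[OF that] s1_pos by (simp add: s_def)
  ultimately show "merge x y \<in> cfg s"
    using s1_pos s2_pos by (auto simp: cfg_def merge_def s_def)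
  have undef: "x g = undefined" "y g = undefined" if "g \<notin> carrier G" for g
    using PiE_arb[OF assms(1) that] PiE_arb[OF assms(2) that] .
  show "px (merge x y) = x"
  proof
    show "px (merge x y) g = x g" for g
      using x[of g] undef(1)[of g] by (cases "g \<in> carrier G") (simp_all add: px_def merge_def)
  qed
  show "py (merge x y) = y"
  proof
    show "py (merge x y) g = y g" for g
      using s1_pos undef(2)[of g] by (cases "g \<in> carrier G") (simp_all add: py_def merge_def)
  qed
qed

lemma X_mem: "x \<in> X \<Longrightarrow> x \<in> carrier G \<rightarrow>\<^sub>E {..<s1}"
  by (simp add: X shift_avoiding_def car1)

lemma f_mem: "x \<in> X \<Longrightarrow> f x \<in> Y"
  using img by blast

lemma Y_mem: "y \<in> Y \<Longrightarrow> y \<in> carrier G \<rightarrow>\<^sub>E {..<s2}"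
proof -
  assume y: "y \<in> Y"
  have "subgroup Y (cellwise_group G \<Sigma>2)" using gY by (simp add: group_shift_def)
  from subgroup.mem_carrier[OF this y] have "y \<in> carrier (cellwise_group G \<Sigma>2)" .
  then show ?thesis by (simp add: cellwise_group_def car2)
qed

lemma shift_X: "x \<in> X \<Longrightarrow> g \<in> carrier G \<Longrightarrow> shift G g x \<in> X"
  using gX by (simp add: group_shift_def subshift_def)

text \<open>The local rule speaks about the identity; shifting \<open>x\<close> by the inverse of
  \<open>g\<close> brings \<open>g\<close> there, and \<open>f\<close> commutes with the
  shift.\<close>

lemma f_at:
  assumes x: "x \<in> X" and g: "g \<in> carrier G"
  shows "map_of (snd r) (map (\<lambda>w. x (g \<otimes> word_value G gs w)) (fst r)) = Some (f x g)"
proof -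
  obtain ws R where r: "r = (ws, R)" by (cases r)
  have ws: "\<forall>w\<in>set ws. is_word gs w" "N = word_value G gs ` set ws"
    "\<And>u. u \<in> N \<rightarrow>\<^sub>E carrier \<Sigma>1 \<Longrightarrow> \<phi> u = map_of R (map (\<lambda>w. u (word_value G gs w)) ws)"
    using rd by (auto simp: rule_describes_def r)
  define y where "y = shift G (inv g) x"
  have y: "y \<in> X" using shift_X[OF x] g by (simp add: y_def)
  have NG: "N \<subseteq> carrier G" and ph: "\<phi> (restrict y N) = Some (f y \<one>)"
    using lr y by (auto simp: local_rule_def)
  have "restrict y N \<in> N \<rightarrow>\<^sub>E carrier \<Sigma>1"
    using X_mem[OF y] NG by (auto simp: car1)
  from ws(3)[OF this] ph have "map_of R (map (\<lambda>w. restrict y N (word_value G gs w)) ws) = Some (f y \<one>)" by simp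
  moreover have "restrict y N (word_value G gs w) = x (g \<otimes> word_value G gs w)" if "w \<in> set ws" for w
    using that ws(1,2) g by (auto simp: y_def shift_def)
  then have "map (\<lambda>w. restrict y N (word_value G gs w)) ws = map (\<lambda>w. x (g \<otimes> word_value G gs w)) ws" by simp
  moreover have "f y \<one> = f x g"
  proof -
    have "f y = shift G (inv g) (f x)" using hom x g by (simp add: group_shift_hom_def y_def)
    then show ?thesis using g by (simp add: shift_def)
  qed
  ultimately show ?thesis by (simp only: r fst_conv snd_conv)
qed

lemma px_word: "k \<in> carrier K \<Longrightarrow> is_word gs w \<Longrightarrow> px x (h k \<otimes> word_value G gs w) = x (k \<otimes>\<^bsub>K\<^esub> nval (nword w), 0) mod s1"
  using px_h[of "k \<otimes>\<^bsub>K\<^esub> nval (nword w)" x] by (simp add: h_nval)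

lemma occurs_iff:
  assumes "pattern_describes G gs S d p"
  shows "occurs_at G p x g \<longleftrightarrow> (\<forall>e\<in>set d. snd e = x (g \<otimes> word_value G gs (fst e)))"
proof -
  have gr: "p v = Some a \<longleftrightarrow> (\<exists>e\<in>set d. v = word_value G gs (fst e) \<and> a = snd e)" for v a
  proof -
    have "p v = Some a \<longleftrightarrow> (v, a) \<in> Map.graph p" by (simp add: Map.graph_def)
    also have "Map.graph p = (\<lambda>e. (word_value G gs (fst e), snd e)) ` set d"
      using assms by (simp add: pattern_describes_def case_prod_beta)
    finally show ?thesis unfolding image_iff prod.inject .
  qed
  show ?thesis
    unfolding occurs_at_def
  proof (intro iffI ballI)
    fix e assume occ: "\<forall>v\<in>dom p. p v = Some (x (g \<otimes> v))" and e: "e \<in> set d"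
    have pe: "p (word_value G gs (fst e)) = Some (snd e)"
      unfolding gr by (rule bexI[OF _ e]) simp
    with bspec[OF occ domI[of p, OF pe]] show "snd e = x (g \<otimes> word_value G gs (fst e))" by simp
  next
    fix v assume all: "\<forall>e\<in>set d. snd e = x (g \<otimes> word_value G gs (fst e))" and "v \<in> dom p"
    then obtain a where a: "p v = Some a" by (auto simp: dom_def)
    then obtain e where "e \<in> set d" "v = word_value G gs (fst e)" "a = snd e" unfolding gr by (rule bexE) simp
    then show "p v = Some (x (g \<otimes> v))" using all a by simp
  qed
qed

lemma avoid_iff:
  assumes x: "x \<in> cfg s" and d: "pattern_describes G gs S d p" and k: "k \<in> carrier K"
  shows "map (\<lambda>q. x (act K k q)) (fst (avoid_rule s1 s (npattern d))) \<in> set (snd (avoid_rule s1 s (npattern d)))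
    \<longleftrightarrow> \<not> occurs_at G p (px x) (h k)"
proof -
  have w: "is_word gs (fst e)" if "e \<in> set d" for e
    using d that by (auto simp: pattern_describes_def)
  let ?v = "map (\<lambda>e. x (k \<otimes>\<^bsub>K\<^esub> nval (nword (fst e)), 0)) d"
  have v: "map (\<lambda>q. x (act K k q)) (fst (avoid_rule s1 s (npattern d))) = ?v"
    by (simp add: avoid_rule_def npattern_def act_def)
  have "?v \<in> set (List.n_lists (length (npattern d)) [0..<s])"
    using x by (auto simp: set_n_lists cfg_def npattern_def)
  then have "?v \<in> set (snd (avoid_rule s1 s (npattern d))) \<longleftrightarrow> map (\<lambda>a. a mod s1) ?v \<noteq> map snd (npattern d)"
    by (simp add: avoid_rule_def)
  also have "\<dots> \<longleftrightarrow> \<not> (\<forall>e\<in>set d. x (k \<otimes>\<^bsub>K\<^esub> nval (nword (fst e)), 0) mod s1 = snd e)"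
    by (simp add: npattern_def)
  also have "\<dots> \<longleftrightarrow> \<not> occurs_at G p (px x) (h k)"
    unfolding occurs_iff[OF d]
  proof (rule arg_cong[of _ _ Not], rule ball_cong[OF refl])
    fix e assume "e \<in> set d"
    from px_word[OF k w[OF this], of x]
    show "x (k \<otimes>\<^bsub>K\<^esub> nval (nword (fst e)), 0) mod s1 = snd e \<longleftrightarrow> snd e = px x (h k \<otimes> word_value G gs (fst e))"
      by (auto simp del: h_mult)
  qed
  finally show ?thesis unfolding v .
qed

lemma image_iff':
  assumes x: "x \<in> cfg s" and k: "k \<in> carrier K"
  shows "map (\<lambda>q. x (act K k q)) (fst (image_rule s1 s (map nword (fst r)) (snd r)))
      \<in> set (snd (image_rule s1 s (map nword (fst r)) (snd r)))
    \<longleftrightarrow> map_of (snd r) (map (\<lambda>w. px x (h k \<otimes> word_value G gs w)) (fst r)) = Some (py x (h k))"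
proof -
  have w: "is_word gs w" if "w \<in> set (fst r)" for w
    using rd that by (auto simp: rule_describes_def case_prod_beta)
  let ?u = "map (\<lambda>w. x (k \<otimes>\<^bsub>K\<^esub> nval (nword w), 0)) (fst r)"
  let ?v = "x (k, 1) # ?u"
  have v: "map (\<lambda>q. x (act K k q)) (fst (image_rule s1 s (map nword (fst r)) (snd r))) = ?v"
    using k by (simp add: image_rule_def act_def)
  have u: "map (\<lambda>a. a mod s1) ?u = map (\<lambda>w. px x (h k \<otimes> word_value G gs w)) (fst r)"
    using px_word[OF k w] by simp
  have "?v \<in> set (List.n_lists (Suc (length (map nword (fst r)))) [0..<s])"
    unfolding set_n_lists using x by (auto simp: cfg_def simp del: n_lists.simps)
  then have "?v \<in> set (snd (image_rule s1 s (map nword (fst r)) (snd r))) \<longleftrightarrow>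
      table_find (snd r) (map (\<lambda>a. a mod s1) ?u) = Suc (x (k, 1) div s1)"
    unfolding image_rule_def snd_conv set_filter mem_Collect_eq list.sel by blast
  then show ?thesis unfolding v u table_find py_h[OF k] .
qed

lemma ball_K: "(\<forall>k\<in>carrier K. P (h k)) \<longleftrightarrow> (\<forall>g\<in>carrier G. P g)"
proof
  assume P: "\<forall>k\<in>carrier K. P (h k)"
  show "\<forall>g\<in>carrier G. P g"
  proof
    fix g assume "g \<in> carrier G"
    with P[rule_format, of "hi g"] show "P g" by simp
  qed
qed simp

definition grc :: rules where "grc = graph_rules s1 s (map npattern ds) (map nword (fst r), snd r)"

text \<open>Only first components on layer 0 and second components on layer 1, at group elements,
  are bound by the rules; all other data of a configuration are free.\<close>

lemma graph_iff: "x \<in> sol K (carrier K) s grc \<longleftrightarrow> x \<in> cfg s \<and> px x \<in> X \<and> py x = f (px x)"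
proof (cases "x \<in> cfg s")
  case x: True
  obtain ps where ps: "list_all2 (pattern_describes G gs (carrier \<Sigma>1)) ds ps" "F = set ps"
    using ds by (auto simp: patterns_describe_def)
  let ?sat = "\<lambda>k c. map (\<lambda>q. x (act K k q)) (fst c) \<in> set (snd c)"
  have "(\<forall>d\<in>set ds. ?sat k (avoid_rule s1 s (npattern d))) \<longleftrightarrow> (\<forall>p\<in>F. \<not> occurs_at G p (px x) (h k))"
    if k: "k \<in> carrier K" for k
  proof -
    have "(\<forall>d\<in>set ds. ?sat k (avoid_rule s1 s (npattern d))) \<longleftrightarrow> (\<forall>i<length ds. \<not> occurs_at G (ps ! i) (px x) (h k))"
      using avoid_iff[OF x list_all2_nthD[OF ps(1)] k] by (metis in_set_conv_nth)
    also have "\<dots> \<longleftrightarrow> (\<forall>p\<in>F. \<not> occurs_at G p (px x) (h k))"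
      unfolding ps(2) list_all2_lengthD[OF ps(1)] by (metis in_set_conv_nth)
    finally show ?thesis .
  qed
  then have "(\<forall>k\<in>carrier K. \<forall>d\<in>set ds. ?sat k (avoid_rule s1 s (npattern d))) \<longleftrightarrow>
      (\<forall>k\<in>carrier K. \<forall>p\<in>F. \<not> occurs_at G p (px x) (h k))" by simp
  also have "\<dots> \<longleftrightarrow> px x \<in> X"
    unfolding ball_K[of "\<lambda>g. \<forall>p\<in>F. \<not> occurs_at G p (px x) g"] X shift_avoiding_def car1
    using px_mem[of x] by blast
  finally have avoid: "(\<forall>k\<in>carrier K. \<forall>d\<in>set ds. ?sat k (avoid_rule s1 s (npattern d))) \<longleftrightarrow> px x \<in> X" .
  have image: "(\<forall>k\<in>carrier K. ?sat k (image_rule s1 s (map nword (fst r)) (snd r))) \<longleftrightarrow> py x = f (px x)" if "px x \<in> X"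
  proof -
    have "(\<forall>k\<in>carrier K. ?sat k (image_rule s1 s (map nword (fst r)) (snd r))) \<longleftrightarrow> (\<forall>k\<in>carrier K. f (px x) (h k) = py x (h k))"
      using image_iff'[OF x] f_at[OF that h_closed] by simp
    also have "\<dots> \<longleftrightarrow> (\<forall>g\<in>carrier G. f (px x) g = py x g)" by (rule ball_K)
    also have "\<dots> \<longleftrightarrow> py x = f (px x)"
      using PiE_ext[OF py_mem[OF x] Y_mem[OF f_mem[OF that]]] by auto
    finally show ?thesis .
  qed
  have "x \<in> sol K (carrier K) s grc \<longleftrightarrow> (\<forall>k\<in>carrier K. ?sat k (image_rule s1 s (map nword (fst r)) (snd r))) \<and>
      (\<forall>k\<in>carrier K. \<forall>d\<in>set ds. ?sat k (avoid_rule s1 s (npattern d)))"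
    using x by (simp add: sol_def grc_def graph_rules_def) blast
  then show ?thesis using avoid image x by blast
qed (simp add: sol_def)

definition allowed :: "site list \<Rightarrow> nat list list \<Rightarrow> ('g \<Rightarrow> nat) set" where
  "allowed D H = {y \<in> carrier G \<rightarrow>\<^sub>E {..<s2}. \<forall>g\<in>carrier G. map (\<lambda>p. y (g \<otimes> h (fst p))) D \<in> set H}"

lemma factor_iff:
  assumes z: "z \<in> cfg s" and D: "\<forall>p\<in>set D. fst p \<in> carrier K \<and> snd p = 1"
  shows "z \<in> sol K (carrier K) s (factor_rules s1 s D H) \<longleftrightarrow> py z \<in> allowed D H"
proof -
  have "map (\<lambda>q. z (act K k q)) D \<in> set (snd (hd (factor_rules s1 s D H))) \<longleftrightarrow>
      map (\<lambda>p. py z (h k \<otimes> h (fst p))) D \<in> set H" if k: "k \<in> carrier K" for k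
  proof -
    have "map (\<lambda>q. z (act K k q)) D \<in> set (List.n_lists (length D) [0..<s])"
      using z by (auto simp: set_n_lists cfg_def)
    moreover have "map (\<lambda>a. a div s1) (map (\<lambda>q. z (act K k q)) D) = map (\<lambda>p. py z (h k \<otimes> h (fst p))) D"
      unfolding map_map
    proof (intro map_cong refl)
      fix p assume "p \<in> set D"
      then have "fst p \<in> carrier K" "snd p = 1" using D by auto
      then show "((\<lambda>a. a div s1) \<circ> (\<lambda>q. z (act K k q))) p = py z (h k \<otimes> h (fst p))"
        using k py_h[of "k \<otimes>\<^bsub>K\<^esub> fst p" z] by (simp add: act_def)
    qed
    ultimately show ?thesis by (simp add: factor_rules_def del: map_map)
  qed
  then have "z \<in> sol K (carrier K) s (factor_rules s1 s D H) \<longleftrightarrow>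
      (\<forall>k\<in>carrier K. map (\<lambda>p. py z (h k \<otimes> h (fst p))) D \<in> set H)"
    using z by (simp add: sol_def factor_rules_def)
  also have "\<dots> \<longleftrightarrow> py z \<in> allowed D H"
    unfolding ball_K[of "\<lambda>g. map (\<lambda>p. py z (g \<otimes> h (fst p))) D \<in> set H"] allowed_def
    using py_mem[OF z] by blast
  finally show ?thesis .
qed

lemma out_correct:
  assumes D: "\<forall>p\<in>set D. fst p \<in> carrier K \<and> snd p = 1" "distinct D"
  shows "\<exists>ds' F'. enc (out_patterns s2 D H) = patterns_code ds' \<and>
    patterns_describe G gs (carrier \<Sigma>2) ds' F' \<and> shift_avoiding G (carrier \<Sigma>2) F' = allowed D H"
proof -
  have "\<forall>a\<in>carrier K. \<exists>w. is_word gs w \<and> find_word a = nword w \<and> word_value G gs w = h a"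
    using find_word by metis
  then obtain W where W: "\<And>a. a \<in> carrier K \<Longrightarrow> is_word gs (W a) \<and> find_word a = nword (W a) \<and> word_value G gs (W a) = h a"
    by metis
  let ?bs = "filter (\<lambda>b. b \<notin> set H) (List.n_lists (length D) [0..<s2])"
  have bs: "length b = length D" "set b \<subseteq> {..<s2}" if "b \<in> set ?bs" for b
    using that by (auto simp: set_n_lists)
  define dd where "dd b = zip (map (\<lambda>p. W (fst p)) D) b" for b :: "nat list"
  define pp where "pp b = map_of (zip (map (\<lambda>p. h (fst p)) D) b)" for b :: "nat list"
  have np: "npattern (dd b) = zip (map (\<lambda>p. find_word (fst p)) D) b" for b
  proof -
    have "map (\<lambda>p. find_word (fst p)) D = map nword (map (\<lambda>p. W (fst p)) D)" using W D(1) by simp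
    moreover have "npattern (zip ws b) = zip (map nword ws) b" for ws
      by (simp add: npattern_def zip_map1 case_prod_beta')
    ultimately show ?thesis unfolding dd_def by metis
  qed
  have code: "enc (out_patterns s2 D H) = patterns_code (map dd ?bs)"
    unfolding patterns_code_nword out_patterns_def by (simp add: np o_def)
  have "inj_on h (carrier K)" using h_bij by (simp add: bij_betw_def)
  \<comment> \<open>All sites of \<open>D\<close> lie on layer 1, so distinct sites sit at distinct
    group elements and every word on \<open>D\<close> is a pattern.\<close>
  then have "inj_on (\<lambda>p. h (fst p)) (set D)"
    using D(1) by (auto simp: inj_on_def prod_eq_iff)
  then have dist: "distinct (map (\<lambda>p. h (fst p)) D)" using D(2) by (simp add: distinct_map)
  have des: "pattern_describes G gs (carrier \<Sigma>2) (dd b) (pp b)" if b: "b \<in> set ?bs" for b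
    unfolding pattern_describes_def is_pattern_def
  proof (intro conjI)
    have gr: "Map.graph (pp b) = set (zip (map (\<lambda>p. h (fst p)) D) b)"
      unfolding pp_def by (rule graph_map_of_if_distinct_dom) (use dist bs(1)[OF b] in simp)
    have "map (\<lambda>p. h (fst p)) D = map (word_value G gs) (map (\<lambda>p. W (fst p)) D)" using W D(1) by simp
    then have "zip (map (\<lambda>p. h (fst p)) D) b = map (\<lambda>(w, s). (word_value G gs w, s)) (dd b)"
      by (simp only: zip_map1 dd_def)
    then show "Map.graph (pp b) = (\<lambda>(w, s). (word_value G gs w, s)) ` set (dd b)"
      using gr by simp
    show "finite (dom (pp b))" by (simp add: pp_def finite_dom_map_of)
    show "dom (pp b) \<subseteq> carrier G" using D(1) bs(1)[OF b] by (auto simp: pp_def dom_map_of_zip)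
    show "ran (pp b) \<subseteq> carrier \<Sigma>2"
      using bs(2)[OF b] unfolding pp_def car2 ran_def by (auto dest!: map_of_SomeD set_zip_rightD)
    show "\<forall>(w, s)\<in>set (dd b). is_word gs w"
    proof clarify
      fix w a assume "(w, a) \<in> set (dd b)"
      then have "w \<in> set (map (\<lambda>p. W (fst p)) D)" unfolding dd_def by (rule set_zip_leftD)
      then show "is_word gs w" using W D(1) by auto
    qed
  qed
  have occ: "occurs_at G (pp b) y g \<longleftrightarrow> map (\<lambda>p. y (g \<otimes> h (fst p))) D = b" if b: "b \<in> set ?bs" for b y g
  proof -
    have "occurs_at G (pp b) y g \<longleftrightarrow> (\<forall>i<length D. b ! i = y (g \<otimes> word_value G gs (W (fst (D ! i)))))"
      unfolding occurs_iff[OF des[OF b]] dd_def using bs(1)[OF b] by (auto simp: set_zip)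
    also have "\<dots> \<longleftrightarrow> (\<forall>i<length D. map (\<lambda>p. y (g \<otimes> h (fst p))) D ! i = b ! i)"
      using W D(1) nth_mem by (metis (no_types, lifting) nth_map)
    also have "\<dots> \<longleftrightarrow> map (\<lambda>p. y (g \<otimes> h (fst p))) D = b"
      using bs(1)[OF b] by (auto simp: list_eq_iff_nth_eq)
    finally show ?thesis .
  qed
  have "patterns_describe G gs (carrier \<Sigma>2) (map dd ?bs) (set (map pp ?bs))"
    unfolding patterns_describe_def
    by (intro exI[of _ "map pp ?bs"] conjI refl)
      (unfold list_all2_map1 list_all2_map2 list_all2_same, rule ballI, rule des)
  moreover have "shift_avoiding G (carrier \<Sigma>2) (set (map pp ?bs)) = allowed D H"
  proof -
    have "(\<forall>p\<in>set (map pp ?bs). \<not> occurs_at G p y g) \<longleftrightarrow> map (\<lambda>p. y (g \<otimes> h (fst p))) D \<in> set H"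
      if y: "y \<in> carrier G \<rightarrow>\<^sub>E {..<s2}" and g: "g \<in> carrier G" for y g
    proof -
      have "map (\<lambda>p. y (g \<otimes> h (fst p))) D \<in> set (List.n_lists (length D) [0..<s2])"
        using PiE_mem[OF y] D(1) g by (auto simp: set_n_lists)
      moreover have "(\<forall>p\<in>set (map pp ?bs). \<not> occurs_at G p y g) \<longleftrightarrow> (\<forall>b\<in>set ?bs. map (\<lambda>p. y (g \<otimes> h (fst p))) D \<noteq> b)"
        using occ by (simp only: set_map ball_simps) blast
      ultimately show ?thesis by auto
    qed
    then show ?thesis unfolding shift_avoiding_def allowed_def car2 by blast
  qed
  ultimately show ?thesis using code by blast
qed

lemma on_cells_factor: "\<forall>p\<in>set D. fst p \<in> carrier K \<and> snd p = 1 \<Longrightarrow> on_cells K snd {1} (factor_rules s1 s D H)"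
  by (simp add: on_cells_def factor_rules_def)

lemma on_cells_graph: "on_cells K snd UNIV grc"
  by (auto simp: on_cells_def grc_def graph_rules_def image_rule_def avoid_rule_def)

lemma py_cong: "(\<And>k. k \<in> carrier K \<Longrightarrow> x (k, 1) = y (k, 1)) \<Longrightarrow> py x = py y"
  and px_cong: "(\<And>k. k \<in> carrier K \<Longrightarrow> x (k, 0) = y (k, 0)) \<Longrightarrow> px x = px y"
  unfolding py_def px_def by (rule restrict_ext, simp)+

lemma agree_py: "agree K snd {1} x z \<Longrightarrow> py x = py z"
  by (rule py_cong) (simp add: agree_def)

text \<open>The inclusion of the graph in the candidate bounds \<open>Y\<close> from above, and the
  extension statement bounds it from below.\<close>

lemma factor_sound:
  assumes D: "\<forall>p\<in>set D. fst p \<in> carrier K \<and> snd p = 1"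
    and ext: "exts K (carrier K) snd s {1} (factor_rules s1 s D H) grc"
    and sub: "sol K (carrier K) s grc \<subseteq> sol K (carrier K) s (factor_rules s1 s D H)"
  shows "Y = allowed D H"
proof
  show "Y \<subseteq> allowed D H"
  proof
    fix y assume "y \<in> Y"
    then obtain x where x: "x \<in> X" "y = f x" using img by blast
    note m = merge_cfg[OF X_mem[OF x(1)] Y_mem[OF \<open>y \<in> Y\<close>]]
    have "merge x y \<in> sol K (carrier K) s grc" unfolding graph_iff using m x by simp
    then have "merge x y \<in> sol K (carrier K) s (factor_rules s1 s D H)" using sub by (rule subsetD[rotated])
    then show "y \<in> allowed D H" using factor_iff[OF m(1) D] m(3) by simp
  qed
  show "allowed D H \<subseteq> Y"
  proof
    fix y assume y: "y \<in> allowed D H"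
    \<comment> \<open>Any filling of layer 0 works, since the candidate sees second components on
      layer 1 only.\<close>
    have "restrict (\<lambda>_. 0) (carrier G) \<in> carrier G \<rightarrow>\<^sub>E {..<s1}" using s1_pos by auto
    moreover have "y \<in> carrier G \<rightarrow>\<^sub>E {..<s2}" using y by (simp add: allowed_def)
    ultimately obtain z where z: "z \<in> cfg s" "py z = y" using merge_cfg(1,3) by blast
    then have "z \<in> sol K (carrier K) s (factor_rules s1 s D H)" using factor_iff[OF z(1) D] y by simp
    then obtain x where x: "x \<in> sol K (carrier K) s grc" "agree K snd {1} x z"
      using ext unfolding exts_def by (auto dest: bspec)
    then have "y = f (px x)" "px x \<in> X" using agree_py[OF x(2)] z(2) x(1) unfolding graph_iff by simp_all
    then show "y \<in> Y" using f_mem by simp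
  qed
qed

text \<open>The direct product of \<Sigma>1 and \<Sigma>2 carried to the numbers below s by
  \<open>mod\<close> and \<open>div\<close>, because \<open>markov\<close> and
  \<open>ext_enum\<close> speak about a single alphabet group on an initial segment.\<close>

definition pairs :: "nat monoid" where
  "pairs = \<lparr>carrier = {..<s},
    mult = \<lambda>a b. (a mod s1 \<otimes>\<^bsub>\<Sigma>1\<^esub> (b mod s1)) + s1 * (a div s1 \<otimes>\<^bsub>\<Sigma>2\<^esub> (b div s1)),
    one = \<one>\<^bsub>\<Sigma>1\<^esub> + s1 * \<one>\<^bsub>\<Sigma>2\<^esub>\<rparr>"

lemma carrier_pairs [simp]: "carrier pairs = {..<s}"
  by (simp add: pairs_def)

lemma mod1: "a < s \<Longrightarrow> a mod s1 \<in> carrier \<Sigma>1" and div2: "a < s \<Longrightarrow> a div s1 \<in> carrier \<Sigma>2"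
  using s1_pos by (simp_all add: car1 car2 div_s1)

lemma combine:
  assumes "a \<in> carrier \<Sigma>1" "b \<in> carrier \<Sigma>2"
  shows "a + s1 * b < s" "(a + s1 * b) mod s1 = a" "(a + s1 * b) div s1 = b"
proof -
  have "a < s1" "b < s2" using assms by (simp_all add: car1 car2)
  then have "a + s1 * b < s1 * Suc b" "s1 * Suc b \<le> s1 * s2" by (simp, intro mult_le_mono2, simp)
  then show "a + s1 * b < s" unfolding s_def by (rule less_le_trans)
  show "(a + s1 * b) mod s1 = a" "(a + s1 * b) div s1 = b" using \<open>a < s1\<close> by simp_all
qed

lemma pairs_mult:
  assumes "a < s" "b < s"
  shows "a \<otimes>\<^bsub>pairs\<^esub> b < s" "(a \<otimes>\<^bsub>pairs\<^esub> b) mod s1 = a mod s1 \<otimes>\<^bsub>\<Sigma>1\<^esub> (b mod s1)"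
    "(a \<otimes>\<^bsub>pairs\<^esub> b) div s1 = a div s1 \<otimes>\<^bsub>\<Sigma>2\<^esub> (b div s1)"
  using combine[OF S1.m_closed[OF mod1[OF assms(1)] mod1[OF assms(2)]] S2.m_closed[OF div2[OF assms(1)] div2[OF assms(2)]]]
  by (simp_all add: pairs_def)

lemma pairs_one: "\<one>\<^bsub>pairs\<^esub> < s" "\<one>\<^bsub>pairs\<^esub> mod s1 = \<one>\<^bsub>\<Sigma>1\<^esub>" "\<one>\<^bsub>pairs\<^esub> div s1 = \<one>\<^bsub>\<Sigma>2\<^esub>"
  using combine[OF S1.one_closed S2.one_closed] by (simp_all add: pairs_def)

lemma group_pairs: "group pairs"
proof (rule group_transport)
  show "group (\<Sigma>1 \<times>\<times> \<Sigma>2)" by (rule DirProd_group[OF grp1 grp2])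
  then show "subgroup (carrier (\<Sigma>1 \<times>\<times> \<Sigma>2)) (\<Sigma>1 \<times>\<times> \<Sigma>2)" by (rule group.subgroup_self)
  show "bij_betw (\<lambda>v. (v mod s1, v div s1)) (carrier pairs) (carrier (\<Sigma>1 \<times>\<times> \<Sigma>2))"
    by (rule bij_betw_byWitness[where f' = "\<lambda>q. fst q + s1 * snd q"]) (auto simp: mod1 div2 combine simp del: mod_mult_self1 mod_mult_self2 mod_mult_self3 mod_mult_self4)
qed (simp_all add: pairs_mult pairs_one)

sublocale P: group pairs by (rule group_pairs)

section \<open>The graph of the map and the preimage of its image as group shifts\<close>

abbreviation "C1 \<equiv> cellwise_group G \<Sigma>1"
abbreviation "C2 \<equiv> cellwise_group G \<Sigma>2"

sublocale C1: group C1 unfolding cellwise_group_def by (rule product_group) (rule grp1)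
sublocale C2: group C2 unfolding cellwise_group_def by (rule product_group) (rule grp2)

lemma px_C1 [simp]: "px x \<in> carrier C1" and py_C2 [simp]: "x \<in> cfg s \<Longrightarrow> py x \<in> carrier C2"
  using px_mem py_mem by (simp_all add: cellwise_group_def car1 car2)

lemma px_mult: "x \<in> cfg s \<Longrightarrow> y \<in> cfg s \<Longrightarrow> px (\<lambda>p. x p \<otimes>\<^bsub>pairs\<^esub> y p) = px x \<otimes>\<^bsub>C1\<^esub> px y"
  and py_mult: "x \<in> cfg s \<Longrightarrow> y \<in> cfg s \<Longrightarrow> py (\<lambda>p. x p \<otimes>\<^bsub>pairs\<^esub> y p) = py x \<otimes>\<^bsub>C2\<^esub> py y"
  unfolding px_def py_def cellwise_group_def mult_product_group
  by (rule restrict_ext, simp add: pairs_mult cfg_def)+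

lemma px_one: "px (\<lambda>p. \<one>\<^bsub>pairs\<^esub>) = \<one>\<^bsub>C1\<^esub>" and py_one: "py (\<lambda>p. \<one>\<^bsub>pairs\<^esub>) = \<one>\<^bsub>C2\<^esub>"
  unfolding px_def py_def cellwise_group_def one_product_group
  by (rule restrict_ext, simp add: pairs_one)+

lemma cfg_pairs:
  "(\<lambda>p. \<one>\<^bsub>pairs\<^esub>) \<in> cfg s" "x \<in> cfg s \<Longrightarrow> y \<in> cfg s \<Longrightarrow> (\<lambda>p. x p \<otimes>\<^bsub>pairs\<^esub> y p) \<in> cfg s"
  "x \<in> cfg s \<Longrightarrow> (\<lambda>p. inv\<^bsub>pairs\<^esub> (x p)) \<in> cfg s"
proof -
  show "(\<lambda>p. inv\<^bsub>pairs\<^esub> (x p)) \<in> cfg s" if "x \<in> cfg s"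
    using that P.inv_closed by (simp add: cfg_def)
qed (simp_all add: cfg_def pairs_one pairs_mult)

lemma px_inv: "x \<in> cfg s \<Longrightarrow> px (\<lambda>p. inv\<^bsub>pairs\<^esub> (x p)) = inv\<^bsub>C1\<^esub> (px x)"
  and py_inv: "x \<in> cfg s \<Longrightarrow> py (\<lambda>p. inv\<^bsub>pairs\<^esub> (x p)) = inv\<^bsub>C2\<^esub> (py x)"
proof -
  assume x: "x \<in> cfg s"
  have "(\<lambda>p. inv\<^bsub>pairs\<^esub> (x p) \<otimes>\<^bsub>pairs\<^esub> x p) = (\<lambda>p. \<one>\<^bsub>pairs\<^esub>)"
    using x by (simp add: cfg_def)
  then have "px (\<lambda>p. inv\<^bsub>pairs\<^esub> (x p)) \<otimes>\<^bsub>C1\<^esub> px x = \<one>\<^bsub>C1\<^esub>" "py (\<lambda>p. inv\<^bsub>pairs\<^esub> (x p)) \<otimes>\<^bsub>C2\<^esub> py x = \<one>\<^bsub>C2\<^esub>"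
    using px_mult[OF cfg_pairs(3)[OF x] x] py_mult[OF cfg_pairs(3)[OF x] x] px_one py_one by simp_all
  then show "px (\<lambda>p. inv\<^bsub>pairs\<^esub> (x p)) = inv\<^bsub>C1\<^esub> (px x)" "py (\<lambda>p. inv\<^bsub>pairs\<^esub> (x p)) = inv\<^bsub>C2\<^esub> (py x)"
    using C1.inv_equality C2.inv_equality x cfg_pairs(3)[OF x] by simp_all
qed

lemma subgroup_X: "subgroup X C1" and subgroup_Y: "subgroup Y C2"
  using gX gY by (simp_all add: group_shift_def)

lemma f_mult: "x \<in> X \<Longrightarrow> y \<in> X \<Longrightarrow> f (x \<otimes>\<^bsub>C1\<^esub> y) = f x \<otimes>\<^bsub>C2\<^esub> f y"
  using hom by (auto simp: group_shift_hom_def hom_def)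

sublocale fhom: group_hom "C1\<lparr>carrier := X\<rparr>" "C2\<lparr>carrier := Y\<rparr>" f
proof (intro group_hom.intro group_hom_axioms.intro)
  show "group (C1\<lparr>carrier := X\<rparr>)" by (rule C1.subgroup_imp_group[OF subgroup_X])
  show "group (C2\<lparr>carrier := Y\<rparr>)" by (rule C2.subgroup_imp_group[OF subgroup_Y])
  show "f \<in> hom (C1\<lparr>carrier := X\<rparr>) (C2\<lparr>carrier := Y\<rparr>)" using hom by (simp add: group_shift_hom_def)
qed

lemma f_inv: "x \<in> X \<Longrightarrow> f (inv\<^bsub>C1\<^esub> x) = inv\<^bsub>C2\<^esub> f x"
  using fhom.hom_inv[of x] C1.m_inv_consistent[OF subgroup_X] C2.m_inv_consistent[OF subgroup_Y f_mem] by simp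

lemma sub_cfg_graph: "sub_cfg pairs (sol K (carrier K) s grc)"
  unfolding sub_cfg_def graph_iff
proof (intro conjI ballI; (elim conjE)?)
  show "py (\<lambda>p. \<one>\<^bsub>pairs\<^esub>) = f (px (\<lambda>p. \<one>\<^bsub>pairs\<^esub>))" using fhom.hom_one by (simp add: px_one py_one)
  show "px (\<lambda>p. \<one>\<^bsub>pairs\<^esub>) \<in> X" by (simp add: px_one subgroup.one_closed[OF subgroup_X])
next
  fix x y assume "x \<in> sol K (carrier K) s grc" "y \<in> sol K (carrier K) s grc"
  then have xy: "x \<in> cfg s" "px x \<in> X" "py x = f (px x)" "y \<in> cfg s" "px y \<in> X" "py y = f (px y)"
    by (simp_all add: graph_iff)
  show "px (\<lambda>p. x p \<otimes>\<^bsub>pairs\<^esub> y p) \<in> X" using xy by (simp add: px_mult subgroup.m_closed[OF subgroup_X])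
  show "py (\<lambda>p. x p \<otimes>\<^bsub>pairs\<^esub> y p) = f (px (\<lambda>p. x p \<otimes>\<^bsub>pairs\<^esub> y p))"
    using xy by (simp add: px_mult py_mult f_mult)
  show "(\<lambda>p. x p \<otimes>\<^bsub>pairs\<^esub> y p) \<in> cfg s" by (rule cfg_pairs(2)[OF xy(1,4)])
next
  fix x assume "x \<in> sol K (carrier K) s grc"
  then have x: "x \<in> cfg s" "px x \<in> X" "py x = f (px x)" by (simp_all add: graph_iff)
  show "px (\<lambda>p. inv\<^bsub>pairs\<^esub> x p) \<in> X" using x by (simp add: px_inv subgroup.m_inv_closed[OF subgroup_X])
  show "py (\<lambda>p. inv\<^bsub>pairs\<^esub> x p) = f (px (\<lambda>p. inv\<^bsub>pairs\<^esub> x p))" using x by (simp add: px_inv py_inv f_inv)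
  show "(\<lambda>p. inv\<^bsub>pairs\<^esub> x p) \<in> cfg s" by (rule cfg_pairs(3)[OF x(1)])
qed (rule cfg_pairs(1))

text \<open>\<open>Y\<close> pulled back along \<open>py\<close>: a closed invariant subgroup on the
  single layer 1, so \<open>markov\<close> describes it by one rule.\<close>

definition over_Y :: "config set" where "over_Y = {z \<in> cfg s. py z \<in> Y}"

lemma sub_cfg_over_Y: "sub_cfg pairs over_Y"
  unfolding sub_cfg_def over_Y_def
  by (auto simp: py_one py_mult py_inv cfg_pairs subgroup.one_closed[OF subgroup_Y]
      subgroup.m_closed[OF subgroup_Y] subgroup.m_inv_closed[OF subgroup_Y])

lemma closed_over_Y: "closed_cfg over_Y"
  unfolding closed_cfg_def
proof (intro allI impI)
  fix z assume approx: "\<forall>W. finite W \<longrightarrow> (\<exists>y\<in>over_Y. \<forall>p\<in>W. y p = z p)"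
  have "z p < s" for p
  proof -
    obtain y where "y \<in> over_Y" "y p = z p" using approx[rule_format, of "{p}"] by auto
    then show ?thesis by (metis (mono_tags, lifting) over_Y_def cfg_def mem_Collect_eq)
  qed
  then have z: "z \<in> cfg s" by (simp add: cfg_def)
  have "py z \<in> Y"
  proof (rule closedin_full_shift)
    show "closedin (full_shift_topology G (carrier \<Sigma>2)) Y" using gY by (simp add: group_shift_def subshift_def)
    show "py z \<in> carrier G \<rightarrow>\<^sub>E carrier \<Sigma>2" using py_mem[OF z] by (simp add: car2)
    fix W assume W: "finite W" "W \<subseteq> carrier G"
    then obtain y where y: "y \<in> over_Y" "\<And>p. p \<in> (\<lambda>g. (hi g, 1)) ` W \<Longrightarrow> y p = z p"
      using approx[rule_format, of "(\<lambda>g. (hi g, 1)) ` W"] by blast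
    have "py y g = py z g" if "g \<in> W" for g
      using y(2)[of "(hi g, 1)"] that W(2) by (auto simp: py_def)
    then show "\<exists>y'\<in>Y. \<forall>g\<in>W. y' g = py z g" using y(1) by (intro bexI[of _ "py y"]) (auto simp: over_Y_def)
  qed
  then show "z \<in> over_Y" using z by (simp add: over_Y_def)
qed

lemma act_inv_over_Y: "act_inv K (carrier K) over_Y"
  unfolding act_inv_def
proof (intro ballI)
  fix z k assume z: "z \<in> over_Y" and k: "k \<in> carrier K"
  have "py (\<lambda>p. z (act K k p)) = shift G (inv (h k)) (py z)"
    unfolding shift_def py_def[of "\<lambda>p. z (act K k p)"]
  proof (rule restrict_ext)
    fix g assume g: "g \<in> carrier G"
    have "py z (h (k \<otimes>\<^bsub>K\<^esub> hi g)) = z (k \<otimes>\<^bsub>K\<^esub> hi g, 1) div s1" by (rule py_h) (simp add: k g)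
    then show "z (act K k (hi g, 1)) div s1 = py z (inv (inv (h k)) \<otimes> g)" using k g by (simp add: act_def)
  qed
  moreover have "shift G (inv (h k)) (py z) \<in> Y"
    using gY z k by (simp add: group_shift_def subshift_def over_Y_def)
  ultimately show "(\<lambda>p. z (act K k p)) \<in> over_Y" using z by (simp add: over_Y_def cfg_compose)
qed

lemma dep_over_Y: "dep K snd s {1} over_Y"
  unfolding dep_def
proof (intro ballI impI)
  fix x y assume "x \<in> over_Y" "y \<in> cfg s" "agree K snd {1} x y"
  then show "y \<in> over_Y" using agree_py[of x y] by (simp add: over_Y_def)
qed

text \<open>\<open>markov\<close> gives a rule with words over the product alphabet, whereas a
  candidate restricts second components only. The gap is bridged by the fact that membership in
  \<open>over_Y\<close> does not depend on first components.\<close>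

lemma factor_complete:
  obtains D H where "\<forall>p\<in>set D. fst p \<in> carrier K \<and> snd p = 1" "distinct D"
    "exts K (carrier K) snd s {1} (factor_rules s1 s D H) grc"
    "sol K (carrier K) s grc \<subseteq> sol K (carrier K) s (factor_rules s1 s D H)"
    "sub_cfg pairs (sol K (carrier K) s (factor_rules s1 s D H))"
proof -
  have mk: "markov K (carrier K) snd" using goodK by (simp add: good_def)
  have sub: "over_Y \<subseteq> cfg s" by (auto simp: over_Y_def)
  obtain D0 H0 where D0: "on_cells K snd {1} [(D0, H0)]" and sol: "over_Y = sol K (carrier K) s [(D0, H0)]"
    by (rule markovD[OF mk group_pairs carrier_pairs _ sub closed_over_Y sub_cfg_over_Y act_inv_over_Y dep_over_Y]) simp
  define D where "D = remdups D0"
  have D: "\<forall>p\<in>set D. fst p \<in> carrier K \<and> snd p = 1" using D0 by (simp add: on_cells_def D_def)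
  let ?w = "\<lambda>z :: config. map (\<lambda>p. z p div s1) D"
  have "?w ` over_Y \<subseteq> {v. set v \<subseteq> {..<s2} \<and> length v = length D}"
    using subsetD[OF sub] by (auto simp: cfg_def intro!: div_s1)
  then have "finite (?w ` over_Y)" by (rule finite_subset) (simp add: finite_lists_length_eq)
  \<comment> \<open>The words that occur in points of \<open>over_Y\<close>, so that each of them
    comes with a full point to work with.\<close>
  from finite_list[OF this] obtain H where H: "set H = ?w ` over_Y" by (rule exE)
  have eq: "sol K (carrier K) s (factor_rules s1 s D H) = over_Y"
  proof (rule Set.set_eqI)
    fix z
    have iff: "z \<in> sol K (carrier K) s (factor_rules s1 s D H) \<longleftrightarrow> z \<in> cfg s \<and> (\<forall>k\<in>carrier K. ?w (\<lambda>p. z (act K k p)) \<in> set H)"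
    proof (cases "z \<in> cfg s")
      case True
      have "map (\<lambda>q. z (act K k q)) D \<in> set (List.n_lists (length D) [0..<s])" for k
        using True by (auto simp: set_n_lists cfg_def)
      then show ?thesis using True by (simp add: sol_def factor_rules_def o_def)
    qed (simp add: sol_def)
    show "z \<in> sol K (carrier K) s (factor_rules s1 s D H) \<longleftrightarrow> z \<in> over_Y"
    proof
      assume z: "z \<in> over_Y"
      then have "?w (\<lambda>p. z (act K k p)) \<in> set H" if "k \<in> carrier K" for k
        unfolding H by (rule imageI[OF act_invD[OF act_inv_over_Y _ that]])
      then show "z \<in> sol K (carrier K) s (factor_rules s1 s D H)" unfolding iff using subsetD[OF sub z] by blast
    next
      assume "z \<in> sol K (carrier K) s (factor_rules s1 s D H)"
      then have z: "z \<in> cfg s" "\<And>k. k \<in> carrier K \<Longrightarrow> ?w (\<lambda>p. z (act K k p)) \<in> ?w ` over_Y"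
        unfolding iff H by blast+
      have "map (\<lambda>p. z (act K k p)) D0 \<in> set H0" if k: "k \<in> carrier K" for k
      proof -
        obtain y where y: "y \<in> over_Y" "?w (\<lambda>p. z (act K k p)) = ?w y" using z(2)[OF k] by (rule imageE) 
        then have yD: "z (act K k p) div s1 = y p div s1" if "p \<in> set D0" for p
          using that unfolding map_eq_conv D_def by simp
        \<comment> \<open>Exchanging first components on \<open>D0\<close> keeps \<open>y\<close> in
          \<open>over_Y\<close>, so the word of \<open>z\<close> at \<open>k\<close> is the word of
          a point of \<open>over_Y\<close> and satisfies the rule.\<close>
        define y' where "y' p = (if p \<in> set D0 then z (act K k p) else y p)" for p
        have "py y' = py y" unfolding py_def by (rule restrict_ext) (simp add: y'_def yD)
        then have "y' \<in> over_Y" using y(1) z(1) by (simp add: over_Y_def cfg_def y'_def)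
        then have "map (\<lambda>p. y' (act K \<one>\<^bsub>K\<^esub> p)) D0 \<in> set H0"
          unfolding sol using solD[of y' K "carrier K" s "[(D0, H0)]" "\<one>\<^bsub>K\<^esub>" "(D0, H0)"] by simp
        moreover have "map (\<lambda>p. y' (act K \<one>\<^bsub>K\<^esub> p)) D0 = map (\<lambda>p. z (act K k p)) D0"
          by (intro map_cong refl) (simp add: y'_def K.is_group)
        ultimately show ?thesis by metis
      qed
      then show "z \<in> over_Y" unfolding sol using z(1) by (simp add: sol_def)
    qed
  qed
  show thesis
  proof (rule that[OF D])
    show "distinct D" by (simp add: D_def)
    show "sub_cfg pairs (sol K (carrier K) s (factor_rules s1 s D H))" unfolding eq by (rule sub_cfg_over_Y)
    show "sol K (carrier K) s grc \<subseteq> sol K (carrier K) s (factor_rules s1 s D H)"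
      unfolding eq
    proof
      fix x assume "x \<in> sol K (carrier K) s grc"
      then show "x \<in> over_Y" unfolding graph_iff over_Y_def using f_mem by simp
    qed
    show "exts K (carrier K) snd s {1} (factor_rules s1 s D H) grc"
      unfolding exts_def eq
    proof
      fix z assume "z \<in> over_Y"
      then have z: "z \<in> cfg s" "py z \<in> Y" by (simp_all add: over_Y_def)
      then obtain x where x: "x \<in> X" "py z = f x" using img by blast
      note m = merge_cfg[OF X_mem[OF x(1)] py_mem[OF z(1)]]
      \<comment> \<open>Layer 1 is copied from \<open>z\<close>, first components included, because
        agreement there is required for whole symbols.\<close>
      define v where "v p = (if snd p = 1 then z p else merge x (py z) p)" for p
      have "px v = x" using px_cong[of v "merge x (py z)"] m(2) by (simp add: v_def)
      moreover have "py v = py z" by (rule py_cong) (simp add: v_def)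
      moreover have "v \<in> cfg s" using z(1) m(1) by (simp add: v_def cfg_def)
      ultimately have v: "v \<in> sol K (carrier K) s grc" unfolding graph_iff using x by simp
      show "\<exists>v\<in>sol K (carrier K) s grc. agree K snd {1} v z"
        by (rule bexI[of _ v, OF _ v]) (simp add: agree_def v_def)
    qed
  qed
qed

section \<open>Certificates: existence and correctness\<close>

definition code :: "nat list" where
  "code = [table_code T1, patterns_code ds, table_code T2, rule_code r]"

lemma input_code: "input_code T1 ds T2 r = enc code"
  unfolding list_code_id[symmetric] by (simp add: input_code_def code_def list_code_def)

lemma cert_code: "cert C code y \<longleftrightarrow> (\<exists>D H. (\<forall>p\<in>set D. fst p \<in> carrier K \<and> snd p = 1) \<and> distinct D \<and>
    C (s, [1], factor_rules s1 s D H, grc) \<and> incl K (carrier K) (s, grc, factor_rules s1 s D H) \<and>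
    y = out_patterns s2 D H)"
  unfolding cert_def
  by (simp only: code_def list.sel table_code_enc patterns_code_nword rule_code_nword tlen_def dec_enc s1_def[symmetric]
      s2_def[symmetric] s_def[symmetric] grc_def)

lemma cert_exists:
  assumes "correct C" shows "\<exists>y. cert C code y"
proof -
  obtain D H where D: "\<forall>p\<in>set D. fst p \<in> carrier K \<and> snd p = 1" "distinct D"
    and ext: "exts K (carrier K) snd s {1} (factor_rules s1 s D H) grc"
    and sub: "sol K (carrier K) s grc \<subseteq> sol K (carrier K) s (factor_rules s1 s D H)"
    and grp: "sub_cfg pairs (sol K (carrier K) s (factor_rules s1 s D H))" by (rule factor_complete)
  note cells = on_cells_factor[OF D(1), of H]
  have one: "set [1::nat] = {1}" by simp
  have "C (s, [1], factor_rules s1 s D H, grc)"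
    by (rule correct_complete[OF assms on_cells_UNIV[OF cells] on_cells_graph group_pairs carrier_pairs _ grp sub_cfg_graph])
      (unfold one, rule cells, rule ext)
  moreover have "incl K (carrier K) (s, grc, factor_rules s1 s D H)"
    by (rule incl_complete[OF K.is_group K.subgroup_self _ sub]) (simp add: s_def s1_pos s2_pos)
  ultimately show ?thesis unfolding cert_code using D by blast
qed

lemma cert_correct:
  assumes "correct C" "cert C code y"
  obtains ds' F' where "enc y = patterns_code ds'" "patterns_describe G gs (carrier \<Sigma>2) ds' F'"
    "Y = shift_avoiding G (carrier \<Sigma>2) F'"
proof -
  obtain D H where D: "\<forall>p\<in>set D. fst p \<in> carrier K \<and> snd p = 1" "distinct D"
    and C: "C (s, [1], factor_rules s1 s D H, grc)" and inc: "incl K (carrier K) (s, grc, factor_rules s1 s D H)"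
    and y: "y = out_patterns s2 D H" using assms(2) unfolding cert_code by blast
  have "exts K (carrier K) snd s {1} (factor_rules s1 s D H) grc"
    using correct_sound[OF assms(1) on_cells_UNIV[OF on_cells_factor[OF D(1)]] on_cells_graph C] by simp
  then have "Y = allowed D H"
    by (rule factor_sound[OF D(1) _ incl_sound[OF K.is_group K.subgroup_self inc]])
  then show thesis using out_correct[OF D, of H] that unfolding y by metis
qed

end

theorem corollary9p3:
  fixes G :: "('g, 'b) monoid_scheme" and gs :: "'g list"
  assumes "polycyclic G"
    and "set gs \<subseteq> carrier G" and "generate G (set gs) = carrier G"
  shows "\<exists>A. partial_recursive 1 A \<and>
    (\<forall>\<Sigma>\<^sub>1 \<Sigma>\<^sub>2 X Y f F N \<phi> T\<^sub>1 T\<^sub>2 ds r.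
      table_describes T\<^sub>1 \<Sigma>\<^sub>1 \<and> table_describes T\<^sub>2 \<Sigma>\<^sub>2 \<and>
      patterns_describe G gs (carrier \<Sigma>\<^sub>1) ds F \<and>
      X = shift_avoiding G (carrier \<Sigma>\<^sub>1) F \<and> group_shift G \<Sigma>\<^sub>1 X \<and>
      group_shift G \<Sigma>\<^sub>2 Y \<and> group_shift_hom G \<Sigma>\<^sub>1 X \<Sigma>\<^sub>2 Y f \<and> f ` X = Y \<and>
      local_rule G (carrier \<Sigma>\<^sub>1) (carrier \<Sigma>\<^sub>2) X f N \<phi> \<and>
      rule_describes G gs (carrier \<Sigma>\<^sub>1) r N \<phi>
      \<longrightarrow> (\<exists>ds' F'.
            A [input_code T\<^sub>1 ds T\<^sub>2 r] = Some (patterns_code ds') \<and>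
            patterns_describe G gs (carrier \<Sigma>\<^sub>2) ds' F' \<and>
            Y = shift_avoiding G (carrier \<Sigma>\<^sub>2) F'))"
proof -
  obtain K h where K: "good K" "codes G K h (carrier G)" by (rule polycyclic_good[OF assms(1)])
  have "group G" using assms(1) by (simp add: polycyclic_def)
  then interpret coded_group G gs K h
    by (intro coded_group.intro coded_group_axioms.intro assms(2,3) K)
  have "\<exists>C. re_pred C \<and> correct C"
    using K(1) unfolding good_def ext_enum_def correct_def by (elim conjE)
  then obtain C where C: "re_pred C" "correct C" by (elim exE conjE)
  \<comment> \<open>\<open>A\<close> depends only on the chosen codes of the group, the generators
    and \<open>C\<close>, hence it serves all inputs at once.\<close>
  obtain A where A: "partial_recursive 1 A"
    "\<And>z. (\<exists>y. cert C z y) \<Longrightarrow> \<exists>y. cert C z y \<and> A [enc z] = Some (enc y)"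
    by (rule re_pred_search[OF re_pred_cert[OF C(1)]]) (rule that)
  show ?thesis
  proof (rule exI[of _ A], intro conjI allI impI A(1); elim conjE)
    fix \<Sigma>1 \<Sigma>2 X Y f F N \<phi> T1 T2 ds r
    assume a: "table_describes T1 \<Sigma>1" "table_describes T2 \<Sigma>2" "patterns_describe G gs (carrier \<Sigma>1) ds F"
      "X = shift_avoiding G (carrier \<Sigma>1) F" "group_shift G \<Sigma>1 X" "group_shift G \<Sigma>2 Y"
      "group_shift_hom G \<Sigma>1 X \<Sigma>2 Y f" "f ` X = Y"
      "local_rule G (carrier \<Sigma>1) (carrier \<Sigma>2) X f N \<phi>" "rule_describes G gs (carrier \<Sigma>1) r N \<phi>"
    interpret FP: factor_problem G gs K h \<Sigma>1 \<Sigma>2 X Y f F N \<phi> T1 T2 ds r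
      by (intro factor_problem.intro factor_problem_axioms.intro coded_group_axioms a)
    obtain y where y: "cert C FP.code y" "A [enc FP.code] = Some (enc y)"
      using A(2)[OF FP.cert_exists[OF C(2)]] by blast
    obtain ds' F' where "enc y = patterns_code ds'" "patterns_describe G gs (carrier \<Sigma>2) ds' F'"
      "Y = shift_avoiding G (carrier \<Sigma>2) F'"
      by (rule FP.cert_correct[OF C(2) y(1)])
    then show "\<exists>ds' F'. A [input_code T1 ds T2 r] = Some (patterns_code ds') \<and>
        patterns_describe G gs (carrier \<Sigma>2) ds' F' \<and> Y = shift_avoiding G (carrier \<Sigma>2) F'"
      using y(2) unfolding FP.input_code by (intro exI[of _ ds'] exI[of _ F']) simp
  qed
qed

end
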